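(* Suppose that problem (P) of the context has an optimal solution and that Slater's condition holds, i.e. there exist $\bm x_i\in\mathrm{ri}(\mathrm{dom}(h_i))$, $i=1,\dots,n$, with $\sum_{i=1}^{n-1}\mathcal A_i\bm x_i+\bm x_n=\bm b$. Let $\{\bm w^k\}$ be a sequence generated by Algorithm ALPDSN (described in the context). Then $$\lim_{k\to\infty}F(\bm w^k)=0.$$
   Context: Setting. Let $0\le n_1\le n-1$ be integers, $\mathcal I_1=\{1,\dots,n_1\}$, $\mathcal I_2=\{n_1+1,\dots,n\}$. Let $\mathcal X_1,\dots,\mathcal X_n,\mathcal Y$ be finite-dimensional real Euclidean spaces with $\mathcal X_n=\mathcal Y$, let $\mathcal A_i:\mathcal X_i\to\mathcal Y$ be linear for $i=1,\dots,n-1$ (with adjoint $\mathcal A_i^*$), and let $\bm b\in\mathcal Y$. For $i\in\mathcal I_1$, $h_i:\mathcal X_i\to\mathbb R$ is convex and twice continuously differentiable with Lipschitz continuous gradient; for $i\in\mathcal I_2$, $h_i:\mathcal X_i\to(-\infty,+\infty]$ is proper, closed and convex. Problem (P) is $$\min_{\bm x_1,\dots,\bm x_n}\ \sum_{i=1}^n h_i(\bm x_i)\quad\text{s.t.}\quad \sum_{i=1}^{n-1}\mathcal A_i\bm x_i+\bm x_n=\bm b.$$ Standing assumption: the proximal operators $\mathrm{prox}_{h_i}$ are semismooth (a locally Lipschitz map $G$ is semismooth at $\bm w$ if it is directionally differentiable at $\bm w$ and $\|G(\bm w+\bm d)-G(\bm w)-J\bm d\|=o(\|\bm d\|)$ as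 $\bm d\to0$, $J\in\partial G(\bm w+\bm d)$, with $\partial G$ the Clarke generalized Jacobian). Notation. $h^*$ is the Fenchel conjugate; $\mathrm{ri}$ the relative interior; $\mathrm{prox}_{th}(\bm x)=\arg\min_{\bm y}\{h(\bm y)+\frac1{2t}\|\bm y-\bm x\|^2\}$; $e_\sigma h(\bm x)=\min_{\bm y}\{h(\bm y)+\frac\sigma2\|\bm y-\bm x\|^2\}$. Write $\bm x=(\bm x_1,\dots,\bm x_{n-1})$, $\bm z=(\bm z_{n_1+1},\dots,\bm z_n)$ with $\bm z_i\in\mathcal X_i$, $\bm w=(\bm x,\bm z)$. Fix $\sigma>0$ and let $$\Phi(\bm w)=\sum_{i\in\mathcal I_1}h_i(\bm x_i)+\sum_{i\in\mathcal I_2\setminus\{n\}}e_\sigma h_i\Big(\bm x_i-\frac{\bm z_i}\sigma\Big)+e_\sigma h_n\Big(\bm b-\frac{\bm z_n}\sigma-\sum_{i=1}^{n-1}\mathcal A_i\bm x_i\Big)-\frac1{2\sigma}\sum_{i\in\mathcal I_2}\|\bm z_i\|^2,$$ which is continuously differentiable, and $F(\bm w)=(\nabla_{\bm x}\Phi(\bm w),\,-\nabla_{\bm z}\Phi(\bm w))$. Generalized Jacobian $\hat\partial F(\bm w)$: the set of all linear operators $J$ obtained by choosing $D_i\in\partial\,\mathrm{prox}_{\sigma h_i^*}(\sigma\bm x_i-\bm z_i)$ for $i\in\mathcal I_2\setminus\{n\}$ and $D_n\in\partial\,\mathrm{prox}_{\sigma h_n^*}(\sigma\bm b-\bm z_n-\sigma\sum_{j=1}^{n-1}\mathcal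 A_j\bm x_j)$ (Clarke generalized Jacobians), and setting, for $\bm d=(\bm d_{\bm x},\bm d_{\bm z})$ and $\bm s:=\bm d_{\bm z_n}+\sigma\sum_{j=1}^{n-1}\mathcal A_j\bm d_{\bm x_j}$, $$(J\bm d)_{\bm x_i}=\nabla^2h_i(\bm x_i)\bm d_{\bm x_i}+\mathcal A_i^*D_n\bm s\ (i\in\mathcal I_1),\qquad (J\bm d)_{\bm x_i}=D_i(\sigma\bm d_{\bm x_i}-\bm d_{\bm z_i})+\mathcal A_i^*D_n\bm s\ (i\in\mathcal I_2\setminus\{n\}),$$ $$(J\bm d)_{\bm z_i}=\tfrac1\sigma\bm d_{\bm z_i}+\tfrac1\sigma D_i(\sigma\bm d_{\bm x_i}-\bm d_{\bm z_i})\ (i\in\mathcal I_2\setminus\{n\}),\qquad (J\bm d)_{\bm z_n}=\tfrac1\sigma\bm d_{\bm z_n}-\tfrac1\sigma D_n\bm s.$$ Algorithm ALPDSN. Inputs: constants $\gamma>1$, $\nu\in(0,1)$, $\beta\in(1/2,1]$, $\kappa>0$, an integer $\zeta\ge1$, and an initial point $\bm w^0$. For $k=0,1,2,\dots$: choose $J^k\in\hat\partial F(\bm w^k)$; for integers $i\ge0$ set $\tau_{k,i}=\kappa\gamma^i\|F(\bm w^k)\|$, let $\bm d^{k,i}$ solve $(J^k+\tau_{k,i}I)\bm d^{k,i}=-F(\bm w^k)$ and put $\bar{\bm w}^{k,i}=\bm w^k+\bm d^{k,i}$; find the smallest integer $i\ge0$ for which $$\|F(\bar{\bm w}^{k,i})\|\le\nu\max_{\max(1,k-\zeta+1)\le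 j\le k}\|F(\bm w^j)\|\qquad\text{or}\qquad \tau_{k,i}\ge k^\beta$$ holds; set $\bm w^{k+1}=\bar{\bm w}^{k,i}$. (For $k=0$ the second condition holds trivially with $i=0$.) The sequence considered is infinite, the algorithm being run without termination, with $F(\bm w^k)\neq0$ for all $k$. *)

theory Defs
  imports "HOL-Analysis.Analysis"
begin

text \<open>
  Every finite-dimensional real Euclidean space is a linear subspace \<open>X\<close> of some ambient
  Euclidean type. All notions below are relative to such an \<open>X\<close> and do not depend on the values
  of the functions outside \<open>X\<close>. A linear operator on \<open>X\<close> is identified with its unique
  extension to the ambient space that vanishes on the orthogonal complement of \<open>X\<close>.
\<close>

section \<open>Calculus on a subspace\<close>

definition has_jacobian_on ::
  "'a::euclidean_space set \<Rightarrow> ('a \<Rightarrow> 'b::real_normed_vector) \<Rightarrow> 'a \<Rightarrow> ('a \<Rightarrow>\<^sub>L 'b) \<Rightarrow> bool" where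
  "has_jacobian_on X G u D \<longleftrightarrow>
     (G has_derivative blinfun_apply D) (at u within X) \<and>
     (\<forall>v\<in>orthogonal_comp X. blinfun_apply D v = 0)"

definition gradient_on :: "'a::euclidean_space set \<Rightarrow> ('a \<Rightarrow> real) \<Rightarrow> 'a \<Rightarrow> 'a" where
  "gradient_on X f u = (THE g. g \<in> X \<and> (f has_derivative (\<lambda>v. g \<bullet> v)) (at u within X))"

definition hessian_on :: "'a::euclidean_space set \<Rightarrow> ('a \<Rightarrow> real) \<Rightarrow> 'a \<Rightarrow> ('a \<Rightarrow>\<^sub>L 'a)" where
  "hessian_on X f u = (THE D. has_jacobian_on X (gradient_on X f) u D)"

definition C2_on :: "'a::euclidean_space set \<Rightarrow> ('a \<Rightarrow> real) \<Rightarrow> bool" where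
  "C2_on X f \<longleftrightarrow>
     (\<forall>u\<in>X. f differentiable (at u within X)) \<and>
     (\<forall>u\<in>X. gradient_on X f differentiable (at u within X)) \<and>
     continuous_on X (hessian_on X f)"

definition adjoint_on ::
  "'a::euclidean_space set \<Rightarrow> ('a \<Rightarrow> 'b::euclidean_space) \<Rightarrow> 'b \<Rightarrow> 'a" where
  "adjoint_on X A y = (THE v. v \<in> X \<and> (\<forall>u\<in>X. A u \<bullet> y = u \<bullet> v))"

definition clarke_jacobian ::
  "'a::euclidean_space set \<Rightarrow> ('a \<Rightarrow> 'b::real_normed_vector) \<Rightarrow> 'a \<Rightarrow> ('a \<Rightarrow>\<^sub>L 'b) set" where
  "clarke_jacobian X G w = convex hull
     {J. \<exists>u D. (\<forall>k::nat. u k \<in> X \<and> has_jacobian_on X G (u k) (D k)) \<and>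
               u \<longlonglongrightarrow> w \<and> D \<longlonglongrightarrow> J}"

definition locally_lipschitz_on ::
  "'a::euclidean_space set \<Rightarrow> ('a \<Rightarrow> 'b::real_normed_vector) \<Rightarrow> bool" where
  "locally_lipschitz_on X G \<longleftrightarrow> (\<forall>w\<in>X. \<exists>r>0. \<exists>L. L-lipschitz_on (X \<inter> ball w r) G)"

definition semismooth_on ::
  "'a::euclidean_space set \<Rightarrow> ('a \<Rightarrow> 'b::real_normed_vector) \<Rightarrow> bool" where
  "semismooth_on X G \<longleftrightarrow> locally_lipschitz_on X G \<and>
     (\<forall>w\<in>X.
        (\<forall>d\<in>X. \<exists>l. ((\<lambda>t. (G (w + t *\<^sub>R d) - G w) /\<^sub>R t) \<longlongrightarrow> l) (at_right 0)) \<and>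
        (\<forall>\<epsilon>>0. \<exists>\<delta>>0. \<forall>d\<in>X. norm d < \<delta> \<longrightarrow>
           (\<forall>J\<in>clarke_jacobian X G (w + d).
              norm (G (w + d) - G w - blinfun_apply J d) \<le> \<epsilon> * norm d)))"


section \<open>Convex analysis of extended-real-valued functions on a subspace\<close>

definition dom_on :: "'a set \<Rightarrow> ('a \<Rightarrow> ereal) \<Rightarrow> 'a set" where
  "dom_on X h = {x \<in> X. h x < \<infinity>}"

definition epigraph_on :: "'a set \<Rightarrow> ('a \<Rightarrow> ereal) \<Rightarrow> ('a \<times> real) set" where
  "epigraph_on X h = {(x, r). x \<in> X \<and> h x \<le> ereal r}"

definition proper_closed_convex_on :: "'a::euclidean_space set \<Rightarrow> ('a \<Rightarrow> ereal) \<Rightarrow> bool" where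
  "proper_closed_convex_on X h \<longleftrightarrow>
     (\<forall>x\<in>X. h x \<noteq> -\<infinity>) \<and> dom_on X h \<noteq> {} \<and>
     closed (epigraph_on X h) \<and> convex (epigraph_on X h)"

definition fenchel_conjugate :: "'a::euclidean_space set \<Rightarrow> ('a \<Rightarrow> ereal) \<Rightarrow> 'a \<Rightarrow> ereal" where
  "fenchel_conjugate X h y = (SUP x\<in>X. ereal (x \<bullet> y) - h x)"

definition prox :: "'a::euclidean_space set \<Rightarrow> real \<Rightarrow> ('a \<Rightarrow> ereal) \<Rightarrow> 'a \<Rightarrow> 'a" where
  "prox X t h x = arg_min (\<lambda>y. h y + ereal (1 / (2 * t) * (norm (y - x))\<^sup>2)) (\<lambda>y. y \<in> X)"

definition moreau_env :: "'a::euclidean_space set \<Rightarrow> real \<Rightarrow> ('a \<Rightarrow> ereal) \<Rightarrow> 'a \<Rightarrow> real" where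
  "moreau_env X \<sigma> h x =
     real_of_ereal (INF y\<in>X. h y + ereal (\<sigma> / 2 * (norm (y - x))\<^sup>2))"


section \<open>The optimization problem\<close>

text \<open>
  The blocks are indexed by a finite type \<open>'n\<close>. The distinguished element \<open>N\<close> is the last index
  \<open>n\<close>, so that \<open>X N\<close> is the space \<open>\<Y>\<close>; the set \<open>I1\<close> is the index set of the smooth
  functions and its complement is \<open>\<I>\<^sub>2\<close>.
\<close>

definition feasible ::
  "('n::finite \<Rightarrow> 'a::euclidean_space set) \<Rightarrow> 'n \<Rightarrow> ('n \<Rightarrow> 'a \<Rightarrow> 'a) \<Rightarrow> 'a \<Rightarrow> 'a ^ 'n \<Rightarrow> bool" where
  "feasible X N A b x \<longleftrightarrow> (\<forall>i. x $ i \<in> X i) \<and> (\<Sum>i\<in>UNIV - {N}. A i (x $ i)) + x $ N = b"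

definition optimal_solution ::
  "('n::finite \<Rightarrow> 'a::euclidean_space set) \<Rightarrow> 'n \<Rightarrow> ('n \<Rightarrow> 'a \<Rightarrow> ereal) \<Rightarrow> ('n \<Rightarrow> 'a \<Rightarrow> 'a) \<Rightarrow> 'a
     \<Rightarrow> 'a ^ 'n \<Rightarrow> bool" where
  "optimal_solution X N h A b x \<longleftrightarrow>
     is_arg_min (\<lambda>u. \<Sum>i\<in>UNIV. h i (u $ i)) (feasible X N A b) x"


section \<open>The saddle function and its generalized Jacobian\<close>

text \<open>
  The pairs \<open>(x, z)\<close>: the unused components, that is, the \<open>N\<close>-th one of \<open>x\<close> and those
  of \<open>z\<close> with index in \<open>I1\<close>, are fixed to zero. The product norm is the Euclidean norm of the
  remaining components.
\<close>

definition pd_space ::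
  "('n::finite \<Rightarrow> 'a::euclidean_space set) \<Rightarrow> 'n set \<Rightarrow> 'n \<Rightarrow> (('a ^ 'n) \<times> ('a ^ 'n)) set" where
  "pd_space X I1 N =
     {(x, z). (\<forall>i. i \<noteq> N \<longrightarrow> x $ i \<in> X i) \<and> x $ N = 0 \<and>
              (\<forall>i. i \<notin> I1 \<longrightarrow> z $ i \<in> X i) \<and> (\<forall>i\<in>I1. z $ i = 0)}"

definition Phi ::
  "('n::finite \<Rightarrow> 'a::euclidean_space set) \<Rightarrow> 'n set \<Rightarrow> 'n \<Rightarrow> ('n \<Rightarrow> 'a \<Rightarrow> ereal) \<Rightarrow> ('n \<Rightarrow> 'a \<Rightarrow> 'a)
     \<Rightarrow> 'a \<Rightarrow> real \<Rightarrow> ('a ^ 'n) \<times> ('a ^ 'n) \<Rightarrow> real" where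
  "Phi X I1 N h A b \<sigma> = (\<lambda>(x, z).
     (\<Sum>i\<in>I1. real_of_ereal (h i (x $ i)))
     + (\<Sum>i\<in>- I1 - {N}. moreau_env (X i) \<sigma> (h i) (x $ i - z $ i /\<^sub>R \<sigma>))
     + moreau_env (X N) \<sigma> (h N) (b - z $ N /\<^sub>R \<sigma> - (\<Sum>i\<in>UNIV - {N}. A i (x $ i)))
     - 1 / (2 * \<sigma>) * (\<Sum>i\<in>- I1. (norm (z $ i))\<^sup>2))"

definition F_map ::
  "('n::finite \<Rightarrow> 'a::euclidean_space set) \<Rightarrow> 'n set \<Rightarrow> 'n \<Rightarrow> ('n \<Rightarrow> 'a \<Rightarrow> ereal) \<Rightarrow> ('n \<Rightarrow> 'a \<Rightarrow> 'a)
     \<Rightarrow> 'a \<Rightarrow> real \<Rightarrow> ('a ^ 'n) \<times> ('a ^ 'n) \<Rightarrow> ('a ^ 'n) \<times> ('a ^ 'n)" where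
  "F_map X I1 N h A b \<sigma> w =
     (let g = gradient_on (pd_space X I1 N) (Phi X I1 N h A b \<sigma>) w in (fst g, - snd g))"

definition jac_op ::
  "('n::finite \<Rightarrow> 'a::euclidean_space set) \<Rightarrow> 'n set \<Rightarrow> 'n \<Rightarrow> ('n \<Rightarrow> 'a \<Rightarrow> ereal) \<Rightarrow> ('n \<Rightarrow> 'a \<Rightarrow> 'a)
     \<Rightarrow> real \<Rightarrow> ('n \<Rightarrow> 'a \<Rightarrow>\<^sub>L 'a) \<Rightarrow> ('a ^ 'n) \<times> ('a ^ 'n) \<Rightarrow> ('a ^ 'n) \<times> ('a ^ 'n) \<Rightarrow> ('a ^ 'n) \<times> ('a ^ 'n)" where
  "jac_op X I1 N h A \<sigma> D = (\<lambda>(x, z) (dx, dz).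
     let s = dz $ N + \<sigma> *\<^sub>R (\<Sum>j\<in>UNIV - {N}. A j (dx $ j)) in
     (\<chi> i. if i = N then 0
           else if i \<in> I1 then
             blinfun_apply (hessian_on (X i) (\<lambda>u. real_of_ereal (h i u)) (x $ i)) (dx $ i)
             + adjoint_on (X i) (A i) (blinfun_apply (D N) s)
           else
             blinfun_apply (D i) (\<sigma> *\<^sub>R dx $ i - dz $ i)
             + adjoint_on (X i) (A i) (blinfun_apply (D N) s),
      \<chi> i. if i = N then dz $ N /\<^sub>R \<sigma> - blinfun_apply (D N) s /\<^sub>R \<sigma>
           else if i \<in> I1 then 0
           else dz $ i /\<^sub>R \<sigma> + blinfun_apply (D i) (\<sigma> *\<^sub>R dx $ i - dz $ i) /\<^sub>R \<sigma>))"

definition gen_jacobian ::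
  "('n::finite \<Rightarrow> 'a::euclidean_space set) \<Rightarrow> 'n set \<Rightarrow> 'n \<Rightarrow> ('n \<Rightarrow> 'a \<Rightarrow> ereal) \<Rightarrow> ('n \<Rightarrow> 'a \<Rightarrow> 'a)
     \<Rightarrow> 'a \<Rightarrow> real \<Rightarrow> ('a ^ 'n) \<times> ('a ^ 'n) \<Rightarrow> (('a ^ 'n) \<times> ('a ^ 'n) \<Rightarrow> ('a ^ 'n) \<times> ('a ^ 'n)) set" where
  "gen_jacobian X I1 N h A b \<sigma> = (\<lambda>(x, z).
     {jac_op X I1 N h A \<sigma> D (x, z) | D.
        (\<forall>i\<in>- I1 - {N}. D i \<in> clarke_jacobian (X i)
            (prox (X i) \<sigma> (fenchel_conjugate (X i) (h i))) (\<sigma> *\<^sub>R x $ i - z $ i)) \<and>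
        D N \<in> clarke_jacobian (X N)
            (prox (X N) \<sigma> (fenchel_conjugate (X N) (h N)))
            (\<sigma> *\<^sub>R b - z $ N - \<sigma> *\<^sub>R (\<Sum>j\<in>UNIV - {N}. A j (x $ j)))})"


section \<open>The algorithm\<close>

text \<open>
  \<open>W\<close> is the space of iterates, \<open>\<J>\<close> a set-valued generalized Jacobian of \<open>F\<close>. At \<open>k = 0\<close>
  the index set of the maximum is empty, but there the second acceptance test always holds, as
  \<open>0 powr \<beta> = 0\<close>.
\<close>

definition lm_param :: "('w::euclidean_space \<Rightarrow> 'w) \<Rightarrow> real \<Rightarrow> real \<Rightarrow> (nat \<Rightarrow> 'w) \<Rightarrow> nat \<Rightarrow> nat \<Rightarrow> real" where
  "lm_param F \<kappa> \<gamma> w k i = \<kappa> * \<gamma> ^ i * norm (F (w k))"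

definition accepts ::
  "('w::euclidean_space \<Rightarrow> 'w) \<Rightarrow> real \<Rightarrow> real \<Rightarrow> real \<Rightarrow> real \<Rightarrow> nat \<Rightarrow> (nat \<Rightarrow> 'w) \<Rightarrow> nat \<Rightarrow> nat \<Rightarrow> 'w
     \<Rightarrow> bool" where
  "accepts F \<gamma> \<nu> \<beta> \<kappa> \<zeta> w k i d \<longleftrightarrow>
     norm (F (w k + d)) \<le> \<nu> * Max ((\<lambda>j. norm (F (w j))) ` {max 1 (k + 1 - \<zeta>)..k}) \<or>
     lm_param F \<kappa> \<gamma> w k i \<ge> real k powr \<beta>"

definition ALPDSN_sequence ::
  "'w::euclidean_space set \<Rightarrow> ('w \<Rightarrow> 'w) \<Rightarrow> ('w \<Rightarrow> ('w \<Rightarrow> 'w) set)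
     \<Rightarrow> real \<Rightarrow> real \<Rightarrow> real \<Rightarrow> real \<Rightarrow> nat \<Rightarrow> (nat \<Rightarrow> 'w) \<Rightarrow> bool" where
  "ALPDSN_sequence W F \<J> \<gamma> \<nu> \<beta> \<kappa> \<zeta> w \<longleftrightarrow>
     w 0 \<in> W \<and>
     (\<forall>k. \<exists>J\<in>\<J> (w k). \<exists>d i.
        (\<forall>j\<le>i. d j \<in> W \<and> J (d j) + lm_param F \<kappa> \<gamma> w k j *\<^sub>R d j = - F (w k)) \<and>
        accepts F \<gamma> \<nu> \<beta> \<kappa> \<zeta> w k i (d i) \<and>
        (\<forall>j<i. \<not> accepts F \<gamma> \<nu> \<beta> \<kappa> \<zeta> w k j (d j)) \<and>
        w (Suc k) = w k + d i)"

end

theory Submission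
  imports Defs
begin

text \<open>
  Let \<open>p\<^sub>i\<close> be the gradient of \<open>h\<^sub>i\<close> or of its Moreau envelope at the current point. The
  components of \<open>F\<close> are \<open>p\<^sub>i - A\<^sub>i\<^sup>* p\<^sub>n\<close> and \<open>(p\<^sub>i + z\<^sub>i) / \<sigma>\<close>. Firm nonexpansiveness of the proximal maps
  makes \<open>F\<close> monotone with a dissipation that controls the \<open>z\<close>-components of \<open>F\<close> and the gradients of the
  smooth \<open>h\<^sub>i\<close>, but not the \<open>x\<close>-components. Up to the dissipation, however, \<open>F w\<close> equals \<open>M (w - w\<^sup>*)\<close> for
  a zero \<open>w\<^sup>*\<close> of \<open>F\<close> (which exists by Lagrange duality) and a linear map \<open>M\<close> that depends on \<open>z\<close> alone,
  so that \<open>M (F w)\<close> is again controlled by the dissipation.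

  A step with large \<open>\<tau>\<close> is an explicit Euler step \<open>- F w / \<tau>\<close> up to \<open>O (\<parallel>F w\<parallel> / \<tau>\<^sup>2)\<close>, because the generalized
  Jacobians are uniformly bounded. Monotonicity shows that it increases \<open>\<parallel>F\<parallel>\<^sup>2\<close> by a factor of at most
  \<open>1 + O (k powr (- 2 * \<beta>))\<close>, which is summable as \<open>\<beta> > 1/2\<close>. Hence infinitely many steps of the first kind
  force \<open>F \<rightarrow> 0\<close>. Otherwise \<open>\<tau>\<close> is eventually of order \<open>k powr \<beta>\<close>, and if \<open>\<parallel>F\<parallel>\<close> stayed away from zero,
  then \<open>M (w - w\<^sup>*) \<bullet> (w - w\<^sup>*)\<close> plus a multiple of \<open>\<parallel>w - w\<^sup>*\<parallel>\<^sup>2\<close> would decrease by a multiple of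
  \<open>k powr (- \<beta>)\<close> in every step; this series diverges as \<open>\<beta> \<le> 1\<close>, while the iterates are bounded.
\<close>

section \<open>Nonmonotone descent of real sequences\<close>

text \<open>If all terms from some index on are at most \<open>B\<close>, one contracting step whose
  window lies beyond that index gives a term at most \<open>\<theta> * B\<close>. No later step can
  leave this bound, whichever alternative it satisfies. Infinitely many contractions allow iteration
  of this argument.\<close>

lemma nonmonotone_descent_tendsto_0:
  fixes s :: "nat \<Rightarrow> real"
  assumes nonneg: "\<And>k. 0 \<le> s k" and \<theta>: "0 \<le> \<theta>" "\<theta> < 1" and \<zeta>: "\<zeta> \<ge> 1"
    and step: "\<And>k. k \<ge> K \<Longrightarrow>
      s (Suc k) \<le> s k \<or> s (Suc k) \<le> \<theta> * Max (s ` {max 1 (k + 1 - \<zeta>)..k})"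
    and inf: "\<exists>\<^sub>\<infinity>k. s (Suc k) \<le> \<theta> * Max (s ` {max 1 (k + 1 - \<zeta>)..k})"
  shows "s \<longlonglongrightarrow> 0"
proof -
  have window: "Max (s ` {max 1 (k + 1 - \<zeta>)..k}) \<le> B"
    if "\<And>j. k + 1 - \<zeta> \<le> j \<Longrightarrow> j \<le> k \<Longrightarrow> s j \<le> B" "k \<ge> 1" for k B
    using that \<zeta> by (subst Max_le_iff) auto
  \<comment> \<open>Ending the initial segment at \<open>Suc K\<close> makes every later index a
    successor of some \<open>m\<close> with \<open>m \<ge> 1\<close>, so that its window is
    nonempty.\<close>
  define M where "M = Max (s ` {..Suc K})"
  have bounded: "s k \<le> M" for k
  proof (induction k rule: less_induct)
    case (less k)
    show ?case
    proof (cases "k \<le> Suc K")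
      case True
      then show ?thesis unfolding M_def by (intro Max_ge) auto
    next
      case False
      then obtain m where m: "k = Suc m" "m \<ge> K" "m \<ge> 1" by (cases k) auto
      have sm: "s m \<le> M" using less m by simp
      have M0: "0 \<le> M" using sm nonneg[of m] by linarith
      have "Max (s ` {max 1 (m + 1 - \<zeta>)..m}) \<le> M"
        using m less by (intro window) auto
      then have "\<theta> * Max (s ` {max 1 (m + 1 - \<zeta>)..m}) \<le> 1 * M"
        using \<theta> M0 by (meson less_eq_real_def mult_left_mono mult_right_mono order_trans)
      then show ?thesis using step[OF m(2)] sm m by auto
    qed
  qed
  have shrink: "\<exists>k1. \<forall>k\<ge>k1. s k \<le> \<theta> * B" if B: "\<forall>k\<ge>k0. s k \<le> B" for B k0
  proof -
    \<comment> \<open>The summand \<open>\<zeta>\<close> pushes the whole window of \<open>m\<close>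
      beyond \<open>k0\<close>; the summand \<open>K\<close> makes the step hypothesis
      available.\<close>
    obtain m where m: "m \<ge> k0 + \<zeta> + K"
        "s (Suc m) \<le> \<theta> * Max (s ` {max 1 (m + 1 - \<zeta>)..m})"
      using inf unfolding INFM_nat_le by meson
    have W: "\<theta> * Max (s ` {max 1 (j + 1 - \<zeta>)..j}) \<le> \<theta> * B" if "j \<ge> m" for j
      using that m \<zeta> B \<theta> by (intro mult_left_mono window) auto
    have "s k \<le> \<theta> * B" if "k \<ge> Suc m" for k
      using that
    proof (induction k rule: dec_induct)
      case base
      then show ?case using m W[of m] by linarith
    next
      case (step n)
      then show ?case using assms(5)[of n] W[of n] m by fastforce
    qed
    then show ?thesis by blast
  qed
  have "\<exists>k0. \<forall>k\<ge>k0. s k \<le> \<theta> ^ n * M" for n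
  proof (induction n)
    case 0
    then show ?case using bounded by simp
  next
    case (Suc n)
    then show ?case using shrink by (fastforce simp: mult.assoc)
  qed
  note geo = this
  have lim: "(\<lambda>n. \<theta> ^ n * M) \<longlonglongrightarrow> 0"
    using \<theta> by (intro tendsto_mult_left_zero LIMSEQ_power_zero) auto
  show ?thesis
  proof (rule LIMSEQ_I)
    fix r :: real assume "r > 0"
    then obtain n where n: "\<theta> ^ n * M < r"
      using order_tendstoD(2)[OF lim] by (auto simp: eventually_sequentially)
    obtain k0 where "\<forall>k\<ge>k0. s k \<le> \<theta> ^ n * M" using geo by blast
    then show "\<exists>no. \<forall>k\<ge>no. norm (s k - 0) < r"
      using n nonneg by (intro exI[of _ k0]) force
  qed
qed

section \<open>Sequences with summable perturbations\<close>

lemma prod_one_plus_bounded: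
  fixes c :: "nat \<Rightarrow> real"
  assumes "summable c" "\<And>k. 0 \<le> c k"
  shows "(\<Prod>j<k. 1 + c j) \<le> exp (suminf c)"
proof -
  have "(\<Prod>j<k. 1 + c j) \<le> (\<Prod>j<k. exp (c j))"
    using assms(2) by (intro prod_mono) (auto simp: exp_ge_add_one_self add_nonneg_nonneg)
  also have "\<dots> = exp (\<Sum>j<k. c j)" by (simp add: exp_sum)
  also have "\<dots> \<le> exp (suminf c)" using assms by (simp add: sum_le_suminf)
  finally show ?thesis .
qed

text \<open>A discrete Gronwall argument. The product may start at 0 instead of \<open>K\<close>,
  since the additional factors are at least 1.\<close>

lemma almost_monotone_bounded:
  fixes r c :: "nat \<Rightarrow> real"
  assumes "summable c" "\<And>k. 0 \<le> c k" "\<And>k. 0 \<le> r k"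
    and step: "\<And>k. k \<ge> K \<Longrightarrow> r (Suc k) \<le> (1 + c k) * r k"
  shows "\<exists>B. \<forall>k\<ge>K. r k \<le> B"
proof -
  have P: "(\<Prod>j<k. 1 + c j) > 0" for k using assms(2) by (intro prod_pos) (simp add: add_pos_nonneg)
  have P1: "(\<Prod>j<k. 1 + c j) \<ge> 1" for k using assms(2) by (intro prod_ge_1) simp
  have "r k \<le> r K * (\<Prod>j<k. 1 + c j)" if "k \<ge> K" for k
    using that
  proof (induction k rule: dec_induct)
    case base
    show ?case using mult_left_mono[OF P1[of K] assms(3)[of K]] by simp
  next
    case (step n)
    have "r (Suc n) \<le> (1 + c n) * (r K * (\<Prod>j<n. 1 + c j))"
      using assms(4)[OF step(1)] mult_left_mono[OF step.IH, of "1 + c n"] assms(2)[of n]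
      by linarith
    then show ?case by (simp add: mult_ac)
  qed
  moreover have "r K * (\<Prod>j<k. 1 + c j) \<le> r K * exp (suminf c)" for k
    using prod_one_plus_bounded[OF assms(1,2)] assms(3) by (intro mult_left_mono) auto
  ultimately show ?thesis by (meson order_trans)
qed

text \<open>Summing the decrease bounds the partial sums of \<open>k powr - \<beta>\<close>, because
  the error terms are summable for \<open>2 * \<beta> > 1\<close> and \<open>E\<close> is bounded
  below. For \<open>\<beta> \<le> 1\<close> the series diverges.\<close>

lemma lyapunov_contradiction:
  fixes E :: "nat \<Rightarrow> real"
  assumes dec: "\<And>k. k \<ge> K \<Longrightarrow> E (Suc k) \<le> E k - a * real k powr - \<beta> + c * real k powr - (2 * \<beta>)"
    and "a > 0" "\<beta> \<le> 1" "1 / 2 < \<beta>" and low: "\<And>k. k \<ge> K \<Longrightarrow> m \<le> E k" and "c \<ge> 0"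
  shows False
proof -
  define S where "S = (\<Sum>k. real k powr - (2 * \<beta>))"
  have sm: "summable (\<lambda>k. real k powr - (2 * \<beta>))"
    using assms by (subst summable_real_powr_iff) auto
  have "(\<Sum>k<n. real (k + K) powr - \<beta>) \<le> (E K - m + c * S) / a" for n
  proof -
    have "E (n + K) \<le> E K - a * (\<Sum>k<n. real (k + K) powr - \<beta>)
        + c * (\<Sum>k<n. real (k + K) powr - (2 * \<beta>))"
    proof (induction n)
      case (Suc n)
      then show ?case using dec[of "n + K"] by (simp add: algebra_simps)
    qed simp
    moreover have "(\<Sum>k<n. real (k + K) powr - (2 * \<beta>)) \<le> S"
    proof -
      have "(\<Sum>k<n. real (k + K) powr - (2 * \<beta>)) = (\<Sum>k\<in>{K..<n + K}. real k powr - (2 * \<beta>))"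
        by (rule sum.reindex_bij_witness[of _ "\<lambda>k. k - K" "\<lambda>k. k + K"]) auto
      also have "\<dots> \<le> S" unfolding S_def by (rule sum_le_suminf[OF sm]) auto
      finally show ?thesis .
    qed
    moreover have "m \<le> E (n + K)" by (intro low) simp
    ultimately have "a * (\<Sum>k<n. real (k + K) powr - \<beta>) \<le> E K - m + c * S"
      using \<open>c \<ge> 0\<close> by (smt (verit) mult_left_mono)
    then show ?thesis using \<open>a > 0\<close> by (simp add: pos_le_divide_eq mult.commute)
  qed
  then have "summable (\<lambda>k. real (k + K) powr - \<beta>)"
    by (intro summableI_nonneg_bounded) auto
  then have "summable (\<lambda>k. real k powr - \<beta>)"
    using summable_iff_shift[of "\<lambda>k. real k powr - \<beta>" K] by simp
  then show False using assms by (subst (asm) summable_real_powr_iff) auto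
qed

section \<open>Long regularized steps\<close>

text \<open>Here \<open>Jd\<close> is the value of the generalized Jacobian at \<open>d\<close>.
  Solving the equation for \<open>\<tau> *\<^sub>R d\<close>, the term \<open>Jd\<close> is absorbed
  by \<open>L \<le> \<tau> / 2\<close>. Inserting the resulting bound on \<open>d\<close> into
  \<open>Jd\<close> shows that \<open>d\<close> is the Euler step up to second order.\<close>

lemma regularized_step_bounds:
  fixes d :: "'w::real_inner"
  assumes eq: "Jd + \<tau> *\<^sub>R d = - f" and J: "norm Jd \<le> L * norm d"
    and "0 < \<tau>" "2 * L \<le> \<tau>" "0 \<le> L"
  shows "norm d \<le> 2 * norm f / \<tau>" "norm (d + f /\<^sub>R \<tau>) \<le> 2 * L * norm f / \<tau>\<^sup>2"
proof -
  have "\<tau> * norm d = norm (- f - Jd)"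
    using eq \<open>0 < \<tau>\<close> by (metis abs_of_pos add_diff_cancel_left' norm_scaleR)
  also have "\<dots> \<le> norm f + norm Jd" using norm_triangle_ineq4[of "- f" Jd] by simp
  also have "\<dots> \<le> norm f + L * norm d" using J by simp
  also have "\<dots> \<le> norm f + \<tau> / 2 * norm d"
    using mult_right_mono[of "2 * L" \<tau> "norm d"] \<open>2 * L \<le> \<tau>\<close> by simp
  finally show d: "norm d \<le> 2 * norm f / \<tau>"
    using \<open>0 < \<tau>\<close> by (simp add: field_simps)
  have "\<tau> *\<^sub>R (d + f /\<^sub>R \<tau>) = - Jd"
    using eq \<open>0 < \<tau>\<close> by (simp add: scaleR_right_distrib eq_neg_iff_add_eq_0 add_ac)
  then have "\<tau> * norm (d + f /\<^sub>R \<tau>) = norm Jd"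
    by (metis \<open>0 < \<tau>\<close> abs_of_pos norm_minus_cancel norm_scaleR)
  also have "\<dots> \<le> L * (2 * norm f / \<tau>)"
    using J d \<open>0 \<le> L\<close> by (meson mult_left_mono order_trans)
  finally show "norm (d + f /\<^sub>R \<tau>) \<le> 2 * L * norm f / \<tau>\<^sup>2"
    using \<open>0 < \<tau>\<close> by (simp add: field_simps power2_eq_square)
qed

text \<open>Monotonicity controls the increment only against \<open>d\<close>, not against
  \<open>f\<close>. Since \<open>f = \<tau> *\<^sub>R (e - d)\<close> with a second-order
  \<open>e\<close>, the cross term of the expanded square becomes a small term minus a nonnegative
  one. The constant is 12 = 2 * 4 + 4, from the cross term and the squared increment.\<close>

lemma regularized_step_residual:
  fixes d :: "'w::real_inner"
  assumes eq: "Jd + \<tau> *\<^sub>R d = - f" and J: "norm Jd \<le> L * norm d"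
    and \<tau>: "0 < \<tau>" "2 * L \<le> \<tau>" "0 \<le> L"
    and mono: "0 \<le> (f' - f) \<bullet> d" and lip: "norm (f' - f) \<le> L * norm d"
  shows "(norm f')\<^sup>2 \<le> (1 + 12 * L\<^sup>2 / \<tau>\<^sup>2) * (norm f)\<^sup>2"
proof -
  note b = regularized_step_bounds[OF eq J \<tau>]
  define e where "e = d + f /\<^sub>R \<tau>"
  have lf: "norm (f' - f) \<le> 2 * L * norm f / \<tau>"
    using order_trans[OF lip mult_left_mono[OF b(1) \<tau>(3)]] by (simp add: mult_ac)
  have "\<tau> * ((f' - f) \<bullet> e) = \<tau> * ((f' - f) \<bullet> d) + (f' - f) \<bullet> f"
    unfolding e_def using \<tau> by (simp add: inner_add_right distrib_left)
  then have "(f' - f) \<bullet> f = \<tau> * ((f' - f) \<bullet> e) - \<tau> * ((f' - f) \<bullet> d)" by simp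
  also have "\<dots> \<le> \<tau> * ((f' - f) \<bullet> e)" using mono \<tau> by simp
  also have "\<dots> \<le> \<tau> * (norm (f' - f) * norm e)"
    using \<tau> by (simp add: norm_cauchy_schwarz)
  also have "\<dots> \<le> \<tau> * ((2 * L * norm f / \<tau>) * (2 * L * norm f / \<tau>\<^sup>2))"
    using \<tau> lf b(2) unfolding e_def by (intro mult_left_mono mult_mono) auto
  also have "\<dots> = 4 * L\<^sup>2 / \<tau>\<^sup>2 * (norm f)\<^sup>2"
    using \<tau> by (simp add: power2_eq_square field_simps)
  finally have 1: "(f' - f) \<bullet> f \<le> 4 * L\<^sup>2 / \<tau>\<^sup>2 * (norm f)\<^sup>2" .
  have 2: "(norm (f' - f))\<^sup>2 \<le> 4 * L\<^sup>2 / \<tau>\<^sup>2 * (norm f)\<^sup>2"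
    using power_mono[OF lf norm_ge_zero, of 2] by (simp add: power_mult_distrib power_divide)
  have "(norm f')\<^sup>2 = (norm f)\<^sup>2 + 2 * ((f' - f) \<bullet> f) + (norm (f' - f))\<^sup>2"
    by (simp add: power2_norm_eq_inner inner_diff algebra_simps inner_commute)
  also have "\<dots> \<le> (1 + 12 * L\<^sup>2 / \<tau>\<^sup>2) * (norm f)\<^sup>2"
    using 1 2 by (simp add: algebra_simps)
  finally show ?thesis .
qed

text \<open>Meant for \<open>u\<close> the difference between the iterate and a zero of
  \<open>F\<close>. The first-order term is kept exactly, as it is the dissipation to be exploited
  later; the rest is of order \<open>1 / \<tau>\<^sup>2\<close>.\<close>

lemma regularized_step_distance:
  fixes d :: "'w::real_inner"
  assumes eq: "Jd + \<tau> *\<^sub>R d = - f" and J: "norm Jd \<le> L * norm d"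
    and \<tau>: "0 < \<tau>" "2 * L \<le> \<tau>" "0 \<le> L" and f: "norm f \<le> L * norm u"
  shows "(norm (u + d))\<^sup>2 \<le> (1 + 8 * L\<^sup>2 / \<tau>\<^sup>2) * (norm u)\<^sup>2 - 2 / \<tau> * (f \<bullet> u)"
proof -
  note b = regularized_step_bounds[OF eq J \<tau>]
  define e where "e = d + f /\<^sub>R \<tau>"
  have d: "norm d \<le> 2 * (L * norm u) / \<tau>"
    using b(1) f \<tau> by (smt (verit) divide_right_mono mult_left_mono)
  have "norm e \<le> 2 * L * (L * norm u) / \<tau>\<^sup>2"
    using b(2) unfolding e_def
    by (rule order_trans) (use f \<tau> in \<open>auto intro!: divide_right_mono mult_left_mono\<close>)
  then have "u \<bullet> e \<le> norm u * (2 * L * (L * norm u) / \<tau>\<^sup>2)"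
    by (meson mult_left_mono norm_cauchy_schwarz norm_ge_zero order_trans)
  also have "\<dots> = 2 * L\<^sup>2 / \<tau>\<^sup>2 * (norm u)\<^sup>2" by (simp add: power2_eq_square)
  finally have 1: "u \<bullet> e \<le> 2 * L\<^sup>2 / \<tau>\<^sup>2 * (norm u)\<^sup>2" .
  have 2: "(norm d)\<^sup>2 \<le> 4 * L\<^sup>2 / \<tau>\<^sup>2 * (norm u)\<^sup>2"
    using power_mono[OF d norm_ge_zero, of 2] by (simp add: power_mult_distrib power_divide)
  have "u \<bullet> d = u \<bullet> e - (f \<bullet> u) / \<tau>"
    unfolding e_def by (simp add: inner_add_right inner_commute divide_inverse_commute)
  moreover have "(norm (u + d))\<^sup>2 = (norm u)\<^sup>2 + 2 * (u \<bullet> d) + (norm d)\<^sup>2"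
    by (simp add: power2_norm_eq_inner inner_add algebra_simps inner_commute)
  moreover have "(1 + 8 * L\<^sup>2 / \<tau>\<^sup>2) * (norm u)\<^sup>2
      = (norm u)\<^sup>2 + 2 * (2 * L\<^sup>2 / \<tau>\<^sup>2 * (norm u)\<^sup>2) + 4 * L\<^sup>2 / \<tau>\<^sup>2 * (norm u)\<^sup>2"
    by (simp add: algebra_simps)
  ultimately show ?thesis using 1 2 by simp
qed

text \<open>Second-order expansion of the quadratic form of \<open>M\<close> along
  \<open>d = e - f /\<^sub>R \<tau>\<close>. Both mixed terms appear because \<open>M\<close> need
  not be symmetric.\<close>

lemma regularized_step_quadratic:
  fixes d :: "'w::real_inner"
  assumes eq: "Jd + \<tau> *\<^sub>R d = - f" and J: "norm Jd \<le> L * norm d"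
    and \<tau>: "0 < \<tau>" "2 * L \<le> \<tau>" "0 \<le> L" and f: "norm f \<le> B" and u: "norm u \<le> R"
    and M: "linear M" "\<And>v. norm (M v) \<le> m * norm v" and m: "0 \<le> m"
  shows "M (u + d) \<bullet> (u + d) \<le> M u \<bullet> u - (M f \<bullet> u + M u \<bullet> f) / \<tau>
           + (4 * m * R * L * B + 4 * m * B\<^sup>2) / \<tau>\<^sup>2"
proof -
  note b = regularized_step_bounds[OF eq J \<tau>]
  interpret linear M by fact
  define e where "e = d + f /\<^sub>R \<tau>"
  have B: "0 \<le> B" and R: "0 \<le> R" using f u norm_ge_zero order_trans by blast+
  have d: "norm d \<le> 2 * B / \<tau>"
    using b(1) by (rule order_trans) (use f \<tau> in \<open>auto intro!: divide_right_mono\<close>)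
  have e: "norm e \<le> 2 * L * B / \<tau>\<^sup>2"
    using b(2) unfolding e_def
    by (rule order_trans) (use f \<tau> in \<open>auto intro!: divide_right_mono mult_left_mono\<close>)
  have Mi: "M v \<bullet> v' \<le> m * norm v * norm v'" for v v'
    by (meson M(2) mult_right_mono norm_cauchy_schwarz norm_ge_zero order_trans)
  have "M d \<bullet> d \<le> m * (2 * B / \<tau>) * (2 * B / \<tau>)"
    using d m B \<tau> by (intro order_trans[OF Mi] mult_mono mult_nonneg_nonneg) auto
  then have 1: "M d \<bullet> d \<le> 4 * m * B\<^sup>2 / \<tau>\<^sup>2" by (simp add: power2_eq_square)
  have "M e \<bullet> u \<le> m * (2 * L * B / \<tau>\<^sup>2) * R"
    using e u m B R \<tau> by (intro order_trans[OF Mi] mult_mono mult_nonneg_nonneg) auto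
  moreover have "M u \<bullet> e \<le> m * R * (2 * L * B / \<tau>\<^sup>2)"
    using e u m B R \<tau> by (intro order_trans[OF Mi] mult_mono mult_nonneg_nonneg) auto
  moreover have "m * (2 * L * B / \<tau>\<^sup>2) * R + m * R * (2 * L * B / \<tau>\<^sup>2) = 4 * m * R * L * B / \<tau>\<^sup>2"
    by (simp add: field_simps)
  ultimately have 2: "M e \<bullet> u + M u \<bullet> e \<le> 4 * m * R * L * B / \<tau>\<^sup>2"
    by linarith
  have de: "d = e - f /\<^sub>R \<tau>" by (simp add: e_def)
  have "M d \<bullet> u + M u \<bullet> d = M e \<bullet> u + M u \<bullet> e - (M f \<bullet> u + M u \<bullet> f) / \<tau>"
    unfolding de by (simp add: diff scale inner_diff_left inner_diff_right divide_inverse algebra_simps)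
  moreover have "M (u + d) \<bullet> (u + d) = M u \<bullet> u + (M d \<bullet> u + M u \<bullet> d) + M d \<bullet> d"
    by (simp add: add inner_add_left inner_add_right)
  ultimately show ?thesis using 1 2 by (simp add: add_divide_distrib)
qed

text \<open>
  The quadratic form of \<open>M\<close> strictly decreases along the flow \<open>u' = - F u\<close> as long as the
  dissipation \<open>f \<bullet> u\<close> is small compared with \<open>\<parallel>f\<parallel>\<close>; hence a multiple of \<open>\<parallel>u\<parallel>\<^sup>2\<close> compensates it.
\<close>

lemma flow_derivative_bound:
  fixes f :: "'w::real_inner"
  assumes M1: "(norm (f - M u))\<^sup>2 \<le> C * (f \<bullet> u)" and M2: "(norm (M f))\<^sup>2 \<le> C * (f \<bullet> u)"
    and u: "norm u \<le> R" and l: "0 < l" "l \<le> (norm f)\<^sup>2"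
  shows "l / 4 - (C / 2 + R\<^sup>2 * C / l) * (f \<bullet> u) \<le> M f \<bullet> u + M u \<bullet> f"
proof -
  have R: "0 \<le> R" using u norm_ge_zero order_trans by blast
  \<comment> \<open>Splitting the product evenly leaves half of the squared norm of \<open>f\<close>
    for the lower bound on \<open>M u \<bullet> f\<close>.\<close>
  have "(f - M u) \<bullet> f \<le> norm (f - M u) * norm f" by (rule norm_cauchy_schwarz)
  also have "\<dots> \<le> (norm (f - M u))\<^sup>2 / 2 + (norm f)\<^sup>2 / 2"
    using sum_squares_bound[of "norm (f - M u)" "norm f"] by simp
  finally have "(norm f)\<^sup>2 - M u \<bullet> f \<le> (norm (f - M u))\<^sup>2 / 2 + (norm f)\<^sup>2 / 2"
    by (simp only: inner_diff_left power2_norm_eq_inner)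
  then have "(norm f)\<^sup>2 - M u \<bullet> f \<le> C * (f \<bullet> u) / 2 + (norm f)\<^sup>2 / 2"
    using M1 by linarith
  then have 1: "l / 2 - C / 2 * (f \<bullet> u) \<le> M u \<bullet> f" using l by simp
  have "- (M f \<bullet> u) \<le> norm (M f) * norm u" using norm_cauchy_schwarz[of "- M f" u] by simp
  also have "\<dots> \<le> norm (M f) * R" using u by (intro mult_left_mono) auto
  also have "\<dots> \<le> l / 4 + R\<^sup>2 / l * (norm (M f))\<^sup>2"
  proof -
    \<comment> \<open>Completing the square with weight \<open>l\<close> spends only
      \<open>l / 4\<close> of the available \<open>l / 2\<close>.\<close>
    have "0 \<le> (l / 2 - R * norm (M f))\<^sup>2 / l" using l by simp
    also have "\<dots> = l / 4 - R * norm (M f) + R\<^sup>2 / l * (norm (M f))\<^sup>2"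
      using l by (simp add: power2_diff power_divide power_mult_distrib field_simps power2_eq_square)
    finally show ?thesis by (simp add: mult.commute)
  qed
  also have "\<dots> \<le> l / 4 + R\<^sup>2 / l * (C * (f \<bullet> u))"
    using M2 l by (intro add_left_mono mult_left_mono) auto
  finally have "- (M f \<bullet> u) \<le> l / 4 + R\<^sup>2 / l * (C * (f \<bullet> u))" .
  moreover have "(C / 2 + R\<^sup>2 * C / l) * (f \<bullet> u) = C / 2 * (f \<bullet> u) + R\<^sup>2 / l * (C * (f \<bullet> u))"
    by (simp add: distrib_right)
  ultimately show ?thesis using 1 by linarith
qed

section \<open>Convergence of the regularized method for an abstract monotone map\<close>

text \<open>Isolates what the convergence rests on: a monotone Lipschitz map with a zero, bounded
  generalized Jacobians, and a linear map \<open>M\<close> for which the defect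
  \<open>F u - M (u - ws)\<close> and \<open>M (F u)\<close> are both controlled by the
  dissipation.\<close>

lemma ALPDSN_residual_tendsto_0:
  fixes W :: "'w::euclidean_space set" and w :: "nat \<Rightarrow> 'w"
  assumes W: "subspace W"
    and seq: "ALPDSN_sequence W F \<J> \<gamma> \<nu> \<beta> \<kappa> \<zeta> w"
    and params: "\<gamma> > 1" "0 < \<nu>" "\<nu> < 1" "1 / 2 < \<beta>" "\<beta> \<le> 1" "\<kappa> > 0" "\<zeta> \<ge> 1"
    and L: "0 \<le> L" and C0: "0 \<le> C"
    and lip: "\<And>u v. u \<in> W \<Longrightarrow> v \<in> W \<Longrightarrow> norm (F u - F v) \<le> L * norm (u - v)"
    and mono: "\<And>u v. u \<in> W \<Longrightarrow> v \<in> W \<Longrightarrow> 0 \<le> (F u - F v) \<bullet> (u - v)"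
    and jac: "\<And>u J d. u \<in> W \<Longrightarrow> J \<in> \<J> u \<Longrightarrow> d \<in> W \<Longrightarrow> norm (J d) \<le> L * norm d"
    and zero: "ws \<in> W" "F ws = 0"
    and M: "linear M"
    and M1: "\<And>u. u \<in> W \<Longrightarrow> (norm (F u - M (u - ws)))\<^sup>2 \<le> C * (F u \<bullet> (u - ws))"
    and M2: "\<And>u. u \<in> W \<Longrightarrow> (norm (M (F u)))\<^sup>2 \<le> C * (F u \<bullet> (u - ws))"
  shows "(\<lambda>k. F (w k)) \<longlonglongrightarrow> 0"
proof -
  define a where "a k = norm (F (w k))" for k
  \<comment> \<open>Steps passing the residual test; every other step is accepted through the size
    of its parameter.\<close>
  define short where
    "short k \<longleftrightarrow> a (Suc k) \<le> \<nu> * Max (a ` {max 1 (k + 1 - \<zeta>)..k})" for k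
  have W0: "w k \<in> W" for k
  proof (induction k)
    case 0
    then show ?case using seq by (simp add: ALPDSN_sequence_def)
  next
    case (Suc k)
    then show ?case using seq W unfolding ALPDSN_sequence_def by (metis order_refl subspace_add)
  qed
  have long: "\<exists>Jd \<tau> d. w (Suc k) = w k + d \<and> Jd + \<tau> *\<^sub>R d = - F (w k) \<and> norm Jd \<le> L * norm d \<and>
      real k powr \<beta> \<le> \<tau> \<and> (\<tau> \<le> \<gamma> * real k powr \<beta> \<or> real k powr \<beta> \<le> \<kappa> * a k)"
    if nshort: "\<not> short k" for k
  proof -
    obtain J d i where J: "J \<in> \<J> (w k)"
      and d: "\<forall>j\<le>i. d j \<in> W \<and> J (d j) + lm_param F \<kappa> \<gamma> w k j *\<^sub>R d j = - F (w k)"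
      and acc: "accepts F \<gamma> \<nu> \<beta> \<kappa> \<zeta> w k i (d i)"
      and nacc: "\<forall>j<i. \<not> accepts F \<gamma> \<nu> \<beta> \<kappa> \<zeta> w k j (d j)"
      and wS: "w (Suc k) = w k + d i"
      using seq unfolding ALPDSN_sequence_def by blast
    define \<tau> where "\<tau> = lm_param F \<kappa> \<gamma> w k i"
    have ge: "real k powr \<beta> \<le> \<tau>"
      using acc nshort unfolding accepts_def short_def a_def wS \<tau>_def by simp
    \<comment> \<open>If \<open>i > 0\<close>, the previous trial was rejected with a parameter
      below the threshold, and \<open>\<tau>\<close> is \<open>\<gamma>\<close> times that one. If
      \<open>i = 0\<close>, then \<open>\<tau> = \<kappa> * a k\<close> already exceeds the
      threshold, which is the second alternative.\<close>
    have "\<tau> \<le> \<gamma> * real k powr \<beta> \<or> real k powr \<beta> \<le> \<kappa> * a k"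
    proof (cases i)
      case 0
      then show ?thesis using ge by (simp add: \<tau>_def lm_param_def a_def)
    next
      case (Suc j)
      then have "lm_param F \<kappa> \<gamma> w k j < real k powr \<beta>"
        using nacc unfolding accepts_def by force
      then show ?thesis
        using params unfolding \<tau>_def Suc lm_param_def by (simp add: mult_ac)
    qed
    then show ?thesis
      using wS d jac[OF W0 J] ge by (intro exI[of _ "J (d i)"] exI[of _ \<tau>] exI[of _ "d i"])
        (auto simp: \<tau>_def)
  qed
  define c where "c k = 12 * L\<^sup>2 * real k powr - (2 * \<beta>)" for k
  have c: "summable c" "0 \<le> c k" for k
    unfolding c_def using params by (auto intro!: summable_mult simp: summable_real_powr_iff)
  have pow_top: "\<exists>K. \<forall>k\<ge>K. x < real k powr \<beta>" for x
  proof -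
    have "LIM k sequentially. real k powr \<beta> :> at_top"
      using params by (intro filterlim_compose[OF real_powr_at_top filterlim_real_sequentially]) auto
    then show ?thesis by (simp add: filterlim_at_top_dense eventually_sequentially)
  qed
  \<comment> \<open>From here on any \<open>\<tau>\<close> at or above the threshold is positive and
    at least \<open>2 * L\<close>, as the step estimates require.\<close>
  obtain K where K: "\<And>k. k \<ge> K \<Longrightarrow> real k powr \<beta> \<ge> 2 * L + 1"
    using pow_top[of "2 * L + 1"] less_imp_le by blast
  have inv: "1 / \<tau>\<^sup>2 \<le> real k powr - (2 * \<beta>)" if "real k powr \<beta> \<le> \<tau>" "k \<ge> K" for k \<tau>
  proof -
    have p: "0 < real k powr \<beta>" using K[OF that(2)] L by linarith
    have "1 / \<tau>\<^sup>2 \<le> 1 / (real k powr \<beta>)\<^sup>2"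
      using that p by (intro divide_left_mono power_mono mult_pos_pos) auto
    also have "\<dots> = real k powr - (2 * \<beta>)"
      by (simp add: powr_minus_divide power2_eq_square flip: powr_add)
    finally show ?thesis .
  qed
  have step2: "(a (Suc k))\<^sup>2 \<le> (1 + c k) * (a k)\<^sup>2" if "\<not> short k" "k \<ge> K" for k
  proof -
    obtain Jd \<tau> d where s: "w (Suc k) = w k + d" "Jd + \<tau> *\<^sub>R d = - F (w k)" "norm Jd \<le> L * norm d"
      and \<tau>: "real k powr \<beta> \<le> \<tau>" using long[OF \<open>\<not> short k\<close>] by blast
    have \<tau>': "0 < \<tau>" "2 * L \<le> \<tau>" using K[OF \<open>k \<ge> K\<close>] \<tau> L by linarith+
    have "(a (Suc k))\<^sup>2 \<le> (1 + 12 * L\<^sup>2 / \<tau>\<^sup>2) * (a k)\<^sup>2"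
      unfolding a_def using mono[OF W0[of "Suc k"] W0[of k]] lip[OF W0[of "Suc k"] W0[of k]] s(1)
      by (intro regularized_step_residual[OF s(2,3) \<tau>' L]) auto
    also have "\<dots> \<le> (1 + c k) * (a k)\<^sup>2"
      using mult_left_mono[OF inv[OF \<tau> \<open>k \<ge> K\<close>], of "12 * L\<^sup>2"]
      by (intro mult_right_mono add_left_mono) (auto simp: c_def)
    finally show ?thesis .
  qed
  \<comment> \<open>Dividing the squared residual by the accumulated growth factors makes it
    nonincreasing along long steps.\<close>
  define P where "P k = (\<Prod>j<k. 1 + c j)" for k
  have P1: "1 \<le> P k" and PS: "P (Suc k) = P k * (1 + c k)" for k
    unfolding P_def using c by (auto intro!: prod_ge_1)
  have Pmono: "P j \<le> P k" if "j \<le> k" for j k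
    using that
  proof (induction k rule: dec_induct)
    case (step n)
    then show ?case using mult_left_mono[of 1 "1 + c n" "P n"] P1[of n] c(2)[of n] PS[of n] by linarith
  qed simp
  define s where "s k = (a k)\<^sup>2 / P k" for k
  have s0: "0 \<le> s k" for k unfolding s_def using P1[of k] by simp
  have s_long: "s (Suc k) \<le> s k" if "\<not> short k" "k \<ge> K" for k
  proof -
    have "s (Suc k) \<le> (1 + c k) * (a k)\<^sup>2 / P (Suc k)"
      unfolding s_def using step2[OF that] P1[of "Suc k"] by (intro divide_right_mono) auto
    also have "\<dots> = s k"
      unfolding s_def PS using c(2)[of k] by (simp add: divide_simps add_nonneg_eq_0_iff)
    finally show ?thesis .
  qed
  have s_short: "s (Suc k) \<le> \<nu>\<^sup>2 * Max (s ` {max 1 (k + 1 - \<zeta>)..k})" if "short k" "k \<ge> 1" for k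
  proof -
    let ?I = "{max 1 (k + 1 - \<zeta>)..k}"
    have ne: "a ` ?I \<noteq> {}" "finite (a ` ?I)" using \<open>k \<ge> 1\<close> params by auto
    then obtain j where j: "j \<in> ?I" "Max (a ` ?I) = a j" using Max_in[OF ne(2,1)] by (metis imageE)
    have "(a (Suc k))\<^sup>2 \<le> (\<nu> * a j)\<^sup>2"
      using that(1) j unfolding short_def by (intro power_mono) (auto simp: a_def)
    then have "s (Suc k) \<le> (\<nu> * a j)\<^sup>2 / P (Suc k)"
      unfolding s_def using P1[of "Suc k"] by (intro divide_right_mono) auto
    \<comment> \<open>The window index satisfies \<open>j \<le> k\<close>, so passing from
      \<open>P (Suc k)\<close> to the smaller \<open>P j\<close> only increases the
      quotient.\<close>
    also have "\<dots> \<le> (\<nu> * a j)\<^sup>2 / P j"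
      using Pmono[of j "Suc k"] j P1[of j] P1[of "Suc k"] by (intro divide_left_mono mult_pos_pos) auto
    also have "\<dots> = \<nu>\<^sup>2 * s j" by (simp add: s_def power_mult_distrib)
    also have "\<dots> \<le> \<nu>\<^sup>2 * Max (s ` ?I)" using j by (intro mult_left_mono Max_ge) auto
    finally show ?thesis .
  qed
  \<comment> \<open>The products \<open>P k\<close> are bounded by \<open>exp (suminf c)\<close>, so
    the rescaled and the original squared residuals vanish together.\<close>
  have s_lim: "(\<lambda>k. F (w k)) \<longlonglongrightarrow> 0" if "s \<longlonglongrightarrow> 0"
  proof -
    have "(\<lambda>k. s k * exp (suminf c)) \<longlonglongrightarrow> 0" by (intro tendsto_mult_left_zero that)
    moreover have "norm ((a k)\<^sup>2) \<le> s k * exp (suminf c)" for k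
    proof -
      have "(a k)\<^sup>2 = s k * P k" unfolding s_def using P1[of k] by simp
      also have "\<dots> \<le> s k * exp (suminf c)"
        unfolding P_def using prod_one_plus_bounded[OF c] s0 by (intro mult_left_mono) auto
      finally show ?thesis by simp
    qed
    ultimately have "(\<lambda>k. (a k)\<^sup>2) \<longlonglongrightarrow> 0" 
      using Lim_null_comparison[of "\<lambda>k. (a k)\<^sup>2" "\<lambda>k. s k * exp (suminf c)" sequentially] by simp
    then show ?thesis unfolding a_def by (simp add: tendsto_norm_zero_iff)
  qed
  show ?thesis
  proof (cases "\<exists>\<^sub>\<infinity>k. short k")
    case True
    have "s \<longlonglongrightarrow> 0"
    proof (rule nonmonotone_descent_tendsto_0)
      show "0 \<le> \<nu>\<^sup>2" "\<nu>\<^sup>2 < 1" using params by (auto simp: power2_less_1_iff abs_square_less_1)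
      show "s (Suc k) \<le> s k \<or> s (Suc k) \<le> \<nu>\<^sup>2 * Max (s ` {max 1 (k + 1 - \<zeta>)..k})" if "k \<ge> max 1 K" for k
        using that s_long s_short by (cases "short k") auto
      show "\<exists>\<^sub>\<infinity>k. s (Suc k) \<le> \<nu>\<^sup>2 * Max (s ` {max 1 (k + 1 - \<zeta>)..k})"
        unfolding INFM_nat_le
      proof
        fix m
        obtain k where "k \<ge> max 1 m" "short k" using True unfolding INFM_nat_le by blast
        then show "\<exists>n\<ge>m. s (Suc n) \<le> \<nu>\<^sup>2 * Max (s ` {max 1 (n + 1 - \<zeta>)..n})"
          using s_short by (intro exI[of _ k]) auto
      qed
    qed (use s0 params in auto)
    then show ?thesis by (rule s_lim)
  next
    case False
    \<comment> \<open>From now on all steps are long, so \<open>s\<close> has a limit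
      \<open>l\<close>. A positive \<open>l\<close> keeps the residuals away from zero, as
      \<open>P k \<ge> 1\<close>.\<close>
    then obtain K1 where K1: "\<And>k. k \<ge> K1 \<Longrightarrow> \<not> short k"
      unfolding INFM_nat_le by (metis)
    define K2 where "K2 = max K K1"
    have dec: "s (Suc k) \<le> s k" if "k \<ge> K2" for k
      using that s_long K1 unfolding K2_def by auto
    have "decseq (\<lambda>k. s (k + K2))" using dec by (intro decseq_SucI) simp
    then obtain l where l: "(\<lambda>k. s (k + K2)) \<longlonglongrightarrow> l" "\<And>k. l \<le> s (k + K2)"
      using decseq_convergent s0 by metis
    have "s \<longlonglongrightarrow> l" using l(1) by (rule LIMSEQ_offset)
    then have "0 \<le> l" using s0 LIMSEQ_le_const by blast
    have "\<not> 0 < l"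
    proof
      assume "0 < l"
      have la: "l \<le> (a k)\<^sup>2" if "k \<ge> K2" for k
      proof -
        have "l \<le> s k" using l(2)[of "k - K2"] that by simp
        also have "\<dots> \<le> (a k)\<^sup>2" unfolding s_def using P1[of k] by (simp add: divide_le_eq mult_le_cancel_left1)
        finally show ?thesis .
      qed
      define u where "u k = w k - ws" for k
      define g where "g k = F (w k) \<bullet> u k" for k
      have g0: "0 \<le> g k" for k using mono[OF W0[of k] zero(1)] zero(2) by (simp add: g_def u_def)
      have aL: "a k \<le> L * norm (u k)" for k
        using lip[OF W0[of k] zero(1)] zero(2) by (simp add: a_def u_def)
      have inv': "x / \<tau>\<^sup>2 \<le> x * real k powr - (2 * \<beta>)"
        if "real k powr \<beta> \<le> \<tau>" "k \<ge> K2" "0 \<le> x" for k \<tau> x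
        using mult_left_mono[OF inv[OF that(1), of] that(3)] that(2) unfolding K2_def by simp
      have ustep: "(norm (u (Suc k)))\<^sup>2 \<le> (norm (u k))\<^sup>2
          + 8 * L\<^sup>2 * real k powr - (2 * \<beta>) * (norm (u k))\<^sup>2 - 2 / \<tau> * g k"
        if "w (Suc k) = w k + d" "Jd + \<tau> *\<^sub>R d = - F (w k)" "norm Jd \<le> L * norm d"
          "real k powr \<beta> \<le> \<tau>" "0 < \<tau>" "2 * L \<le> \<tau>" "k \<ge> K2" for k \<tau> d Jd
      proof -
        have "(norm (u k + d))\<^sup>2 \<le> (1 + 8 * L\<^sup>2 / \<tau>\<^sup>2) * (norm (u k))\<^sup>2 - 2 / \<tau> * (F (w k) \<bullet> u k)"
          by (rule regularized_step_distance[OF that(2,3,5,6) L]) (use aL in \<open>simp add: a_def\<close>)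
        moreover have "8 * L\<^sup>2 / \<tau>\<^sup>2 * (norm (u k))\<^sup>2 \<le> 8 * L\<^sup>2 * real k powr - (2 * \<beta>) * (norm (u k))\<^sup>2"
          using inv'[OF that(4,7), of "8 * L\<^sup>2"] by (intro mult_right_mono) auto
        moreover have "u (Suc k) = u k + d" by (simp add: u_def that(1))
        ultimately show ?thesis by (simp add: g_def algebra_simps)
      qed
      \<comment> \<open>Dropping the dissipation leaves growth by summable factors, hence bounded
        iterates.\<close>
      have "(norm (u (Suc k)))\<^sup>2 \<le> (1 + 8 * L\<^sup>2 * real k powr - (2 * \<beta>)) * (norm (u k))\<^sup>2"
        if k: "k \<ge> K2" for k
      proof -
        obtain Jd \<tau> d where s: "w (Suc k) = w k + d" "Jd + \<tau> *\<^sub>R d = - F (w k)" "norm Jd \<le> L * norm d"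
          and \<tau>: "real k powr \<beta> \<le> \<tau>" using long[OF K1[of k]] k unfolding K2_def by auto
        have \<tau>': "0 < \<tau>" "2 * L \<le> \<tau>" using K[of k] k \<tau> L unfolding K2_def by auto
        have "0 \<le> 2 / \<tau> * g k" using \<tau>' g0 by simp
        then show ?thesis using ustep[OF s \<tau> \<tau>' k] by (simp add: algebra_simps)
      qed
      then obtain B where B: "\<And>k. k \<ge> K2 \<Longrightarrow> (norm (u k))\<^sup>2 \<le> B"
        using almost_monotone_bounded[of "\<lambda>k. 8 * L\<^sup>2 * real k powr - (2 * \<beta>)" "\<lambda>k. (norm (u k))\<^sup>2" K2] params
        by (auto intro!: summable_mult simp: summable_real_powr_iff)
      define R where "R = sqrt B"
      have uR: "norm (u k) \<le> R" if "k \<ge> K2" for k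
        using B[OF that] unfolding R_def by (simp add: real_le_rsqrt)
      have R0: "0 \<le> R" using uR[of K2] norm_ge_zero order_trans by blast
      have aR: "a k \<le> L * R" if "k \<ge> K2" for k
        using aL[of k] mult_left_mono[OF uR[OF that] L] by linarith
      obtain m where m: "0 < m" "\<And>v. norm (M v) \<le> m * norm v"
        using linear_bounded_pos[OF M] by (metis mult.commute)
      \<comment> \<open>Residuals are now bounded while the threshold tends to infinity, so the
        alternative \<open>real k powr \<beta> \<le> \<kappa> * a k\<close> is eventually
        excluded.\<close>
      obtain K3 where K3: "\<And>k. k \<ge> K3 \<Longrightarrow> real k powr \<beta> > \<kappa> * (L * R)"
        using pow_top by blast
      define K4 where "K4 = max K2 K3"
      \<comment> \<open>The coefficient of the dissipation in \<open>flow_derivative_bound\<close>.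
        The term \<open>D * g k / \<tau>\<close> that it causes is cancelled by the decrease of
        \<open>D / 2 * (norm (u k))\<^sup>2\<close> in \<open>E\<close>.\<close>
      define D where "D = C / 2 + R\<^sup>2 * C / l"
      define q where "q = 4 * m * R * L * (L * R) + 4 * m * (L * R)\<^sup>2"
      have q0: "0 \<le> q" using m R0 L by (simp add: q_def)
      define E where "E k = M (u k) \<bullet> u k + D / 2 * (norm (u k))\<^sup>2" for k
      have D0: "0 \<le> D" unfolding D_def using C0 \<open>0 < l\<close> by simp
      show False
      \<comment> \<open>The decrease \<open>l / (4 * \<tau>)\<close> is at least
        \<open>l / (4 * \<gamma>) * real k powr - \<beta>\<close>. The constant \<open>c\<close>
        adds the second-order errors of both parts of \<open>E\<close>; the lower bound for
        \<open>E\<close> uses only boundedness, as the quadratic form of \<open>M\<close> may be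
        indefinite.\<close>
      proof (rule lyapunov_contradiction[where E = E and K = K4 and m = "- m * R\<^sup>2"
            and a = "l / (4 * \<gamma>)" and c = "q + D * 4 * L\<^sup>2 * R\<^sup>2"])
        fix k assume k: "k \<ge> K4"
        then have k2: "k \<ge> K2" unfolding K4_def by simp
        have "- (M (u k) \<bullet> u k) \<le> norm (M (u k)) * norm (u k)"
          using norm_cauchy_schwarz[of "- M (u k)" "u k"] by simp
        also have "\<dots> \<le> (m * R) * R"
          using m(2)[of "u k"] uR[OF k2] m(1) R0
          by (intro mult_mono) (auto intro: order_trans[OF _ mult_left_mono])
        finally show "- m * R\<^sup>2 \<le> E k"
          unfolding E_def using D0 by (simp add: power2_eq_square add_increasing2)
        obtain Jd \<tau> d where s: "w (Suc k) = w k + d" "Jd + \<tau> *\<^sub>R d = - F (w k)" "norm Jd \<le> L * norm d"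
          and \<tau>: "real k powr \<beta> \<le> \<tau>" "\<tau> \<le> \<gamma> * real k powr \<beta> \<or> real k powr \<beta> \<le> \<kappa> * a k"
          using long[OF K1[of k]] k2 unfolding K2_def by auto
        have \<tau>': "0 < \<tau>" "2 * L \<le> \<tau>" using K[of k] k2 \<tau> L unfolding K2_def by auto
        have "\<kappa> * a k < real k powr \<beta>"
        proof -
          have "\<kappa> * (L * R) < real k powr \<beta>" using K3 k unfolding K4_def by simp
          moreover have "\<kappa> * a k \<le> \<kappa> * (L * R)" using aR[OF k2] params(6) by simp
          ultimately show ?thesis by linarith
        qed
        then have \<tau>up: "\<tau> \<le> \<gamma> * real k powr \<beta>" using \<tau> by linarith
        have u': "u (Suc k) = u k + d" by (simp add: u_def s(1))
        have quad: "M (u (Suc k)) \<bullet> u (Suc k) \<le> M (u k) \<bullet> u k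
            - (M (F (w k)) \<bullet> u k + M (u k) \<bullet> F (w k)) / \<tau> + q / \<tau>\<^sup>2"
          unfolding u' q_def
          using aR[OF k2] uR[OF k2] m
          by (intro regularized_step_quadratic[OF s(2,3) \<tau>' L _ _ M]) (auto simp: a_def)
        have "l / 4 - D * g k \<le> M (F (w k)) \<bullet> u k + M (u k) \<bullet> F (w k)"
          unfolding D_def g_def using M1[OF W0[of k]] M2[OF W0[of k]] uR[OF k2] la[OF k2] \<open>0 < l\<close>
          by (intro flow_derivative_bound) (auto simp: u_def a_def)
        then have "(l / 4 - D * g k) / \<tau> \<le> (M (F (w k)) \<bullet> u k + M (u k) \<bullet> F (w k)) / \<tau>"
          using \<tau>' by (intro divide_right_mono) auto
        then have 1: "M (u (Suc k)) \<bullet> u (Suc k) \<le> M (u k) \<bullet> u k - l / (4 * \<tau>) + D * g k / \<tau>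
            + q * real k powr - (2 * \<beta>)"
          using quad inv'[OF \<tau>(1) k2 q0] by (simp add: diff_divide_distrib)
        have "8 * L\<^sup>2 * real k powr - (2 * \<beta>) * (norm (u k))\<^sup>2 \<le> 8 * L\<^sup>2 * real k powr - (2 * \<beta>) * R\<^sup>2"
          using uR[OF k2] by (intro mult_left_mono power_mono) auto
        then have "(norm (u (Suc k)))\<^sup>2 \<le> (norm (u k))\<^sup>2 + 8 * L\<^sup>2 * real k powr - (2 * \<beta>) * R\<^sup>2 - 2 / \<tau> * g k"
          using ustep[OF s \<tau>(1) \<tau>' k2] by linarith
        then have 2: "D / 2 * (norm (u (Suc k)))\<^sup>2
            \<le> D / 2 * ((norm (u k))\<^sup>2 + 8 * L\<^sup>2 * real k powr - (2 * \<beta>) * R\<^sup>2 - 2 / \<tau> * g k)"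
          using D0 by (intro mult_left_mono) auto
        have "K \<le> k" using k2 unfolding K2_def by simp
        from K[OF this] have kp: "0 < real k powr \<beta>" using L by linarith
        have "l / (4 * \<gamma>) * real k powr - \<beta> = l / 4 * (1 / (\<gamma> * real k powr \<beta>))"
          by (simp add: powr_minus_divide)
        also have "\<dots> \<le> l / 4 * (1 / \<tau>)"
          using kp \<tau>up \<tau>' \<open>0 < l\<close> params by (intro mult_left_mono divide_left_mono mult_pos_pos) auto
        finally have 3: "l / (4 * \<gamma>) * real k powr - \<beta> \<le> l / (4 * \<tau>)" by simp
        show "E (Suc k) \<le> E k - l / (4 * \<gamma>) * real k powr - \<beta>
            + (q + D * 4 * L\<^sup>2 * R\<^sup>2) * real k powr - (2 * \<beta>)"
          using 1 2 3 unfolding E_def by (simp add: algebra_simps)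
      qed (use params \<open>0 < l\<close> q0 D0 R0 in auto)
    qed
    then have "l = 0" using \<open>0 \<le> l\<close> by simp
    then show ?thesis using \<open>s \<longlonglongrightarrow> l\<close> s_lim by simp
  qed
qed

section \<open>Calculus on a subspace\<close>

text \<open>The definite description is met by the orthogonal projection onto \<open>X\<close> of
  the ambient adjoint. Uniqueness follows by testing the difference of two candidates against
  itself.\<close>

lemma adjoint_on_props:
  fixes X :: "'a::euclidean_space set" and A :: "'a \<Rightarrow> 'b::euclidean_space"
  assumes X: "subspace X" and A: "linear A"
  shows adjoint_on_in: "adjoint_on X A y \<in> X"
    and adjoint_on_works: "u \<in> X \<Longrightarrow> A u \<bullet> y = u \<bullet> adjoint_on X A y"
proof -
  obtain p z where pz: "p \<in> span X" "\<And>w. w \<in> span X \<Longrightarrow> orthogonal z w" "adjoint A y = p + z"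
    using orthogonal_subspace_decomp_exists[of X "adjoint A y"] by metis
  have "span X = X" using X by (simp add: span_eq_iff)
  have p: "p \<in> X \<and> (\<forall>u\<in>X. A u \<bullet> y = u \<bullet> p)"
  proof (intro conjI ballI)
    fix u assume "u \<in> X"
    then have "u \<bullet> z = 0" using pz(2) \<open>span X = X\<close> by (simp add: orthogonal_def inner_commute)
    then show "A u \<bullet> y = u \<bullet> p" using adjoint_works[OF A, of u y] pz(3) by (simp add: inner_add_right)
  qed (use pz \<open>span X = X\<close> in auto)
  have "adjoint_on X A y \<in> X \<and> (\<forall>u\<in>X. A u \<bullet> y = u \<bullet> adjoint_on X A y)"
    unfolding adjoint_on_def
  proof (rule theI[where a = p])
    show "p \<in> X \<and> (\<forall>u\<in>X. A u \<bullet> y = u \<bullet> p)" by (rule p)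
    fix v assume v: "v \<in> X \<and> (\<forall>u\<in>X. A u \<bullet> y = u \<bullet> v)"
    have d: "v - p \<in> X" using v p X by (simp add: subspace_diff)
    have "(v - p) \<bullet> (v - p) = 0" using v p d by (simp only: inner_diff_right) auto
    then show "v = p" by simp
  qed
  then show "adjoint_on X A y \<in> X" "u \<in> X \<Longrightarrow> A u \<bullet> y = u \<bullet> adjoint_on X A y" by auto
qed

lemma subspace_eqI:
  assumes "subspace X" "a \<in> X" "b \<in> X" "\<And>u. u \<in> X \<Longrightarrow> u \<bullet> a = u \<bullet> b"
  shows "a = b"
proof -
  have "a - b \<in> X" by (rule subspace_diff[OF assms(1-3)])
  from assms(4)[OF this] have "(a - b) \<bullet> (a - b) = 0" by (simp add: inner_diff_right)
  then show ?thesis by simp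
qed

lemma linear_adjoint_on:
  fixes X :: "'a::euclidean_space set" and A :: "'a \<Rightarrow> 'b::euclidean_space"
  assumes X: "subspace X" and A: "linear A"
  shows "linear (adjoint_on X A)"
proof (rule linearI)
  note in_X = adjoint_on_in[OF X A] and works = adjoint_on_works[OF X A, symmetric]
  fix y y' and r :: real
  show "adjoint_on X A (y + y') = adjoint_on X A y + adjoint_on X A y'"
    by (rule subspace_eqI[OF X in_X subspace_add[OF X in_X in_X]]) (simp only: inner_add_right works)
  show "adjoint_on X A (r *\<^sub>R y) = r *\<^sub>R adjoint_on X A y"
    by (rule subspace_eqI[OF X in_X subspace_scale[OF X in_X]]) (simp only: inner_scaleR_right works)
qed

text \<open>The adjoint of the identity relative to \<open>X\<close> is the orthogonal projection
  onto \<open>X\<close>, and it serves as such below.\<close>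

lemma adjoint_on_id_eq:
  assumes X: "subspace X" and v: "v \<in> X"
  shows "adjoint_on X (\<lambda>x. x) v = v"
  by (rule subspace_eqI[OF X adjoint_on_in[OF X linear_ident] v])
    (rule adjoint_on_works[OF X linear_ident, symmetric])

lemma adjoint_on_id_orthogonal:
  assumes X: "subspace X" and v: "v \<in> orthogonal_comp X"
  shows "adjoint_on X (\<lambda>x. x) v = 0"
proof (rule subspace_eqI[OF X adjoint_on_in[OF X linear_ident] subspace_0[OF X]])
  fix u assume u: "u \<in> X"
  have "u \<bullet> v = 0" using u v by (simp add: orthogonal_comp_def orthogonal_def)
  then show "u \<bullet> adjoint_on X (\<lambda>x. x) v = u \<bullet> 0"
    using adjoint_on_works[OF X linear_ident u, of v] by simp
qed

section \<open>Derivatives, gradients and Hessians relative to a subspace\<close>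

text \<open>A derivative within \<open>X\<close> is determined only on \<open>X\<close>. Lines
  inside \<open>X\<close> reduce questions about it to ordinary derivatives on the real
  line.\<close>

lemma has_derivative_subspace_line:
  assumes X: "subspace X" "u \<in> X" "v \<in> X" and f: "(f has_derivative f') (at u within X)"
  shows "((\<lambda>t::real. f (u + t *\<^sub>R v)) has_derivative (\<lambda>t. f' (t *\<^sub>R v))) (at 0)"
proof -
  have 1: "((\<lambda>t::real. u + t *\<^sub>R v) has_derivative (\<lambda>t. t *\<^sub>R v)) (at 0)"
    by (auto intro!: derivative_eq_intros)
  have "range (\<lambda>t::real. u + t *\<^sub>R v) \<subseteq> X" using X by (auto simp: subspace_add subspace_scale)
  then have 2: "(f has_derivative f') (at (u + 0 *\<^sub>R v) within range (\<lambda>t::real. u + t *\<^sub>R v))"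
    using has_derivative_subset[OF f] by simp
  show ?thesis by (rule has_derivative_in_compose[OF 1 2])
qed

lemma has_derivative_subspace_unique:
  assumes X: "subspace X" "u \<in> X" "v \<in> X"
    and "(f has_derivative f1) (at u within X)" "(f has_derivative f2) (at u within X)"
  shows "f1 v = f2 v"
proof -
  have "(\<lambda>t::real. f1 (t *\<^sub>R v)) = (\<lambda>t. f2 (t *\<^sub>R v))"
    using assms by (intro has_derivative_unique[OF has_derivative_subspace_line has_derivative_subspace_line]) auto
  from fun_cong[OF this, of 1] show ?thesis by simp
qed

lemma has_derivative_subspace_cong:
  assumes X: "subspace X" "u \<in> X" and f: "(f has_derivative f1) (at u within X)"
    and "bounded_linear f2" and eq: "\<And>v. v \<in> X \<Longrightarrow> f1 v = f2 v"
  shows "(f has_derivative f2) (at u within X)"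
  unfolding has_derivative_within
proof
  have "((\<lambda>y. (1 / norm (y - u)) *\<^sub>R (f y - (f u + f1 (y - u)))) \<longlongrightarrow> 0) (at u within X)"
    using f by (simp add: has_derivative_within)
  moreover have "\<forall>\<^sub>F y in at u within X. y \<in> X" by (simp add: eventually_at_filter)
  ultimately show "((\<lambda>y. (1 / norm (y - u)) *\<^sub>R (f y - (f u + f2 (y - u)))) \<longlongrightarrow> 0) (at u within X)"
    by (rule Lim_transform_eventually[OF _ eventually_mono]) (simp add: eq subspace_diff[OF X(1) _ X(2)])
qed fact

lemma has_derivative_lipschitz_bound:
  assumes X: "subspace X" "u \<in> X" "v \<in> X" and f: "(f has_derivative f') (at u within X)"
    and lip: "C-lipschitz_on X f"
  shows "norm (f' v) \<le> C * norm v"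
proof -
  have "((\<lambda>t. norm (f (u + t *\<^sub>R v) - f u - f' (t *\<^sub>R v)) / norm t) \<longlongrightarrow> 0) (at (0::real))"
    using has_derivative_subspace_line[OF X f] by (simp add: has_derivative_at)
  \<comment> \<open>The left side does not depend on \<open>t\<close>, while the right side tends to
    0.\<close>
  moreover have "norm (f' v) - C * norm v \<le> norm (f (u + t *\<^sub>R v) - f u - f' (t *\<^sub>R v)) / norm t"
    if "t \<noteq> 0" for t :: real
  proof -
    have "f' (t *\<^sub>R v) = t *\<^sub>R f' v"
      using has_derivative_bounded_linear[OF f] by (simp add: bounded_linear.linear linear_cmul)
    then have "\<bar>t\<bar> * norm (f' v) \<le> norm (f (u + t *\<^sub>R v) - f u) + norm (f (u + t *\<^sub>R v) - f u - f' (t *\<^sub>R v))"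
      using norm_triangle_ineq4[of "f (u + t *\<^sub>R v) - f u" "f (u + t *\<^sub>R v) - f u - f' (t *\<^sub>R v)"] by simp
    moreover have "norm (f (u + t *\<^sub>R v) - f u) \<le> C * (\<bar>t\<bar> * norm v)"
      using lipschitz_on_normD[OF lip, of "u + t *\<^sub>R v" u] X by (simp add: subspace_add subspace_scale)
    ultimately show ?thesis using that by (simp add: field_simps)
  qed
  ultimately have "norm (f' v) - C * norm v \<le> 0"
    by (intro tendsto_lowerbound[where f = "\<lambda>t. norm (f (u + t *\<^sub>R v) - f u - f' (t *\<^sub>R v)) / norm t" and F = "at (0::real)"])
      (auto simp: eventually_at_filter)
  then show ?thesis by simp
qed

lemma gradient_on_eqI:
  assumes X: "subspace X" "u \<in> X" and g: "g \<in> X" "(f has_derivative (\<lambda>v. g \<bullet> v)) (at u within X)"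
  shows "gradient_on X f u = g"
  unfolding gradient_on_def
proof (rule the_equality)
  fix g' assume g': "g' \<in> X \<and> (f has_derivative (\<lambda>v. g' \<bullet> v)) (at u within X)"
  show "g' = g"
  proof (rule subspace_eqI[OF X(1)])
    fix v assume "v \<in> X"
    then show "v \<bullet> g' = v \<bullet> g"
      using has_derivative_subspace_unique[OF X, of v f] g g' by (metis inner_commute)
  qed (use g g' in auto)
qed (use g in auto)

lemma gradient_on_works:
  fixes f :: "'a::euclidean_space \<Rightarrow> real"
  assumes X: "subspace X" "u \<in> X" and f: "f differentiable (at u within X)"
  shows "gradient_on X f u \<in> X"
    and "(f has_derivative (\<lambda>v. gradient_on X f u \<bullet> v)) (at u within X)"
proof -
  obtain f' where f': "(f has_derivative f') (at u within X)" using f by (auto simp: differentiable_def)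
  then have l: "linear f'" by (simp add: has_derivative_bounded_linear bounded_linear.linear)
  \<comment> \<open>Riesz representation: the adjoint of a functional, applied to 1, is its
    representing vector.\<close>
  define g where "g = adjoint_on X f' 1"
  have g: "g \<in> X" unfolding g_def using X l by (simp add: adjoint_on_in)
  have "(f has_derivative (\<lambda>v. g \<bullet> v)) (at u within X)"
    using adjoint_on_works[OF X(1) l, of _ 1]
    by (intro has_derivative_subspace_cong[OF X f']) (auto simp: g_def inner_commute bounded_linear_inner_right)
  then show "gradient_on X f u \<in> X"
    "(f has_derivative (\<lambda>v. gradient_on X f u \<bullet> v)) (at u within X)"
    using g gradient_on_eqI[OF X g] by auto
qed

text \<open>The point is that the description in \<open>hessian_on\<close> denotes something. The
  derivative of the gradient, precomposed with the projection onto \<open>X\<close>, is such an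
  operator, and any other one agrees with it on \<open>X\<close> and on the orthogonal complement.
  The bound is then the Lipschitz bound for derivatives.\<close>

lemma hessian_on_bound:
  assumes X: "subspace X" "u \<in> X" "v \<in> X" and C2: "C2_on X f"
    and lip: "C-lipschitz_on X (gradient_on X f)"
  shows "norm (blinfun_apply (hessian_on X f u) v) \<le> C * norm v"
proof -
  let ?G = "gradient_on X f" and ?Q = "adjoint_on X (\<lambda>x. x)"
  note Q = linear_adjoint_on[OF X(1) linear_ident] adjoint_on_id_eq[OF X(1)] adjoint_on_id_orthogonal[OF X(1)]
  obtain f' where f': "(?G has_derivative f') (at u within X)"
    using C2 X by (auto simp: C2_on_def differentiable_def)
  have bl: "bounded_linear (\<lambda>v. f' (?Q v))"
    using Q(1) by (intro bounded_linear_compose[OF has_derivative_bounded_linear[OF f']])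
      (simp add: linear_conv_bounded_linear)
  define D where "D = Blinfun (\<lambda>v. f' (?Q v))"
  have Dv: "blinfun_apply D v = f' (?Q v)" for v
    unfolding D_def using bl by (simp add: bounded_linear_Blinfun_apply)
  have f0: "f' 0 = 0"
    using has_derivative_bounded_linear[OF f'] by (simp add: bounded_linear.linear linear_0)
  have D: "has_jacobian_on X ?G u D"
    unfolding has_jacobian_on_def
    using Q(3) by (auto intro!: has_derivative_subspace_cong[OF X(1,2) f'] simp: Dv Q(2) blinfun.bounded_linear_right f0)
  have "hessian_on X f u = D"
    unfolding hessian_on_def
  proof (rule the_equality[OF _ blinfun_eqI])
    fix D' v assume D': "has_jacobian_on X ?G u D'"
    have q: "?Q v \<in> X" by (rule adjoint_on_in[OF X(1) linear_ident])
    have vq: "v - ?Q v \<in> orthogonal_comp X"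
      using adjoint_on_works[OF X(1) linear_ident, of _ v]
      by (auto simp: orthogonal_comp_def orthogonal_def inner_diff_right)
    have "blinfun_apply D' (v - ?Q v) = 0" "blinfun_apply D (v - ?Q v) = 0"
      using D D' vq by (auto simp: has_jacobian_on_def)
    moreover have "blinfun_apply D' (?Q v) = blinfun_apply D (?Q v)"
      using D D' has_derivative_subspace_unique[OF X(1,2) q] by (auto simp: has_jacobian_on_def)
    ultimately show "blinfun_apply D' v = blinfun_apply D v" by (simp add: blinfun.diff_right)
  qed (rule D)
  then show ?thesis
    using D has_derivative_lipschitz_bound[OF X _ lip] by (auto simp: has_jacobian_on_def)
qed

text \<open>For fixed \<open>v\<close> the operators obeying the bound form a convex set. It
  contains all limits of Jacobians, hence their convex hull.\<close>

lemma clarke_jacobian_bound: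
  fixes X :: "'a::euclidean_space set" and G :: "'a \<Rightarrow> 'b::real_normed_vector"
  assumes X: "subspace X" "v \<in> X" and lip: "C-lipschitz_on X G" and J: "J \<in> clarke_jacobian X G u"
  shows "norm (blinfun_apply J v) \<le> C * norm v"
proof -
  define S where "S = {J :: 'a \<Rightarrow>\<^sub>L 'b. norm (blinfun_apply J v) \<le> C * norm v}"
  have "clarke_jacobian X G u \<subseteq> S"
    unfolding clarke_jacobian_def
  proof (rule hull_minimal)
    show "convex S"
    proof (rule convexI)
      fix J J' :: "'a \<Rightarrow>\<^sub>L 'b" and a b :: real
      assume *: "J \<in> S" "J' \<in> S"
        "0 \<le> a" "0 \<le> b" "a + b = 1"
      have "norm (a *\<^sub>R J v + b *\<^sub>R J' v) \<le> a * norm (J v) + b * norm (J' v)"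
        using *(3,4) norm_triangle_ineq[of "a *\<^sub>R J v" "b *\<^sub>R J' v"] by simp
      also have "\<dots> \<le> a * (C * norm v) + b * (C * norm v)"
        using * unfolding S_def by (intro add_mono mult_left_mono) auto
      also have "\<dots> = C * norm v" using * by (simp flip: distrib_right)
      finally show "a *\<^sub>R J + b *\<^sub>R J' \<in> S"
        by (simp add: S_def blinfun.add_left blinfun.scaleR_left)
    qed
    show "{J. \<exists>u' D. (\<forall>k. u' k \<in> X \<and> has_jacobian_on X G (u' k) (D k)) \<and> u' \<longlonglongrightarrow> u \<and> D \<longlonglongrightarrow> J}
        \<subseteq> S"
    proof safe
      fix J and u' :: "nat \<Rightarrow> 'a" and D
      assume *: "\<forall>k. u' k \<in> X \<and> has_jacobian_on X G (u' k) (D k)" "D \<longlonglongrightarrow> J"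
      have "(\<lambda>k. norm (blinfun_apply (D k) v)) \<longlonglongrightarrow> norm (blinfun_apply J v)"
        by (intro tendsto_intros *)
      moreover have "norm (blinfun_apply (D k) v) \<le> C * norm v" for k
        using *(1) has_derivative_lipschitz_bound[OF X(1) _ X(2) _ lip, of "u' k" "D k"]
        by (simp add: has_jacobian_on_def)
      ultimately have "norm (blinfun_apply J v) \<le> C * norm v" by (intro LIMSEQ_le_const2) auto
      then show "J \<in> S" by (simp add: S_def)
    qed
  qed
  then show ?thesis using J by (auto simp: S_def)
qed

section \<open>Gradients of smooth convex functions\<close>

lemma convex_gradient_inequality:
  assumes X: "subspace X" "x \<in> X" "y \<in> X" and cv: "convex_on X f"
    and f: "(f has_derivative (\<lambda>v. g \<bullet> v)) (at x within X)"
  shows "f x + g \<bullet> (y - x) \<le> f y"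
proof -
  define p where "p t = f (x + t *\<^sub>R (y - x))" for t
  have yx: "y - x \<in> X" using X by (simp add: subspace_diff)
  have "(p has_derivative (\<lambda>t. g \<bullet> (t *\<^sub>R (y - x)))) (at 0)"
    unfolding p_def by (rule has_derivative_subspace_line[OF X(1,2) yx f])
  then have d: "(p has_field_derivative g \<bullet> (y - x)) (at 0 within UNIV)"
    by (simp add: has_field_derivative_def mult.commute[of _ "g \<bullet> (y - x)"])
  have "convex_on UNIV p"
    unfolding convex_on_def
  proof (safe; (simp; fail)?)
    fix s t a b :: real assume ab: "0 \<le> a" "0 \<le> b" "a + b = 1"
    have "x + (a *\<^sub>R s + b *\<^sub>R t) *\<^sub>R (y - x) = a *\<^sub>R (x + s *\<^sub>R (y - x)) + b *\<^sub>R (x + t *\<^sub>R (y - x))"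
    proof -
      have "x = a *\<^sub>R x + b *\<^sub>R x" using ab by (simp flip: scaleR_left_distrib)
      then show ?thesis by (simp add: algebra_simps)
    qed
    then show "p (a *\<^sub>R s + b *\<^sub>R t) \<le> a * p s + b * p t"
      unfolding p_def using cv ab X yx by (auto simp: convex_on_def subspace_add subspace_scale)
  qed
  from convex_on_imp_above_tangent[OF this _ _ _ d, of 1] show ?thesis
    by (simp add: p_def)
qed

text \<open>The Baillon-Haddad argument with the weaker constant \<open>1 / (2 * L)\<close>. The
  upper bound on \<open>f x'\<close> comes from the gradient inequality based at \<open>x'\<close>,
  so integration along the segment is avoided at the cost of a factor 2.\<close>

lemma gradient_cocoercive:
  assumes X: "subspace X" "x \<in> X" "y \<in> X" and H: "\<And>x. x \<in> X \<Longrightarrow> H x \<in> X"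
    and gi: "\<And>x y. x \<in> X \<Longrightarrow> y \<in> X \<Longrightarrow> f x + H x \<bullet> (y - x) \<le> f y"
    and lip: "L-lipschitz_on X H" and L: "0 < L"
  shows "(norm (H x - H y))\<^sup>2 / (2 * L) \<le> (H x - H y) \<bullet> (x - y)"
proof -
  have *: "f y + H y \<bullet> (x - y) + (norm (H x - H y))\<^sup>2 / (4 * L) \<le> f x" if xy: "x \<in> X" "y \<in> X" for x y
  proof -
    define D where "D = H x - H y"
    \<comment> \<open>This step length minimizes \<open>- t + L * t\<^sup>2\<close>, the coefficient
      of the squared norm of \<open>D\<close>.\<close>
    define t where "t = 1 / (2 * L)"
    define x' where "x' = x - t *\<^sub>R D"
    have x': "x' \<in> X" unfolding x'_def D_def using xy X H by (simp add: subspace_diff subspace_scale)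
    have "f x' \<le> f x + H x' \<bullet> (x' - x)"
      using gi[OF x' xy(1)] by (simp add: inner_diff_right)
    also have "H x' \<bullet> (x' - x) = H x \<bullet> (x' - x) + (H x' - H x) \<bullet> (x' - x)"
      by (simp add: inner_diff_left)
    also have "(H x' - H x) \<bullet> (x' - x) \<le> L * norm (x' - x) * norm (x' - x)"
      using lipschitz_on_normD[OF lip x' xy(1)]
      by (meson mult_right_mono norm_cauchy_schwarz norm_ge_zero order_trans)
    finally have "f x' \<le> f x + (H x \<bullet> (x' - x) + L * (norm (x' - x))\<^sup>2)"
      by (simp add: power2_eq_square mult.assoc)
    moreover have "f y + H y \<bullet> (x' - y) \<le> f x'" using gi[OF xy(2) x'] .
    moreover have "H x \<bullet> (x' - x) - H y \<bullet> (x' - y) = H y \<bullet> (y - x) - t * (norm D)\<^sup>2"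
      by (simp add: x'_def D_def power2_norm_eq_inner inner_diff_left inner_diff_right algebra_simps)
    moreover have "L * (norm (x' - x))\<^sup>2 = t / 2 * (norm D)\<^sup>2"
      using L by (simp add: x'_def t_def power_mult_distrib power2_eq_square field_simps)
    moreover have "t / 2 = 1 / (4 * L)" by (simp add: t_def)
    ultimately show ?thesis by (simp add: D_def inner_diff_right)
  qed
  have "(norm (H y - H x))\<^sup>2 = (norm (H x - H y))\<^sup>2" by (simp add: norm_minus_commute)
  then show ?thesis
    using *[OF X(2,3)] *[OF X(3,2)] L by (simp add: inner_diff_left inner_diff_right field_simps)
qed

section \<open>Proximal maps and Moreau envelopes\<close>

text \<open>Testing points of the domain only lets the inequality be stated with real values;
  elsewhere on \<open>X\<close> the function is infinite. Membership of \<open>g\<close> in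
  \<open>X\<close> is not demanded, as proximal maps are also evaluated at points outside
  \<open>X\<close>.\<close>

definition subgradient_on :: "'a::euclidean_space set \<Rightarrow> ('a \<Rightarrow> ereal) \<Rightarrow> 'a \<Rightarrow> 'a \<Rightarrow> bool" where
  "subgradient_on X h x g \<longleftrightarrow> x \<in> dom_on X h \<and>
     (\<forall>y\<in>dom_on X h. real_of_ereal (h x) + g \<bullet> (y - x) \<le> real_of_ereal (h y))"

lemma subgradient_on_monotone:
  assumes "subgradient_on X h x g" "subgradient_on X h y g'"
  shows "0 \<le> (g - g') \<bullet> (x - y)"
proof -
  have "real_of_ereal (h x) + g \<bullet> (y - x) \<le> real_of_ereal (h y)"
    "real_of_ereal (h y) + g' \<bullet> (x - y) \<le> real_of_ereal (h x)"
    using assms by (auto simp: subgradient_on_def)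
  then show ?thesis by (simp add: inner_diff_left inner_diff_right)
qed

lemma dom_on_ereal:
  assumes "proper_closed_convex_on X h" "y \<in> dom_on X h"
  shows "ereal (real_of_ereal (h y)) = h y"
  using assms by (cases "h y") (auto simp: proper_closed_convex_on_def dom_on_def)

lemma epigraph_dom_on:
  assumes "proper_closed_convex_on X h"
  shows "(y, r) \<in> epigraph_on X h \<longleftrightarrow> y \<in> dom_on X h \<and> real_of_ereal (h y) \<le> r"
  using assms by (cases "h y") (auto simp: proper_closed_convex_on_def dom_on_def epigraph_on_def)

lemma convex_on_dom_on:
  assumes h: "proper_closed_convex_on X h"
  shows "convex_on (dom_on X h) (\<lambda>y. real_of_ereal (h y))"
proof -
  have *: "a *\<^sub>R x + b *\<^sub>R y \<in> dom_on X h \<and> real_of_ereal (h (a *\<^sub>R x + b *\<^sub>R y))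
      \<le> a * real_of_ereal (h x) + b * real_of_ereal (h y)"
    if "x \<in> dom_on X h" "y \<in> dom_on X h" "0 \<le> a" "0 \<le> b" "a + b = 1" for x y and a b :: real
  proof -
    have "convex (epigraph_on X h)" using h by (simp add: proper_closed_convex_on_def)
    then have "a *\<^sub>R (x, real_of_ereal (h x)) + b *\<^sub>R (y, real_of_ereal (h y)) \<in> epigraph_on X h"
      using that by (intro convexD) (auto simp: epigraph_dom_on[OF h])
    then show ?thesis by (simp add: epigraph_dom_on[OF h])
  qed
  show ?thesis unfolding convex_on_def convex_def using * by auto
qed

text \<open>Separates the closed epigraph from a point just below it. The hyperplane is not vertical
  because that point and the epigraph point above it differ only in the last coordinate.\<close>

lemma affine_minorant:
  assumes h: "proper_closed_convex_on X h"
  obtains a c where "\<And>y. y \<in> dom_on X h \<Longrightarrow> a \<bullet> y + c \<le> real_of_ereal (h y)"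
proof -
  obtain x0 where x0: "x0 \<in> dom_on X h" using h by (auto simp: proper_closed_convex_on_def)
  let ?v = "real_of_ereal (h x0)"
  have "(x0, ?v - 1) \<notin> epigraph_on X h" by (simp add: epigraph_dom_on[OF h])
  moreover have "closed (epigraph_on X h)" "convex (epigraph_on X h)"
    using h by (auto simp: proper_closed_convex_on_def)
  ultimately obtain p b where p: "p \<bullet> (x0, ?v - 1) < b" "\<And>e. e \<in> epigraph_on X h \<Longrightarrow> b < p \<bullet> e"
    using separating_hyperplane_closed_point by metis
  obtain a \<alpha> where a: "p = (a, \<alpha>)" by (cases p)
  have "b < a \<bullet> x0 + \<alpha> * ?v" using p(2)[of "(x0, ?v)"] x0 by (simp add: a epigraph_dom_on[OF h])
  moreover have "a \<bullet> x0 + \<alpha> * (?v - 1) < b" using p(1) by (simp add: a)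
  ultimately have \<alpha>: "0 < \<alpha>" by (simp add: algebra_simps)
  have "(- a /\<^sub>R \<alpha>) \<bullet> y + b / \<alpha> \<le> real_of_ereal (h y)" if "y \<in> dom_on X h" for y
  proof -
    have "b < a \<bullet> y + \<alpha> * real_of_ereal (h y)"
      using p(2)[of "(y, real_of_ereal (h y))"] that by (simp add: a epigraph_dom_on[OF h])
    then show ?thesis using \<alpha> by (simp add: field_simps)
  qed
  then show ?thesis by (rule that)
qed

text \<open>Lower semicontinuity is available as closedness of the epigraph, so the continuous
  function \<open>q\<close> is minimized over a part of the epigraph. Quadratic growth against the
  affine minorant makes that part compact.\<close>

lemma prox_minimizer_exists:
  fixes X :: "'a::euclidean_space set"
  assumes h: "proper_closed_convex_on X h" and t: "0 < t"
  shows "\<exists>p\<in>dom_on X h. \<forall>y\<in>dom_on X h. real_of_ereal (h p) + 1 / (2 * t) * (norm (p - u))\<^sup>2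
           \<le> real_of_ereal (h y) + 1 / (2 * t) * (norm (y - u))\<^sup>2"
proof -
  obtain a c where ac: "\<And>y. y \<in> dom_on X h \<Longrightarrow> a \<bullet> y + c \<le> real_of_ereal (h y)"
    using affine_minorant[OF h] by blast
  obtain x0 where x0: "x0 \<in> dom_on X h" using h by (auto simp: proper_closed_convex_on_def)
  define q where "q = (\<lambda>e :: 'a \<times> real. snd e + 1 / (2 * t) * (norm (fst e - u))\<^sup>2)"
  define \<alpha> where "\<alpha> = q (x0, real_of_ereal (h x0))"
  have q: "continuous_on UNIV q" unfolding q_def by (intro continuous_intros)
  define S where "S = epigraph_on X h \<inter> {e. q e \<le> \<alpha>}"
  have "closed {e. q e \<le> \<alpha>}" using q by (intro closed_Collect_le continuous_intros)
  then have "closed S" unfolding S_def using h by (intro closed_Int) (auto simp: proper_closed_convex_on_def)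
  define \<beta> where "\<beta> = \<bar>\<alpha> - c - a \<bullet> u\<bar>"
  \<comment> \<open>Membership in \<open>S\<close> yields
    \<open>D\<^sup>2 \<le> 2 * t * \<beta> + 2 * t * norm a * D\<close> for the distance
    \<open>D\<close>. For \<open>D > 1\<close> the right side is below \<open>R * D\<close>, which
    excludes \<open>D > R\<close>.\<close>
  define R where "R = 2 * t * norm a + 1 + 2 * t * \<beta>"
  have bnd: "norm (y - u) \<le> R" if yr: "(y, r) \<in> S" for y r
  proof (rule ccontr)
    let ?D = "norm (y - u)"
    assume "\<not> ?D \<le> R"
    then have D: "R < ?D" by simp
    moreover have "1 \<le> R" using t by (simp add: R_def \<beta>_def)
    ultimately have D1: "1 < ?D" by linarith
    have "a \<bullet> y + c \<le> r" using yr ac[of y] by (auto simp: S_def epigraph_dom_on[OF h])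
    moreover have "r + 1 / (2 * t) * ?D\<^sup>2 \<le> \<alpha>" using yr by (simp add: S_def q_def)
    moreover have "- (a \<bullet> (y - u)) \<le> norm a * ?D" using norm_cauchy_schwarz[of "- a" "y - u"] by simp
    ultimately have "1 / (2 * t) * ?D\<^sup>2 \<le> \<beta> + norm a * ?D" by (simp add: \<beta>_def inner_diff_right)
    then have "?D\<^sup>2 \<le> 2 * t * \<beta> + 2 * t * norm a * ?D" using t by (simp add: field_simps)
    also have "\<dots> < (1 + 2 * t * \<beta>) * ?D + 2 * t * norm a * ?D"
    proof -
      have "(1 + 2 * t * \<beta>) * 1 \<le> (1 + 2 * t * \<beta>) * ?D"
        using D1 t by (intro mult_left_mono) (auto simp: \<beta>_def)
      moreover have "2 * t * \<beta> + z < z' + z" if "(1 + 2 * t * \<beta>) * 1 \<le> z'" for z z' :: real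
        using that by simp
      ultimately show ?thesis by blast
    qed
    also have "\<dots> = R * ?D" by (simp add: R_def algebra_simps)
    also have "\<dots> \<le> ?D\<^sup>2" using mult_right_mono[of R ?D ?D] D by (simp add: power2_eq_square)
    finally show False by simp
  qed
  have "S \<subseteq> cball u R \<times> {- (norm a * (norm u + R)) + c .. \<alpha>}"
  proof
    fix e assume e: "e \<in> S"
    obtain y r where yr: "e = (y, r)" by (cases e)
    have D: "norm (y - u) \<le> R" using bnd e yr by simp
    have "norm y \<le> norm u + R" using D norm_triangle_sub[of y u] by linarith
    then have "norm a * norm y \<le> norm a * (norm u + R)" by (intro mult_left_mono) auto
    moreover have "- (a \<bullet> y) \<le> norm a * norm y" using norm_cauchy_schwarz[of "- a" y] by simp
    moreover have "a \<bullet> y + c \<le> r" using e yr ac[of y] by (auto simp: S_def epigraph_dom_on[OF h])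
    moreover have "r \<le> \<alpha>"
    proof -
      have "r + 1 / (2 * t) * (norm (y - u))\<^sup>2 \<le> \<alpha>" using e yr by (simp add: S_def q_def)
      moreover have "0 \<le> 1 / (2 * t) * (norm (y - u))\<^sup>2" using t by simp
      ultimately show ?thesis by linarith
    qed
    ultimately show "e \<in> cball u R \<times> {- (norm a * (norm u + R)) + c .. \<alpha>}"
      using D yr by (auto simp: dist_norm norm_minus_commute)
  qed
  then have "bounded S" by (rule bounded_subset[rotated]) (intro bounded_Times bounded_cball bounded_closed_interval)
  then have "compact S" using \<open>closed S\<close> by (simp add: compact_eq_bounded_closed)
  moreover have x0S: "(x0, real_of_ereal (h x0)) \<in> S"
    using x0 by (simp add: S_def \<alpha>_def epigraph_dom_on[OF h])
  ultimately obtain e where e: "e \<in> S" "\<And>e'. e' \<in> S \<Longrightarrow> q e \<le> q e'"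
    using continuous_attains_inf[of S q] continuous_on_subset[OF q] by blast
  obtain p r where pr: "e = (p, r)" by (cases e)
  have p: "p \<in> dom_on X h" "real_of_ereal (h p) \<le> r"
    using e(1) by (auto simp: pr S_def epigraph_dom_on[OF h])
  \<comment> \<open>The minimizer may lie strictly above the graph, but lowering it onto the graph
    cannot increase \<open>q\<close>. Graph points outside \<open>S\<close> have values above
    \<open>\<alpha>\<close>.\<close>
  have "q (p, real_of_ereal (h p)) \<le> q (y, real_of_ereal (h y))" if y: "y \<in> dom_on X h" for y
  proof -
    have "q (p, real_of_ereal (h p)) \<le> q e" using p by (simp add: q_def pr)
    also have "\<dots> \<le> q (y, real_of_ereal (h y))"
    proof (cases "q (y, real_of_ereal (h y)) \<le> \<alpha>")
      case True
      then show ?thesis using y by (intro e(2)) (simp add: S_def epigraph_dom_on[OF h])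
    next
      case False
      then show ?thesis using e(2)[OF x0S] by (simp add: \<alpha>_def)
    qed
    finally show ?thesis .
  qed
  then show ?thesis using p(1) by (auto simp: q_def)
qed

text \<open>Since \<open>prox\<close> chooses some minimizer of an extended-real objective,
  existence is first transferred to that objective, whose value is infinite off the domain.\<close>

lemma prox_minimizer:
  fixes X :: "'a::euclidean_space set"
  assumes h: "proper_closed_convex_on X h" and t: "0 < t"
  shows "prox X t h u \<in> dom_on X h"
    and "y \<in> dom_on X h \<Longrightarrow> real_of_ereal (h (prox X t h u)) + 1 / (2 * t) * (norm (prox X t h u - u))\<^sup>2
           \<le> real_of_ereal (h y) + 1 / (2 * t) * (norm (y - u))\<^sup>2"
proof -
  let ?q = "\<lambda>y. h y + ereal (1 / (2 * t) * (norm (y - u))\<^sup>2)"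
  have q: "?q y = ereal (real_of_ereal (h y) + 1 / (2 * t) * (norm (y - u))\<^sup>2)" if "y \<in> dom_on X h" for y
    by (subst dom_on_ereal[OF h that, symmetric]) simp
  obtain p where p: "p \<in> dom_on X h" "\<And>y. y \<in> dom_on X h \<Longrightarrow>
      real_of_ereal (h p) + 1 / (2 * t) * (norm (p - u))\<^sup>2
           \<le> real_of_ereal (h y) + 1 / (2 * t) * (norm (y - u))\<^sup>2"
    using prox_minimizer_exists[OF h t] by blast
  have "?q p \<le> ?q y" if "y \<in> X" for y
  proof (cases "y \<in> dom_on X h")
    case True
    show ?thesis unfolding q[OF True] q[OF p(1)] using p(2)[OF True] by simp
  next
    case False
    then have "h y = \<infinity>" using that by (auto simp: dom_on_def)
    then show ?thesis by simp
  qed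
  then have "is_arg_min ?q (\<lambda>y. y \<in> X) p"
    using p(1) by (auto simp: is_arg_min_def dom_on_def not_less)
  then have am: "is_arg_min ?q (\<lambda>y. y \<in> X) (prox X t h u)"
    unfolding prox_def arg_min_def by (rule someI)
  then have le: "?q (prox X t h u) \<le> ?q y" if "y \<in> dom_on X h" for y
    using that by (auto simp: is_arg_min_def dom_on_def not_less)
  have "?q (prox X t h u) < \<infinity>" using le[OF p(1)] q[OF p(1)] by auto
  then show d: "prox X t h u \<in> dom_on X h"
    using am by (auto simp: is_arg_min_def dom_on_def)
  show "real_of_ereal (h (prox X t h u)) + 1 / (2 * t) * (norm (prox X t h u - u))\<^sup>2
           \<le> real_of_ereal (h y) + 1 / (2 * t) * (norm (y - u))\<^sup>2" if "y \<in> dom_on X h"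
    using le[OF that] unfolding q[OF that] q[OF d] by simp
qed

text \<open>The minimizer is compared with points moved a fraction \<open>s\<close> towards
  \<open>y\<close>. Convexity allows division by \<open>s\<close>, and the quadratic remainder
  vanishes as \<open>s\<close> tends to 0.\<close>

lemma prox_subgradient:
  fixes X :: "'a::euclidean_space set"
  assumes h: "proper_closed_convex_on X h" and t: "0 < t"
  shows "subgradient_on X h (prox X t h u) ((u - prox X t h u) /\<^sub>R t)"
  unfolding subgradient_on_def
proof (intro conjI ballI)
  let ?p = "prox X t h u" and ?r = "\<lambda>y. real_of_ereal (h y)"
  show p: "?p \<in> dom_on X h" by (rule prox_minimizer(1)[OF h t])
  fix y assume y: "y \<in> dom_on X h"
  have "?r ?p + ((u - ?p) /\<^sub>R t) \<bullet> (y - ?p) - ?r y \<le> s * ((norm (y - ?p))\<^sup>2 / (2 * t))"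
    if s: "0 < s" "s < 1" for s
  proof -
    let ?z = "(1 - s) *\<^sub>R ?p + s *\<^sub>R y"
    have cv: "convex_on (dom_on X h) ?r" by (rule convex_on_dom_on[OF h])
    have z: "?z \<in> dom_on X h"
      using cv p y s by (intro convexD[of "dom_on X h"]) (auto simp: convex_on_def)
    have 1: "?r ?z \<le> (1 - s) * ?r ?p + s * ?r y"
      using convex_onD[OF cv, of s ?p y] p y s by simp
    have 2: "?r ?p + 1 / (2 * t) * (norm (?p - u))\<^sup>2 \<le> ?r ?z + 1 / (2 * t) * (norm (?z - u))\<^sup>2"
      by (rule prox_minimizer(2)[OF h t z])
    have 3: "(norm (?z - u))\<^sup>2 = (norm (?p - u))\<^sup>2 - 2 * s * ((u - ?p) \<bullet> (y - ?p)) + s\<^sup>2 * (norm (y - ?p))\<^sup>2"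
    proof -
      have sq: "(norm (a + s *\<^sub>R c))\<^sup>2 = (norm a)\<^sup>2 + 2 * s * (a \<bullet> c) + s\<^sup>2 * (norm c)\<^sup>2" for a c :: 'a
        unfolding power2_norm_eq_inner
        by (simp add: inner_add_left inner_add_right inner_commute power2_eq_square)
      have "?z - u = (?p - u) + s *\<^sub>R (y - ?p)" by (simp add: algebra_simps)
      then have "(norm (?z - u))\<^sup>2
          = (norm (?p - u))\<^sup>2 + 2 * s * ((?p - u) \<bullet> (y - ?p)) + s\<^sup>2 * (norm (y - ?p))\<^sup>2"
        by (simp only: sq)
      moreover have "(?p - u) \<bullet> (y - ?p) = - ((u - ?p) \<bullet> (y - ?p))" by (simp add: inner_diff_left)
      ultimately show ?thesis by simp
    qed
    \<comment> \<open>Abstract real variables make the division by \<open>s\<close> pure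
      arithmetic.\<close>
    have arith: "pr + I / t - yr \<le> s * (D / (2 * t))"
      if "zr \<le> (1 - s) * pr + s * yr" "pr + 1 / (2 * t) * P \<le> zr + 1 / (2 * t) * Z"
        "Z = P - 2 * s * I + s\<^sup>2 * D" for pr yr zr P Z I D :: real
    proof -
      have "1 / (2 * t) * Z = 1 / (2 * t) * P - s * (I / t) + s * (s * (D / (2 * t)))"
        unfolding that(3) using t by (simp add: field_simps power2_eq_square)
      then have "s * (pr + I / t - yr) \<le> s * (s * (D / (2 * t)))"
        using that(1,2) by (simp add: algebra_simps)
      then show ?thesis by (rule mult_left_le_imp_le[OF _ s(1)])
    qed
    have "?r ?p + (u - ?p) \<bullet> (y - ?p) / t - ?r y \<le> s * ((norm (y - ?p))\<^sup>2 / (2 * t))"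
      by (rule arith[OF 1 2 3])
    moreover have "((u - ?p) /\<^sub>R t) \<bullet> (y - ?p) = (u - ?p) \<bullet> (y - ?p) / t"
      by (simp add: divide_inverse mult.commute)
    ultimately show ?thesis by simp
  qed
  then have "\<forall>\<^sub>F s in at_right 0. ?r ?p + ((u - ?p) /\<^sub>R t) \<bullet> (y - ?p) - ?r y \<le> s * ((norm (y - ?p))\<^sup>2 / (2 * t))"
    using eventually_at_right_real[of 0 1] by (auto elim: eventually_mono)
  moreover have "((\<lambda>s. s * ((norm (y - ?p))\<^sup>2 / (2 * t))) \<longlongrightarrow> 0) (at_right 0)"
    by (intro tendsto_mult_left_zero) (rule tendsto_ident_at)
  ultimately have "?r ?p + ((u - ?p) /\<^sub>R t) \<bullet> (y - ?p) - ?r y \<le> 0"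
    by (intro tendsto_lowerbound[where F = "at_right (0::real)"]) auto
  then show "?r ?p + ((u - ?p) /\<^sub>R t) \<bullet> (y - ?p) \<le> ?r y" by simp
qed

lemma prox_eqI:
  assumes h: "proper_closed_convex_on X h" and t: "0 < t"
    and p: "subgradient_on X h p ((u - p) /\<^sub>R t)"
  shows "prox X t h u = p"
proof -
  let ?q = "prox X t h u"
  have "0 \<le> ((u - ?q) /\<^sub>R t - (u - p) /\<^sub>R t) \<bullet> (?q - p)"
    by (rule subgradient_on_monotone[OF prox_subgradient[OF h t] p])
  also have "\<dots> = - ((norm (?q - p))\<^sup>2 / t)"
    by (simp add: power2_norm_eq_inner algebra_simps inner_diff divide_inverse)
  finally have "(norm (?q - p))\<^sup>2 / t = 0" using t by (simp add: divide_le_0_iff)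
  then show ?thesis using t by simp
qed

lemma prox_firmly_nonexpansive:
  assumes h: "proper_closed_convex_on X h" and t: "0 < t"
  shows "(norm (prox X t h u - prox X t h v))\<^sup>2 \<le> (prox X t h u - prox X t h v) \<bullet> (u - v)"
proof -
  let ?p = "prox X t h u" and ?q = "prox X t h v"
  have "0 \<le> ((u - ?p) /\<^sub>R t - (v - ?q) /\<^sub>R t) \<bullet> (?p - ?q)"
    by (rule subgradient_on_monotone[OF prox_subgradient[OF h t] prox_subgradient[OF h t]])
  also have "\<dots> = ((?p - ?q) \<bullet> (u - v) - (norm (?p - ?q))\<^sup>2) / t"
    by (simp add: power2_norm_eq_inner algebra_simps inner_diff divide_inverse inner_commute)
  finally show ?thesis using t by (simp add: zero_le_divide_iff)
qed

lemma prox_nonexpansive: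
  assumes h: "proper_closed_convex_on X h" and t: "0 < t"
  shows "1-lipschitz_on S (prox X t h)"
proof (rule lipschitz_onI)
  fix u v
  let ?d = "prox X t h u - prox X t h v"
  have "norm ?d * norm ?d \<le> norm ?d * norm (u - v)"
    using prox_firmly_nonexpansive[OF h t, of u v] norm_cauchy_schwarz[of ?d "u - v"]
    by (simp add: power2_eq_square)
  then have "norm ?d \<le> norm (u - v)"
    by (cases "norm ?d = 0") (auto dest: mult_left_le_imp_le)
  then show "dist (prox X t h u) (prox X t h v) \<le> 1 * dist u v" by (simp add: dist_norm)
qed simp

section \<open>Moreau envelopes and their gradients\<close>

lemma moreau_env_eq:
  fixes X :: "'a::euclidean_space set"
  assumes h: "proper_closed_convex_on X h" and s: "0 < \<sigma>"
  shows "moreau_env X \<sigma> h u = real_of_ereal (h (prox X (1 / \<sigma>) h u)) + \<sigma> / 2 * (norm (prox X (1 / \<sigma>) h u - u))\<^sup>2"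
proof -
  let ?p = "prox X (1 / \<sigma>) h u"
  let ?q = "\<lambda>y. h y + ereal (\<sigma> / 2 * (norm (y - u))\<^sup>2)"
  note pm = prox_minimizer(2)[OF h, of "1 / \<sigma>" _ u]
  have q: "?q y = ereal (real_of_ereal (h y) + \<sigma> / 2 * (norm (y - u))\<^sup>2)" if "y \<in> dom_on X h" for y
    by (subst dom_on_ereal[OF h that, symmetric]) simp
  have p: "?p \<in> dom_on X h" using prox_minimizer(1)[OF h] s by simp
  have "(INF y\<in>X. ?q y) = ?q ?p"
  proof (rule antisym[OF INF_lower INF_greatest])
    show "?p \<in> X" using p by (simp add: dom_on_def)
    fix y assume y: "y \<in> X"
    show "?q ?p \<le> ?q y"
    proof (cases "y \<in> dom_on X h")
      case True
      then show ?thesis unfolding q[OF True] q[OF p] using pm[of y] s by simp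
    next
      case False
      then have "h y = \<infinity>" using y by (auto simp: dom_on_def)
      then show ?thesis by simp
    qed
  qed
  then show ?thesis unfolding moreau_env_def q[OF p] by simp
qed

text \<open>The proximal point of \<open>u\<close> is a competitor in the infimum at
  \<open>v\<close>.\<close>

lemma moreau_env_upper_bound:
  fixes X :: "'a::euclidean_space set"
  assumes h: "proper_closed_convex_on X h" and s: "0 < \<sigma>"
  shows "moreau_env X \<sigma> h v \<le> moreau_env X \<sigma> h u + (\<sigma> *\<^sub>R (u - prox X (1 / \<sigma>) h u)) \<bullet> (v - u)
           + \<sigma> / 2 * (norm (v - u))\<^sup>2"
proof -
  let ?p = "prox X (1 / \<sigma>) h u"
  have "moreau_env X \<sigma> h v \<le> real_of_ereal (h ?p) + \<sigma> / 2 * (norm (?p - v))\<^sup>2"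
    using prox_minimizer(2)[OF h, of "1 / \<sigma>"] prox_minimizer(1)[OF h, of "1 / \<sigma>"] s
    by (simp add: moreau_env_eq[OF h s])
  moreover have "(norm (?p - v))\<^sup>2 = (norm (?p - u))\<^sup>2 + 2 * ((u - ?p) \<bullet> (v - u)) + (norm (v - u))\<^sup>2"
    by (simp add: power2_norm_eq_inner inner_diff inner_commute algebra_simps)
  then have "\<sigma> / 2 * (norm (?p - v))\<^sup>2 = \<sigma> / 2 * (norm (?p - u))\<^sup>2 + \<sigma> * ((u - ?p) \<bullet> (v - u)) + \<sigma> / 2 * (norm (v - u))\<^sup>2"
    by (simp only: distrib_left)
  ultimately show ?thesis unfolding moreau_env_eq[OF h s, of u] inner_scaleR_left by linarith
qed

text \<open>The identity minus a firmly nonexpansive map is again firmly nonexpansive; scaling by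
  \<open>\<sigma>\<close> gives the constant.\<close>

lemma moreau_gradient_cocoercive:
  assumes h: "proper_closed_convex_on X h" and s: "0 < \<sigma>"
  defines "g \<equiv> \<lambda>u. \<sigma> *\<^sub>R (u - prox X (1 / \<sigma>) h u)"
  shows "(norm (g u - g v))\<^sup>2 \<le> \<sigma> * ((g u - g v) \<bullet> (u - v))"
proof -
  define d where "d = prox X (1 / \<sigma>) h u - prox X (1 / \<sigma>) h v"
  have d: "(norm d)\<^sup>2 \<le> d \<bullet> (u - v)"
    unfolding d_def using prox_firmly_nonexpansive[OF h] s by simp
  have g: "g u - g v = \<sigma> *\<^sub>R ((u - v) - d)" by (simp add: g_def d_def algebra_simps)
  have "(norm ((u - v) - d))\<^sup>2 = ((u - v) - d) \<bullet> (u - v) - (d \<bullet> (u - v) - (norm d)\<^sup>2)"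
    by (simp only: power2_norm_eq_inner inner_diff_left inner_diff_right inner_commute)
  then have "(norm ((u - v) - d))\<^sup>2 \<le> ((u - v) - d) \<bullet> (u - v)" using d by linarith
  then have "\<sigma>\<^sup>2 * (norm ((u - v) - d))\<^sup>2 \<le> \<sigma>\<^sup>2 * (((u - v) - d) \<bullet> (u - v))"
    by (intro mult_left_mono) auto
  then show ?thesis unfolding g using s by (simp add: power_mult_distrib power2_eq_square mult.assoc)
qed

lemma moreau_gradient_lipschitz:
  assumes h: "proper_closed_convex_on X h" and s: "0 < \<sigma>"
  shows "\<sigma>-lipschitz_on S (\<lambda>u. \<sigma> *\<^sub>R (u - prox X (1 / \<sigma>) h u))"
proof (rule lipschitz_onI)
  fix u v
  define d where "d = \<sigma> *\<^sub>R (u - prox X (1 / \<sigma>) h u) - \<sigma> *\<^sub>R (v - prox X (1 / \<sigma>) h v)"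
  have "(norm d)\<^sup>2 \<le> \<sigma> * (d \<bullet> (u - v))"
    unfolding d_def by (rule moreau_gradient_cocoercive[OF h s])
  also have "\<dots> \<le> \<sigma> * (norm d * norm (u - v))"
    using s norm_cauchy_schwarz by (intro mult_left_mono) auto
  finally have "norm d * norm d \<le> norm d * (\<sigma> * norm (u - v))" by (simp add: power2_eq_square mult_ac)
  then have "norm d \<le> \<sigma> * norm (u - v)"
    using s by (cases "norm d = 0") (auto dest: mult_left_le_imp_le)
  then show "dist (\<sigma> *\<^sub>R (u - prox X (1 / \<sigma>) h u)) (\<sigma> *\<^sub>R (v - prox X (1 / \<sigma>) h v)) \<le> \<sigma> * dist u v"
    by (simp add: dist_norm d_def)
qed (use s in simp)

text \<open>The upper bound, used once from \<open>u\<close> and once from \<open>v\<close>,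
  encloses the envelope. Lipschitz continuity of \<open>g\<close> turns the enclosure into a
  quadratic error.\<close>

lemma moreau_env_has_derivative:
  fixes X :: "'a::euclidean_space set"
  assumes h: "proper_closed_convex_on X h" and s: "0 < \<sigma>"
  shows "(moreau_env X \<sigma> h has_derivative (\<lambda>v. (\<sigma> *\<^sub>R (u - prox X (1 / \<sigma>) h u)) \<bullet> v)) (at u within S)"
proof -
  define e where "e = moreau_env X \<sigma> h"
  define g where "g u = \<sigma> *\<^sub>R (u - prox X (1 / \<sigma>) h u)" for u
  have up: "e v \<le> e u + g u \<bullet> (v - u) + \<sigma> / 2 * (norm (v - u))\<^sup>2" for u v
    unfolding e_def g_def by (rule moreau_env_upper_bound[OF h s])
  have quad: "\<bar>e v - e u - g u \<bullet> (v - u)\<bar> \<le> 2 * \<sigma> * (norm (v - u))\<^sup>2" for v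
  proof -
    have "(g u - g v) \<bullet> (v - u) \<le> norm (g u - g v) * norm (v - u)" by (rule norm_cauchy_schwarz)
    also have "\<dots> \<le> (\<sigma> * norm (u - v)) * norm (v - u)"
      using lipschitz_on_normD[OF moreau_gradient_lipschitz[OF h s, of UNIV], of u v]
      by (intro mult_right_mono) (auto simp: g_def)
    finally have "(g u - g v) \<bullet> (v - u) \<le> \<sigma> * (norm (v - u))\<^sup>2"
      by (simp add: power2_eq_square norm_minus_commute mult.assoc)
    then have "g u \<bullet> (v - u) - g v \<bullet> (v - u) \<le> \<sigma> * (norm (v - u))\<^sup>2" by (simp add: inner_diff_left)
    moreover have "e u \<le> e v - g v \<bullet> (v - u) + \<sigma> / 2 * (norm (v - u))\<^sup>2"
      using up[of u v] by (simp add: norm_minus_commute inner_diff_right)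
    moreover have "0 \<le> \<sigma> * (norm (v - u))\<^sup>2" using s by simp
    ultimately show ?thesis using up[of v u] by (auto simp: abs_le_iff)
  qed
  have "(e has_derivative (\<lambda>v. g u \<bullet> v)) (at u within S)"
  proof (rule has_derivativeI_sandwich[where e = 1 and H = "\<lambda>v. 2 * \<sigma> * norm (v - u)"])
    show "((\<lambda>v. 2 * \<sigma> * norm (v - u)) \<longlongrightarrow> 0) (at u within S)"
      by (rule tendsto_eq_intros refl tendsto_ident_at | simp)+
    fix v assume "v \<noteq> u"
    then show "norm (e v - e u - g u \<bullet> (v - u)) / norm (v - u) \<le> 2 * \<sigma> * norm (v - u)"
      using quad[of v] by (simp add: divide_le_eq power2_eq_square mult.assoc)
  qed (auto intro: bounded_linear_inner_right)
  then show ?thesis unfolding e_def g_def .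
qed

text \<open>The epigraph of the conjugate is an intersection of half-spaces. Its domain is nonempty
  because a subgradient, here supplied by the proximal point of 0, makes the conjugate
  finite.\<close>

lemma proper_closed_convex_fenchel_conjugate:
  fixes X :: "'a::euclidean_space set"
  assumes X: "subspace X" and h: "proper_closed_convex_on X h"
  shows "proper_closed_convex_on X (fenchel_conjugate X h)"
proof -
  let ?r = "\<lambda>y. real_of_ereal (h y)"
  have val: "ereal (x \<bullet> y) - h x = ereal (x \<bullet> y - ?r x)" if "x \<in> dom_on X h" for x y
    by (subst dom_on_ereal[OF h that, symmetric]) simp
  have le_iff: "fenchel_conjugate X h y \<le> ereal r \<longleftrightarrow> (\<forall>x\<in>dom_on X h. x \<bullet> y - ?r x \<le> r)" for y r
  proof -
    have "fenchel_conjugate X h y \<le> ereal r \<longleftrightarrow> (\<forall>x\<in>X. ereal (x \<bullet> y) - h x \<le> ereal r)"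
      unfolding fenchel_conjugate_def by (rule SUP_le_iff)
    also have "\<dots> \<longleftrightarrow> (\<forall>x\<in>dom_on X h. ereal (x \<bullet> y) - h x \<le> ereal r)"
      by (auto simp: dom_on_def)
    also have "\<dots> \<longleftrightarrow> (\<forall>x\<in>dom_on X h. x \<bullet> y - ?r x \<le> r)" by (simp add: val)
    finally show ?thesis .
  qed
  have epi: "epigraph_on X (fenchel_conjugate X h)
      = (X \<times> UNIV) \<inter> (\<Inter>x\<in>dom_on X h. {e. (x, - 1) \<bullet> e \<le> ?r x})"
    by (auto simp: epigraph_on_def le_iff algebra_simps)
  obtain x0 where x0: "x0 \<in> dom_on X h" using h by (auto simp: proper_closed_convex_on_def)
  have "closed (epigraph_on X (fenchel_conjugate X h))"
    unfolding epi using X by (intro closed_Int closed_Times closed_INT ballI closed_halfspace_le) (auto simp: closed_subspace)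
  moreover have "convex (epigraph_on X (fenchel_conjugate X h))"
    unfolding epi using X by (intro convex_Int convex_Times convex_INT ballI convex_halfspace_le) (auto simp: subspace_imp_convex)
  moreover have "fenchel_conjugate X h y \<noteq> - \<infinity>" for y
  proof
    assume "fenchel_conjugate X h y = - \<infinity>"
    then have "fenchel_conjugate X h y \<le> ereal (x0 \<bullet> y - ?r x0 - 1)" by simp
    then show False using x0 unfolding le_iff by fastforce
  qed
  moreover have "dom_on X (fenchel_conjugate X h) \<noteq> {}"
  proof -
    define p where "p = prox X 1 h 0"
    have sg: "subgradient_on X h p (- p)" using prox_subgradient[OF h, of 1 0] by (simp add: p_def)
    then have pX: "- p \<in> X" using X by (auto simp: subgradient_on_def dom_on_def subspace_neg)
    have "fenchel_conjugate X h (- p) \<le> ereal (- (p \<bullet> p) - ?r p)"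
      unfolding le_iff using sg by (auto simp: subgradient_on_def inner_diff_right inner_commute algebra_simps)
    then have "fenchel_conjugate X h (- p) < \<infinity>" using le_less_trans by fastforce
    then show ?thesis using pX by (auto simp: dom_on_def)
  qed
  ultimately show ?thesis by (simp add: proper_closed_convex_on_def)
qed

section \<open>Lagrange multipliers under a relative interior condition\<close>

lemma sum_fun_upd:
  fixes f :: "'n::finite \<Rightarrow> 'a \<Rightarrow> 'b::ab_group_add"
  shows "(\<Sum>j\<in>UNIV. f j ((g(i := x)) j)) = (\<Sum>j\<in>UNIV. f j (g j)) + (f i x - f i (g i))"
proof -
  have "(\<Sum>j\<in>UNIV - {i}. f j ((g(i := x)) j)) = (\<Sum>j\<in>UNIV - {i}. f j (g j))"
    by (intro sum.cong) auto
  then show ?thesis by (simp add: sum.remove[of UNIV i])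
qed

text \<open>Separates the origin from the set of pairs of constraint residual and value exceeding
  the optimal one. The points \<open>xs i\<close> of the relative interiors force a nonzero weight
  on the value component, and dividing by it yields the multiplier.\<close>

lemma lagrange_multiplier_exists:
  fixes S :: "'n::finite \<Rightarrow> 'a::euclidean_space set" and f :: "'n \<Rightarrow> 'a \<Rightarrow> real"
    and B :: "'n \<Rightarrow> 'a \<Rightarrow> 'b::euclidean_space"
  assumes cv: "\<And>i. convex_on (S i) (f i)" and B: "\<And>i. linear (B i)"
    and xs: "\<And>i. xs i \<in> rel_interior (S i)" "(\<Sum>i\<in>UNIV. B i (xs i)) = b"
    and xo: "\<And>i. xo i \<in> S i" "(\<Sum>i\<in>UNIV. B i (xo i)) = b"
    and opt: "\<And>x. (\<And>i. x i \<in> S i) \<Longrightarrow> (\<Sum>i\<in>UNIV. B i (x i)) = b \<Longrightarrow>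
      (\<Sum>i\<in>UNIV. f i (xo i)) \<le> (\<Sum>i\<in>UNIV. f i (x i))"
  shows "\<exists>y. \<forall>i. \<forall>x\<in>S i. f i (xo i) + y \<bullet> B i (x - xo i) \<le> f i x"
proof -
  define v where "v = (\<Sum>i\<in>UNIV. f i (xo i))"
  \<comment> \<open>The strict inequality keeps the origin outside \<open>C\<close>: otherwise a
    feasible point would beat the optimal value.\<close>
  define C where "C = {((\<Sum>i\<in>UNIV. B i (x i)) - b, r) | x r. (\<forall>i. x i \<in> S i) \<and> (\<Sum>i\<in>UNIV. f i (x i)) - v < r}"
  have xsS: "xs i \<in> S i" for i using xs(1) rel_interior_subset by blast
  have CI: "((\<Sum>i\<in>UNIV. B i (x i)) - b, r) \<in> C"
    if "\<And>i. x i \<in> S i" "(\<Sum>i\<in>UNIV. f i (x i)) - v < r" for x r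
    unfolding C_def using that by blast
  have "convex C"
  proof (rule convexI)
    fix c c' and s t :: real
    assume "c \<in> C" "c' \<in> C" and st: "0 \<le> s" "0 \<le> t" "s + t = 1"
    then obtain x r x' r' where
        c: "c = ((\<Sum>i\<in>UNIV. B i (x i)) - b, r)" "\<And>i. x i \<in> S i" "(\<Sum>i\<in>UNIV. f i (x i)) - v < r"
      and c': "c' = ((\<Sum>i\<in>UNIV. B i (x' i)) - b, r')" "\<And>i. x' i \<in> S i" "(\<Sum>i\<in>UNIV. f i (x' i)) - v < r'"
      unfolding C_def by blast
    define z where "z i = s *\<^sub>R x i + t *\<^sub>R x' i" for i
    have z: "z i \<in> S i" for i
      unfolding z_def using cv[of i] c(2) c'(2) st by (intro convexD) (auto simp: convex_on_def)
    have "(\<Sum>i\<in>UNIV. f i (z i)) \<le> (\<Sum>i\<in>UNIV. s * f i (x i) + t * f i (x' i))"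
      unfolding z_def using cv c(2) c'(2) st by (intro sum_mono) (auto simp: convex_on_def)
    also have "\<dots> = s * (\<Sum>i\<in>UNIV. f i (x i)) + t * (\<Sum>i\<in>UNIV. f i (x' i))"
      by (simp add: sum.distrib sum_distrib_left)
    finally have le: "(\<Sum>i\<in>UNIV. f i (z i)) \<le> \<dots>" .
    have "0 < s * (r - ((\<Sum>i\<in>UNIV. f i (x i)) - v)) + t * (r' - ((\<Sum>i\<in>UNIV. f i (x' i)) - v))"
    proof (cases "s = 0")
      case True
      then show ?thesis using st c'(3) by simp
    next
      case False
      then show ?thesis using st c(3) c'(3) by (intro add_pos_nonneg mult_pos_pos mult_nonneg_nonneg) auto
    qed
    moreover have "v = s * v + t * v" "b = s *\<^sub>R b + t *\<^sub>R b"
      using st by (simp_all flip: distrib_right scaleR_left_distrib)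
    ultimately have "(\<Sum>i\<in>UNIV. f i (z i)) - v < s * r + t * r'"
      using le by (simp add: right_diff_distrib)
    moreover have "(\<Sum>i\<in>UNIV. B i (z i)) - b
        = s *\<^sub>R ((\<Sum>i\<in>UNIV. B i (x i)) - b) + t *\<^sub>R ((\<Sum>i\<in>UNIV. B i (x' i)) - b)"
      using \<open>b = s *\<^sub>R b + t *\<^sub>R b\<close>
      by (simp add: z_def linear_add[OF B] linear_cmul[OF B] sum.distrib scaleR_diff_right
          scaleR_sum_right algebra_simps)
    ultimately show "s *\<^sub>R c + t *\<^sub>R c' \<in> C"
      using CI[OF z] by (simp add: c(1) c'(1))
  qed
  moreover have "C \<noteq> {}" using CI[OF xsS] by (metis empty_iff lt_ex gt_ex)
  moreover have "0 \<notin> C"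
  proof
    assume "0 \<in> C"
    then obtain x where "\<And>i. x i \<in> S i" "(\<Sum>i\<in>UNIV. B i (x i)) = b" "(\<Sum>i\<in>UNIV. f i (x i)) - v < 0"
      unfolding C_def by (auto simp: zero_prod_def)
    then show False using opt[of x] by (simp add: v_def)
  qed
  \<comment> \<open>Choosing the normal in the span of \<open>C\<close> matters: a normal orthogonal
    to all of \<open>C\<close> would then be zero, which excludes \<open>\<mu> = 0\<close>
    below.\<close>
  ultimately obtain a where a: "a \<in> span C" "a \<noteq> 0" "\<And>c. c \<in> C \<Longrightarrow> 0 \<le> a \<bullet> c"
    using separating_hyperplane_set_0_inspan by blast
  obtain y \<mu> where ya: "a = (y, \<mu>)" by (cases a)
  have sep: "0 \<le> y \<bullet> ((\<Sum>i\<in>UNIV. B i (x i)) - b) + \<mu> * r"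
    if "\<And>i. x i \<in> S i" "(\<Sum>i\<in>UNIV. f i (x i)) - v < r" for x r
    using a(3)[OF CI[OF that]] by (simp add: ya)
  have "0 \<le> \<mu>"
  proof -
    define r where "r = \<bar>(\<Sum>i\<in>UNIV. f i (xs i)) - v\<bar> + 1"
    have "0 \<le> \<mu> * r" using sep[OF xsS, of r] xs(2) by (simp add: r_def)
    moreover have "0 < r" by (simp add: r_def)
    ultimately show ?thesis by (simp add: zero_le_mult_iff)
  qed
  moreover have "\<mu> \<noteq> 0"
  proof
    assume \<mu>: "\<mu> = 0"
    have sep0: "0 \<le> y \<bullet> ((\<Sum>i\<in>UNIV. B i (x i)) - b)" if "\<And>i. x i \<in> S i" for x
      using sep[OF that, of "(\<Sum>i\<in>UNIV. f i (x i)) - v + 1"] \<mu> by simp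
    have ge: "0 \<le> y \<bullet> B i (x - xs i)" if "x \<in> S i" for i x
    proof -
      have "(xs(i := x)) j \<in> S j" for j using that xsS by simp
      from sep0[OF this] show ?thesis
        by (simp add: sum_fun_upd xs(2) linear_diff[OF B] del: fun_upd_apply)
    qed
    have zero: "y \<bullet> B i (x - xs i) = 0" if x: "x \<in> S i" for i x
    proof -
      \<comment> \<open>The segment from \<open>x\<close> to the relative interior point extends
        beyond it within \<open>S i\<close>, which reverses the sign of the inequality
        \<open>ge\<close>.\<close>
      obtain e where e: "e > 1" "(1 - e) *\<^sub>R x + e *\<^sub>R xs i \<in> S i"
        using convex_rel_interior_iff[of "S i" "xs i"] cv[of i] x xs(1)[of i] by (auto simp: convex_on_def)
      have "(1 - e) *\<^sub>R x + e *\<^sub>R xs i - xs i = (1 - e) *\<^sub>R (x - xs i)" by (simp add: algebra_simps)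
      then have "0 \<le> (1 - e) * (y \<bullet> B i (x - xs i))"
        using ge[OF e(2)] by (simp add: linear_cmul[OF B])
      then show ?thesis using ge[OF x] e(1) by (auto simp: zero_le_mult_iff)
    qed
    have "a \<bullet> c = 0" if "c \<in> C" for c
    proof -
      obtain x r where c: "c = ((\<Sum>i\<in>UNIV. B i (x i)) - b, r)" "\<And>i. x i \<in> S i"
        using \<open>c \<in> C\<close> unfolding C_def by blast
      have "(\<Sum>i\<in>UNIV. B i (x i)) - b = (\<Sum>i\<in>UNIV. B i (x i - xs i))"
        by (simp add: linear_diff[OF B] sum_subtractf xs(2))
      then show ?thesis using zero c(2) by (simp add: ya c(1) \<mu> inner_sum_right)
    qed
    then have "orthogonal a a"
      using orthogonal_to_span[OF a(1)] by (auto simp: orthogonal_def)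
    then show False using a(2) by (simp add: orthogonal_def)
  qed
  ultimately have \<mu>: "0 < \<mu>" by simp
  have "f i (xo i) + (- y /\<^sub>R \<mu>) \<bullet> B i (x - xo i) \<le> f i x" if x: "x \<in> S i" for i x
  proof -
    \<comment> \<open>Varying a single block separates the joint inequality into one per index;
      \<open>r\<close> is then lowered to the actual difference.\<close>
    have S: "(xo(i := x)) j \<in> S j" for j using x xo(1) by simp
    have ge: "- (y \<bullet> B i (x - xo i)) \<le> \<mu> * r" if "f i x - f i (xo i) < r" for r
    proof -
      have "(\<Sum>j\<in>UNIV. f j ((xo(i := x)) j)) - v < r"
        using that by (simp add: sum_fun_upd v_def del: fun_upd_apply)
      from sep[OF S this] show ?thesis
        by (simp add: sum_fun_upd xo(2) linear_diff[OF B] del: fun_upd_apply)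
    qed
    then have "- (y \<bullet> B i (x - xo i)) / \<mu> \<le> r" if "f i x - f i (xo i) < r" for r
    proof -
      have "- (y \<bullet> B i (x - xo i)) \<le> r * \<mu>" by (subst mult.commute) (rule ge[OF that])
      then show ?thesis using \<mu> by (simp only: pos_divide_le_eq)
    qed
    then have "- (y \<bullet> B i (x - xo i)) / \<mu> \<le> f i x - f i (xo i)" by (rule dense_ge)
    moreover have "(- y /\<^sub>R \<mu>) \<bullet> B i (x - xo i) = - (y \<bullet> B i (x - xo i)) / \<mu>"
      by (simp add: divide_inverse mult.commute)
    ultimately show ?thesis by linarith
  qed
  then show ?thesis by blast
qed

section \<open>Lipschitz maps into product spaces\<close>

lemma linear_lipschitz_on:
  fixes f :: "'a::euclidean_space \<Rightarrow> 'b::real_normed_vector"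
  assumes "linear f"
  shows "\<exists>L. L-lipschitz_on S f"
proof -
  obtain B where B: "B > 0" "\<And>x. norm (f x) \<le> B * norm x"
    using linear_bounded_pos[OF assms] by (metis mult.commute)
  have "B-lipschitz_on S f"
    using B by (intro lipschitz_onI) (auto simp: dist_norm simp flip: linear_diff[OF assms])
  then show ?thesis by blast
qed

lemma norm_vec_le_sum: "norm (x :: 'a::real_normed_vector ^ 'n) \<le> (\<Sum>i\<in>UNIV. norm (x $ i))"
  unfolding norm_vec_def by (rule L2_set_le_sum) simp

lemma lipschitz_on_vec:
  fixes f :: "'a::metric_space \<Rightarrow> 'b::real_normed_vector ^ 'n::finite"
  assumes "\<And>i. \<exists>L. L-lipschitz_on S (\<lambda>x. f x $ i)"
  shows "\<exists>L. L-lipschitz_on S f"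
proof -
  obtain L where L: "\<And>i. (L i)-lipschitz_on S (\<lambda>x. f x $ i)" using assms by metis
  have "(\<Sum>i\<in>UNIV. L i)-lipschitz_on S f"
  proof (rule lipschitz_onI)
    fix x y assume xy: "x \<in> S" "y \<in> S"
    have "dist (f x) (f y) \<le> (\<Sum>i\<in>UNIV. norm ((f x - f y) $ i))"
      unfolding dist_norm by (rule norm_vec_le_sum)
    also have "\<dots> \<le> (\<Sum>i\<in>UNIV. L i * dist x y)"
      using lipschitz_onD[OF L xy] by (intro sum_mono) (simp add: dist_norm)
    finally show "dist (f x) (f y) \<le> (\<Sum>i\<in>UNIV. L i) * dist x y" by (simp add: sum_distrib_right)
  qed (use L lipschitz_on_nonneg in \<open>auto intro!: sum_nonneg\<close>)
  then show ?thesis by blast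
qed

lemma power2_norm_vec: "(norm (x :: 'a::real_inner ^ 'n))\<^sup>2 = (\<Sum>i\<in>UNIV. (norm (x $ i))\<^sup>2)"
  by (simp add: power2_norm_eq_inner inner_vec_def)

section \<open>The saddle map\<close>

locale saddle_problem =
  fixes X :: "'n::finite \<Rightarrow> 'a::euclidean_space set"
    and I1 :: "'n set" and N :: 'n
    and h :: "'n \<Rightarrow> 'a \<Rightarrow> ereal"
    and A :: "'n \<Rightarrow> 'a \<Rightarrow> 'a" and b :: 'a and \<sigma> :: real
  assumes N: "N \<notin> I1"
    and X: "\<And>i. subspace (X i)"
    and A: "\<And>i. i \<noteq> N \<Longrightarrow> linear (A i)" "\<And>i u. i \<noteq> N \<Longrightarrow> u \<in> X i \<Longrightarrow> A i u \<in> X N"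
    and b: "b \<in> X N"
    and finite_I1: "\<And>i u. i \<in> I1 \<Longrightarrow> u \<in> X i \<Longrightarrow> \<bar>h i u\<bar> \<noteq> \<infinity>"
    and convex_I1: "\<And>i. i \<in> I1 \<Longrightarrow> convex_on (X i) (\<lambda>u. real_of_ereal (h i u))"
    and C2_I1: "\<And>i. i \<in> I1 \<Longrightarrow> C2_on (X i) (\<lambda>u. real_of_ereal (h i u))"
    and lipschitz_I1: "\<And>i. i \<in> I1 \<Longrightarrow>
      \<exists>L. L-lipschitz_on (X i) (gradient_on (X i) (\<lambda>u. real_of_ereal (h i u)))"
    and pcc: "\<And>i. i \<notin> I1 \<Longrightarrow> proper_closed_convex_on (X i) (h i)"
    and \<sigma>: "\<sigma> > 0"
begin

abbreviation "W \<equiv> pd_space X I1 N"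

definition "H i = gradient_on (X i) (\<lambda>u. real_of_ereal (h i u))"

text \<open>The gradient of the \<open>i\<close>-th Moreau envelope, by
  \<open>moreau_env_has_derivative\<close>.\<close>

definition "G i u = \<sigma> *\<^sub>R (u - prox (X i) (1 / \<sigma>) (h i) u)"

definition "adj i = adjoint_on (X i) (A i)"

text \<open>The linear part of the argument of the \<open>i\<close>-th Moreau envelope in \<open>Phi\<close>.\<close>

definition ql :: "'n \<Rightarrow> ('a ^ 'n) \<times> ('a ^ 'n) \<Rightarrow> 'a" where
  "ql i d = (if i = N then - (\<Sum>j\<in>UNIV - {N}. A j (fst d $ j)) else fst d $ i) - snd d $ i /\<^sub>R \<sigma>"

definition "q i w = ql i w + (if i = N then b else 0)"

definition "p i w = (if i \<in> I1 then H i (fst w $ i) else G i (q i w))"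

text \<open>The common shape of \<open>F\<close> and of the gradient of \<open>Phi\<close>. The
  \<open>N\<close>-th envelope argument contains \<open>- A i\<close> applied to each primal block,
  hence the term \<open>- adj i (c N)\<close>; the argument \<open>e\<close> leaves the sign of the
  \<open>z\<close>-part open.\<close>

definition assemble :: "('n \<Rightarrow> 'a) \<Rightarrow> ('n \<Rightarrow> 'a) \<Rightarrow> ('a ^ 'n) \<times> ('a ^ 'n)" where
  "assemble c e = (\<chi> i. if i = N then 0 else c i - adj i (c N), \<chi> i. if i \<in> I1 then 0 else e i)"

definition "Fe w = assemble (\<lambda>i. p i w) (\<lambda>i. (p i w + snd w $ i) /\<^sub>R \<sigma>)"

lemma adj: "i \<noteq> N \<Longrightarrow> linear (adj i)" "i \<noteq> N \<Longrightarrow> adj i y \<in> X i"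
    "i \<noteq> N \<Longrightarrow> u \<in> X i \<Longrightarrow> A i u \<bullet> y = u \<bullet> adj i y"
  unfolding adj_def using X A
  by (auto intro: linear_adjoint_on adjoint_on_in adjoint_on_works)

lemma subspace_W: "subspace W"
  using X unfolding pd_space_def subspace_def by (auto simp: zero_prod_def)

lemma W_D:
  assumes "w \<in> W"
  shows "i \<noteq> N \<Longrightarrow> fst w $ i \<in> X i" "fst w $ N = 0" "i \<notin> I1 \<Longrightarrow> snd w $ i \<in> X i" "i \<in> I1 \<Longrightarrow> snd w $ i = 0"
  using assms by (auto simp: pd_space_def)

lemma linear_ql: "linear (ql i)"
  by (rule linearI) (auto simp: ql_def linear_add[OF A(1)] linear_cmul[OF A(1)] sum.distrib
    algebra_simps scaleR_sum_right)

lemma q_diff: "q i w - q i w' = ql i (w - w')"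
  by (simp add: q_def linear_diff[OF linear_ql])

lemma q_in:
  assumes w: "w \<in> W" and i: "i \<notin> I1"
  shows "q i w \<in> X i"
proof -
  have z: "snd w $ i /\<^sub>R \<sigma> \<in> X i" by (rule subspace_scale[OF X W_D(3)[OF w i]])
  show ?thesis
  proof (cases "i = N")
    case True
    have "(\<Sum>j\<in>UNIV - {N}. A j (fst w $ j)) \<in> X N"
      by (rule subspace_sum[OF X]) (simp add: A(2) W_D(1)[OF w])
    then show ?thesis using True z X b unfolding q_def ql_def
      by (simp add: subspace_add subspace_diff subspace_neg)
  next
    case False
    then show ?thesis using z X W_D(1)[OF w False] unfolding q_def ql_def
      by (simp add: subspace_diff)
  qed
qed

lemma H_works:
  assumes "i \<in> I1" "u \<in> X i"
  shows "H i u \<in> X i"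
    and "((\<lambda>u. real_of_ereal (h i u)) has_derivative (\<lambda>v. H i u \<bullet> v)) (at u within X i)"
  unfolding H_def using assms X C2_I1[of i] by (auto simp: C2_on_def intro!: gradient_on_works)

lemma H_gradient_inequality:
  assumes "i \<in> I1" "u \<in> X i" "v \<in> X i"
  shows "real_of_ereal (h i u) + H i u \<bullet> (v - u) \<le> real_of_ereal (h i v)"
  using assms X by (intro convex_gradient_inequality[of "X i"] convex_I1 H_works)

lemma p_in: "w \<in> W \<Longrightarrow> p i w \<in> X i"
  unfolding p_def G_def using W_D(1)[of w i] q_in[of w i] prox_minimizer(1)[OF pcc, of i "1 / \<sigma>"] X N \<sigma>
  by (auto intro!: H_works subspace_scale subspace_diff simp: dom_on_def)

section \<open>The explicit form of the saddle map\<close>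

lemma assemble_in:
  assumes "\<And>i. c i \<in> X i" "\<And>i. i \<notin> I1 \<Longrightarrow> e i \<in> X i"
  shows "assemble c e \<in> W"
  using assms X adj(2) by (auto simp: assemble_def pd_space_def intro!: subspace_diff)

lemma assemble_diff: "assemble c e - assemble c' e' = assemble (\<lambda>i. c i - c' i) (\<lambda>i. e i - e' i)"
  by (auto simp: assemble_def vec_eq_iff linear_diff[OF adj(1)])

text \<open>Moving each \<open>adj i\<close> back to \<open>A i\<close> collects all terms with
  \<open>c N\<close> in the \<open>N\<close>-th envelope argument. The summand with
  \<open>inverse \<sigma>\<close> cancels the \<open>z\<close>-part of \<open>ql\<close>.\<close>

lemma assemble_inner:
  assumes d: "d \<in> W"
  shows "assemble c e \<bullet> d = (\<Sum>i\<in>I1. c i \<bullet> fst d $ i)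
     + (\<Sum>i\<in>- I1. c i \<bullet> (ql i d + snd d $ i /\<^sub>R \<sigma>) + e i \<bullet> snd d $ i)"
proof -
  note D = W_D[OF d]
  have "(\<Sum>i\<in>UNIV. (if i = N then 0 else c i - adj i (c N)) \<bullet> fst d $ i)
      = (\<Sum>i\<in>UNIV - {N}. (c i - adj i (c N)) \<bullet> fst d $ i)"
    by (simp add: sum.remove[of UNIV N])
  also have "\<dots> = (\<Sum>i\<in>UNIV - {N}. c i \<bullet> fst d $ i - c N \<bullet> A i (fst d $ i))"
  proof (rule sum.cong[OF refl])
    fix i assume "i \<in> UNIV - {N}"
    then have "adj i (c N) \<bullet> fst d $ i = c N \<bullet> A i (fst d $ i)"
      using adj(3)[of i "fst d $ i" "c N"] D(1) by (metis DiffD2 inner_commute insertI1)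
    then show "(c i - adj i (c N)) \<bullet> fst d $ i = c i \<bullet> fst d $ i - c N \<bullet> A i (fst d $ i)"
      by (simp add: inner_diff_left)
  qed
  also have "\<dots> = (\<Sum>i\<in>UNIV - {N}. c i \<bullet> fst d $ i) - c N \<bullet> (\<Sum>i\<in>UNIV - {N}. A i (fst d $ i))"
    by (simp add: sum_subtractf inner_sum_right)
  also have "(\<Sum>i\<in>UNIV - {N}. c i \<bullet> fst d $ i)
      = (\<Sum>i\<in>I1. c i \<bullet> fst d $ i) + (\<Sum>i\<in>- I1 - {N}. c i \<bullet> fst d $ i)"
    using N by (subst sum.union_disjoint[symmetric]) (auto intro!: sum.cong)
  also have "(\<Sum>i\<in>- I1 - {N}. c i \<bullet> fst d $ i) - c N \<bullet> (\<Sum>i\<in>UNIV - {N}. A i (fst d $ i))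
     = (\<Sum>i\<in>- I1. c i \<bullet> (ql i d + snd d $ i /\<^sub>R \<sigma>))"
    using N by (simp add: sum.remove[of "- I1" N] ql_def)
  moreover have "(\<Sum>i\<in>UNIV. (if i \<in> I1 then 0 else e i) \<bullet> snd d $ i) = (\<Sum>i\<in>- I1. e i \<bullet> snd d $ i)"
    by (rule sum.mono_neutral_cong_right) auto
  ultimately show ?thesis
    by (simp add: assemble_def inner_prod_def inner_vec_def sum.distrib)
qed

text \<open>The chain rule gives the derivative block by block. It need agree with the inner product
  only in directions of \<open>W\<close>, where \<open>assemble_inner\<close> applies.\<close>

lemma Phi_has_derivative:
  assumes w: "w \<in> W"
  shows "(Phi X I1 N h A b \<sigma> has_derivative
      (\<lambda>d. assemble (\<lambda>i. p i w) (\<lambda>i. - ((p i w + snd w $ i) /\<^sub>R \<sigma>)) \<bullet> d)) (at w within W)"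
proof (rule has_derivative_subspace_cong[OF subspace_W w])
  have Phi: "Phi X I1 N h A b \<sigma> = (\<lambda>w. (\<Sum>i\<in>I1. real_of_ereal (h i (fst w $ i)))
     + (\<Sum>i\<in>- I1. moreau_env (X i) \<sigma> (h i) (q i w)) - 1 / (2 * \<sigma>) * (\<Sum>i\<in>- I1. snd w $ i \<bullet> snd w $ i))"
    using N by (simp add: Phi_def fun_eq_iff split_beta sum.remove[of "- I1" N] q_def ql_def
        power2_norm_eq_inner algebra_simps)
  have 1: "((\<lambda>w. real_of_ereal (h i (fst w $ i))) has_derivative (\<lambda>d. H i (fst w $ i) \<bullet> fst d $ i)) (at w within W)"
    if i: "i \<in> I1" for i
  proof -
    have d: "((\<lambda>w. fst w $ i) has_derivative (\<lambda>d. fst d $ i)) (at w within W)"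
      by (intro bounded_linear_imp_has_derivative bounded_linear_compose[OF bounded_linear_vec_nth bounded_linear_fst])
    have "i \<noteq> N" using i N by auto
    then have "((\<lambda>u. real_of_ereal (h i u)) has_derivative (\<bullet>) (H i (fst w $ i))) (at (fst w $ i) within (\<lambda>w. fst w $ i) ` W)"
      using W_D(1) w by (intro has_derivative_subset[OF H_works(2)[OF i]]) auto
    from has_derivative_in_compose[OF d this] show ?thesis .
  qed
  have 2: "((\<lambda>w. moreau_env (X i) \<sigma> (h i) (q i w)) has_derivative (\<lambda>d. G i (q i w) \<bullet> ql i d)) (at w within W)"
    if i: "i \<notin> I1" for i
  proof -
    have d: "(q i has_derivative ql i) (at w within W)"
      unfolding q_def using linear_ql
      by (intro has_derivative_add_const bounded_linear_imp_has_derivative) (simp add: linear_conv_bounded_linear)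
    have "(moreau_env (X i) \<sigma> (h i) has_derivative (\<bullet>) (G i (q i w))) (at (q i w) within q i ` W)"
      unfolding G_def by (rule moreau_env_has_derivative[OF pcc[OF i] \<sigma>])
    from has_derivative_in_compose[OF d this] show ?thesis .
  qed
  have 3: "((\<lambda>w. snd w $ i) has_derivative (\<lambda>d. snd d $ i)) (at w within W)" for i
    by (intro bounded_linear_imp_has_derivative bounded_linear_compose[OF bounded_linear_vec_nth bounded_linear_snd])
  show "(Phi X I1 N h A b \<sigma> has_derivative (\<lambda>d. (\<Sum>i\<in>I1. H i (fst w $ i) \<bullet> fst d $ i)
      + (\<Sum>i\<in>- I1. G i (q i w) \<bullet> ql i d)
      - 1 / (2 * \<sigma>) * (\<Sum>i\<in>- I1. snd w $ i \<bullet> snd d $ i + snd d $ i \<bullet> snd w $ i))) (at w within W)"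
    unfolding Phi
    by (intro has_derivative_diff has_derivative_add has_derivative_sum has_derivative_mult_right
        has_derivative_inner 1 2 3) auto
  fix d assume d: "d \<in> W"
  have "1 / (2 * \<sigma>) * (\<Sum>i\<in>- I1. snd w $ i \<bullet> snd d $ i + snd d $ i \<bullet> snd w $ i)
      = (\<Sum>i\<in>- I1. (snd w $ i /\<^sub>R \<sigma>) \<bullet> snd d $ i)"
    using \<sigma> by (simp add: inner_commute sum_distrib_left field_simps)
  moreover have "(\<Sum>i\<in>- I1. p i w \<bullet> (ql i d + snd d $ i /\<^sub>R \<sigma>) + - ((p i w + snd w $ i) /\<^sub>R \<sigma>) \<bullet> snd d $ i)
      = (\<Sum>i\<in>- I1. G i (q i w) \<bullet> ql i d) - (\<Sum>i\<in>- I1. (snd w $ i /\<^sub>R \<sigma>) \<bullet> snd d $ i)"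
    unfolding sum_subtractf[symmetric]
    by (rule sum.cong) (auto simp: p_def inner_add_left inner_add_right algebra_simps)
  moreover have "(\<Sum>i\<in>I1. p i w \<bullet> fst d $ i) = (\<Sum>i\<in>I1. H i (fst w $ i) \<bullet> fst d $ i)"
    by (rule sum.cong) (auto simp: p_def)
  ultimately show "(\<Sum>i\<in>I1. H i (fst w $ i) \<bullet> fst d $ i) + (\<Sum>i\<in>- I1. G i (q i w) \<bullet> ql i d)
      - 1 / (2 * \<sigma>) * (\<Sum>i\<in>- I1. snd w $ i \<bullet> snd d $ i + snd d $ i \<bullet> snd w $ i)
      = assemble (\<lambda>i. p i w) (\<lambda>i. - ((p i w + snd w $ i) /\<^sub>R \<sigma>)) \<bullet> d"
    unfolding assemble_inner[OF d] by simp
qed (rule bounded_linear_inner_right)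

lemma F_map_eq:
  assumes w: "w \<in> W"
  shows "F_map X I1 N h A b \<sigma> w = Fe w"
proof -
  have "- ((p i w + snd w $ i) /\<^sub>R \<sigma>) \<in> X i" if "i \<notin> I1" for i
    by (intro subspace_neg subspace_scale subspace_add X p_in[OF w] W_D(3)[OF w that])
  then have "assemble (\<lambda>i. p i w) (\<lambda>i. - ((p i w + snd w $ i) /\<^sub>R \<sigma>)) \<in> W"
    by (intro assemble_in p_in[OF w])
  then have "gradient_on W (Phi X I1 N h A b \<sigma>) w = assemble (\<lambda>i. p i w) (\<lambda>i. - ((p i w + snd w $ i) /\<^sub>R \<sigma>))"
    by (rule gradient_on_eqI[OF subspace_W w _ Phi_has_derivative[OF w]])
  then show ?thesis by (simp add: F_map_def Fe_def assemble_def vec_eq_iff)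
qed

text \<open>The part of \<open>F v - F w\<close> that the dissipation \<open>(F v - F w) \<bullet> (v - w)\<close> controls.\<close>

definition ev :: "('a ^ 'n) \<times> ('a ^ 'n) \<Rightarrow> ('a ^ 'n) \<times> ('a ^ 'n) \<Rightarrow> 'a ^ 'n" where
  "ev v w = (\<chi> i. if i \<in> I1 then p i v - p i w else (p i v - p i w + (snd v $ i - snd w $ i)) /\<^sub>R \<sigma>)"

text \<open>The pairing is estimated block by block. Smooth blocks use cocoercivity of the gradients
  \<open>H i\<close>. In the others, cocoercivity of the envelope gradient supplies the squared norm
  of \<open>P i\<close> over \<open>\<sigma>\<close>, which completes the remaining terms to the
  square of \<open>P i + ?z\<close>.\<close>

lemma dissipation:
  "\<exists>c>0. \<forall>v\<in>W. \<forall>w\<in>W. c * (norm (ev v w))\<^sup>2 \<le> (Fe v - Fe w) \<bullet> (v - w)"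
proof -
  obtain L where L: "\<And>i. i \<in> I1 \<Longrightarrow> (L i)-lipschitz_on (X i) (H i)"
    using lipschitz_I1 unfolding H_def by metis
  \<comment> \<open>One positive Lipschitz constant for all smooth blocks; the summand 1 covers
    constant gradients and an empty \<open>I1\<close>.\<close>
  define K where "K = 1 + (\<Sum>i\<in>I1. L i)"
  have L0: "0 \<le> L i" if "i \<in> I1" for i using L[OF that] by (rule lipschitz_on_nonneg)
  have K: "K > 0" unfolding K_def using L0 by (intro add_pos_nonneg sum_nonneg) auto
  have LK: "K-lipschitz_on (X i) (H i)" if i: "i \<in> I1" for i
  proof -
    have "L i \<le> (\<Sum>i\<in>I1. L i)" using L0 i by (intro member_le_sum) auto
    then show ?thesis by (intro lipschitz_on_mono[OF L[OF i]]) (auto simp: K_def)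
  qed
  define c where "c = min \<sigma> (1 / (2 * K))"
  have "c * (norm (ev v w))\<^sup>2 \<le> (Fe v - Fe w) \<bullet> (v - w)" if v: "v \<in> W" and w: "w \<in> W" for v w
  proof -
    define P where "P i = p i v - p i w" for i
    define d where "d = v - w"
    have d: "d \<in> W" unfolding d_def using v w subspace_W by (simp add: subspace_diff)
    have "Fe v - Fe w = assemble P (\<lambda>i. (P i + snd d $ i) /\<^sub>R \<sigma>)"
      unfolding Fe_def assemble_diff
      by (intro arg_cong2[of _ _ _ _ assemble]) (auto simp: P_def d_def algebra_simps)
    then have F: "(Fe v - Fe w) \<bullet> (v - w) = (\<Sum>i\<in>I1. P i \<bullet> fst d $ i)
       + (\<Sum>i\<in>- I1. P i \<bullet> (ql i d + snd d $ i /\<^sub>R \<sigma>) + ((P i + snd d $ i) /\<^sub>R \<sigma>) \<bullet> snd d $ i)"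
      using assemble_inner[OF d] by (simp add: d_def)
    have 1: "c * (norm (ev v w $ i))\<^sup>2 \<le> P i \<bullet> fst d $ i" if i: "i \<in> I1" for i
    proof -
      have iN: "i \<noteq> N" using i N by auto
      have "c * (norm (P i))\<^sup>2 \<le> 1 / (2 * K) * (norm (P i))\<^sup>2" by (intro mult_right_mono) (auto simp: c_def)
      also have "\<dots> \<le> P i \<bullet> fst d $ i"
        using gradient_cocoercive[OF X W_D(1)[OF v iN] W_D(1)[OF w iN] H_works(1)[OF i] H_gradient_inequality[OF i] LK[OF i] K]
        by (simp add: P_def p_def i d_def)
      finally show ?thesis by (simp add: ev_def i P_def)
    qed
    have 2: "c * (norm (ev v w $ i))\<^sup>2
        \<le> P i \<bullet> (ql i d + snd d $ i /\<^sub>R \<sigma>) + ((P i + snd d $ i) /\<^sub>R \<sigma>) \<bullet> snd d $ i" if i: "i \<notin> I1" for i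
    proof -
      let ?z = "snd d $ i"
      have "(norm (P i))\<^sup>2 \<le> \<sigma> * (P i \<bullet> ql i d)"
        using moreau_gradient_cocoercive[OF pcc[OF i] \<sigma>, of "q i v" "q i w"]
        by (simp add: P_def p_def i G_def d_def flip: q_diff)
      then have co: "(norm (P i))\<^sup>2 / \<sigma> \<le> P i \<bullet> ql i d" using \<sigma> by (simp add: divide_le_eq mult.commute)
      have "c * (norm ((P i + ?z) /\<^sub>R \<sigma>))\<^sup>2 \<le> \<sigma> * (norm ((P i + ?z) /\<^sub>R \<sigma>))\<^sup>2"
        by (intro mult_right_mono) (auto simp: c_def)
      also have "\<dots> = (norm (P i + ?z))\<^sup>2 / \<sigma>"
        using \<sigma> by (simp add: power_mult_distrib power2_eq_square divide_inverse)
      also have "\<dots> = (norm (P i))\<^sup>2 / \<sigma> + 2 * (P i \<bullet> ?z) / \<sigma> + (?z \<bullet> ?z) / \<sigma>"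
        by (simp add: power2_norm_eq_inner inner_add_left inner_add_right inner_commute add_divide_distrib)
      also have "\<dots> \<le> P i \<bullet> ql i d + 2 * (P i \<bullet> ?z) / \<sigma> + (?z \<bullet> ?z) / \<sigma>" using co by simp
      also have "\<dots> = P i \<bullet> (ql i d + ?z /\<^sub>R \<sigma>) + ((P i + ?z) /\<^sub>R \<sigma>) \<bullet> ?z"
        by (simp add: inner_add_left inner_add_right divide_inverse algebra_simps)
      finally show ?thesis by (simp add: ev_def i P_def d_def)
    qed
    have "c * (norm (ev v w))\<^sup>2 = (\<Sum>i\<in>I1. c * (norm (ev v w $ i))\<^sup>2) + (\<Sum>i\<in>- I1. c * (norm (ev v w $ i))\<^sup>2)"
      unfolding power2_norm_vec sum_distrib_left
      by (subst sum.union_disjoint[symmetric]) (auto intro!: sum.cong)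
    also have "\<dots> \<le> (Fe v - Fe w) \<bullet> (v - w)"
      unfolding F using 1 2 by (intro add_mono sum_mono) auto
    finally show ?thesis .
  qed
  moreover have "c > 0" using \<sigma> K by (simp add: c_def)
  ultimately show ?thesis by blast
qed

lemma p_lipschitz: "\<exists>L. L-lipschitz_on W (p i)"
proof (cases "i \<in> I1")
  case True
  then have iN: "i \<noteq> N" using N by auto
  obtain L where L: "L-lipschitz_on (X i) (H i)" using lipschitz_I1[OF True] unfolding H_def by blast
  have "linear (\<lambda>w::('a ^ 'n) \<times> ('a ^ 'n). fst w $ i)" by (rule linearI) auto
  then obtain L' where L': "L'-lipschitz_on W (\<lambda>w. fst w $ i)" using linear_lipschitz_on by blast
  have "L-lipschitz_on ((\<lambda>w. fst w $ i) ` W) (H i)"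
    using W_D(1)[OF _ iN] by (intro lipschitz_on_subset[OF L]) auto
  from lipschitz_on_compose2[OF L' this] show ?thesis using True by (auto simp: p_def[abs_def])
next
  case False
  obtain L where L: "L-lipschitz_on W (ql i)" using linear_lipschitz_on[OF linear_ql] by blast
  have "L-lipschitz_on W (q i)"
    using L by (auto simp: lipschitz_on_def q_diff dist_norm linear_diff[OF linear_ql])
  moreover have "\<sigma>-lipschitz_on (q i ` W) (G i)"
    unfolding G_def by (rule moreau_gradient_lipschitz[OF pcc[OF False] \<sigma>])
  ultimately show ?thesis using lipschitz_on_compose2 False by (fastforce simp: p_def[abs_def])
qed

lemma Fe_lipschitz: "\<exists>L. L-lipschitz_on W Fe"
proof -
  have "\<exists>L. L-lipschitz_on W (\<lambda>w. fst (Fe w) $ i)" for i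
  proof (cases "i = N")
    case True
    then show ?thesis using lipschitz_on_constant by (auto simp: Fe_def assemble_def)
  next
    case False
    obtain L L' L'' where "L-lipschitz_on W (p i)" "L'-lipschitz_on W (p N)" "L''-lipschitz_on (p N ` W) (adj i)"
      using p_lipschitz linear_lipschitz_on[OF adj(1)[OF False]] by metis
    from lipschitz_on_diff[OF this(1) lipschitz_on_compose2[OF this(2,3)]]
    show ?thesis using False by (auto simp: Fe_def assemble_def)
  qed
  moreover have "\<exists>L. L-lipschitz_on W (\<lambda>w. snd (Fe w) $ i)" for i
  proof (cases "i \<in> I1")
    case True
    then show ?thesis using lipschitz_on_constant by (auto simp: Fe_def assemble_def)
  next
    case False
    have "linear (\<lambda>w::('a ^ 'n) \<times> ('a ^ 'n). snd w $ i)" by (rule linearI) auto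
    then obtain L L' where "L-lipschitz_on W (p i)" "L'-lipschitz_on W (\<lambda>w. snd w $ i)"
      using p_lipschitz linear_lipschitz_on by metis
    from lipschitz_on_cmult[OF lipschitz_on_add[OF this], of "inverse \<sigma>"]
    show ?thesis using False by (auto simp: Fe_def assemble_def)
  qed
  ultimately obtain L L' where "L-lipschitz_on W (\<lambda>w. fst (Fe w))" "L'-lipschitz_on W (\<lambda>w. snd (Fe w))"
    using lipschitz_on_vec by metis
  from lipschitz_on_Pair[OF this] show ?thesis by auto
qed

section \<open>The linear part of the saddle map\<close>

text \<open>On the nonsmooth blocks a difference of \<open>p i\<close> equals
  \<open>\<sigma>\<close> times the entry of \<open>ev\<close> minus the difference of
  \<open>z\<close>. Substituting this into \<open>Fe v - Fe w\<close> and discarding the entries of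
  \<open>ev\<close> leaves \<open>M (v - w)\<close>.\<close>

definition M :: "('a ^ 'n) \<times> ('a ^ 'n) \<Rightarrow> ('a ^ 'n) \<times> ('a ^ 'n)" where
  "M d = (\<chi> i. if i = N then 0 else adj i (snd d $ N) - (if i \<in> I1 then 0 else snd d $ i), 0)"

lemma linear_M: "linear M"
  by (rule linearI) (auto simp: M_def vec_eq_iff linear_add[OF adj(1)] linear_cmul[OF adj(1)] algebra_simps)

text \<open>Both quantities are linear images of \<open>ev v w\<close>. For the second this holds
  because \<open>M\<close> sees only the \<open>z\<close>-part, and the \<open>z\<close>-part of
  \<open>Fe v - Fe w\<close> consists of entries of \<open>ev v w\<close>.\<close>

lemma M_bounds:
  "\<exists>K. \<forall>v w. norm (Fe v - Fe w - M (v - w)) \<le> K * norm (ev v w) \<and> norm (M (Fe v - Fe w)) \<le> K * norm (ev v w)"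
proof -
  define T1 :: "'a ^ 'n \<Rightarrow> ('a ^ 'n) \<times> ('a ^ 'n)" where
    "T1 v = (\<chi> i. if i = N then 0 else (if i \<in> I1 then v $ i else \<sigma> *\<^sub>R v $ i) - \<sigma> *\<^sub>R adj i (v $ N),
             \<chi> i. if i \<in> I1 then 0 else v $ i)" for v
  define T2 :: "'a ^ 'n \<Rightarrow> ('a ^ 'n) \<times> ('a ^ 'n)" where
    "T2 v = (\<chi> i. if i = N then 0 else adj i (v $ N) - (if i \<in> I1 then 0 else v $ i), 0)" for v
  have "linear T1" "linear T2"
    by (rule linearI; auto simp: T1_def T2_def vec_eq_iff linear_add[OF adj(1)] linear_cmul[OF adj(1)] algebra_simps)+
  then obtain K1 K2 where K: "\<And>v. norm (T1 v) \<le> K1 * norm v" "\<And>v. norm (T2 v) \<le> K2 * norm v"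
    using linear_bounded by (metis mult.commute)
  have "Fe v - Fe w - M (v - w) = T1 (ev v w)" for v w
    using N \<sigma> by (auto simp: Fe_def assemble_diff assemble_def M_def T1_def ev_def vec_eq_iff algebra_simps
        linear_add[OF adj(1)] linear_diff[OF adj(1)] linear_cmul[OF adj(1)])
  moreover have "M (Fe v - Fe w) = T2 (ev v w)" for v w
    using N \<sigma> by (auto simp: Fe_def assemble_diff assemble_def M_def T2_def ev_def vec_eq_iff algebra_simps)
  moreover have "K1 * norm v \<le> max K1 K2 * norm v" "K2 * norm v \<le> max K1 K2 * norm v" for v :: "'a ^ 'n"
    by (auto intro: mult_right_mono)
  ultimately show ?thesis
    using order_trans[OF K(1)] order_trans[OF K(2)] by (intro exI[of _ "max K1 K2"]) simp
qed

section \<open>Uniform bound on the generalized Jacobians\<close>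

text \<open>Proximal maps of the conjugates are nonexpansive, so each \<open>D i\<close> has norm at
  most 1 on \<open>X i\<close>; Hessians are bounded by the Lipschitz constants of the gradients.
  Neither bound depends on the point.\<close>

lemma gen_jacobian_bound:
  "\<exists>K\<ge>0. \<forall>w\<in>W. \<forall>J\<in>gen_jacobian X I1 N h A b \<sigma> w. \<forall>d\<in>W. norm (J d) \<le> K * norm d"
proof -
  define s :: "('a ^ 'n) \<times> ('a ^ 'n) \<Rightarrow> 'a" where
    "s d = snd d $ N + \<sigma> *\<^sub>R (\<Sum>j\<in>UNIV - {N}. A j (fst d $ j))" for d
  have "linear s"
    by (rule linearI) (auto simp: s_def linear_add[OF A(1)] linear_cmul[OF A(1)] sum.distrib
      algebra_simps scaleR_sum_right)
  then obtain S where S: "0 < S" "\<And>d. norm (s d) \<le> S * norm d"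
    using linear_bounded_pos by (metis mult.commute)
  have "\<exists>B>0. \<forall>y. norm (adj i y) \<le> B * norm y" if "i \<noteq> N" for i
    using linear_bounded_pos[OF adj(1)[OF that]] by (metis mult.commute)
  then obtain B where B: "\<And>i. i \<noteq> N \<Longrightarrow> 0 < B i" "\<And>i y. i \<noteq> N \<Longrightarrow> norm (adj i y) \<le> B i * norm y"
    by metis
  obtain L where L: "\<And>i. i \<in> I1 \<Longrightarrow> (L i)-lipschitz_on (X i) (gradient_on (X i) (\<lambda>u. real_of_ereal (h i u)))"
    using lipschitz_I1 by metis
  \<comment> \<open>Bounds for the single components of \<open>J d\<close>, relative to the norm of
    \<open>d\<close>; \<open>S\<close> accounts for the argument of \<open>D N\<close> and
    \<open>B i\<close> for the adjoint.\<close>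
  define c1 where "c1 i = (if i = N then 0 else if i \<in> I1 then L i + B i * S else \<sigma> + 1 + B i * S)" for i
  define c2 where "c2 i = (if i = N then (1 + S) / \<sigma> else if i \<in> I1 then 0 else (\<sigma> + 2) / \<sigma>)" for i
  define K where "K = (\<Sum>i\<in>UNIV. c1 i) + (\<Sum>i\<in>UNIV. c2 i)"
  have "0 \<le> c1 i" "0 \<le> c2 i" for i
    using B(1)[of i] S(1) \<sigma> lipschitz_on_nonneg[OF L, of i] by (auto simp: c1_def c2_def)
  then have "0 \<le> K" unfolding K_def by (intro add_nonneg_nonneg sum_nonneg) auto
  moreover have "norm (J d) \<le> K * norm d"
    if w: "w \<in> W" and J: "J \<in> gen_jacobian X I1 N h A b \<sigma> w" and d: "d \<in> W" for w J d
  proof -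
    obtain D where JD: "J = jac_op X I1 N h A \<sigma> D w"
      and Di: "\<And>i. i \<notin> I1 \<Longrightarrow> i \<noteq> N \<Longrightarrow> D i \<in> clarke_jacobian (X i)
            (prox (X i) \<sigma> (fenchel_conjugate (X i) (h i))) (\<sigma> *\<^sub>R fst w $ i - snd w $ i)"
      and DN: "D N \<in> clarke_jacobian (X N) (prox (X N) \<sigma> (fenchel_conjugate (X N) (h N)))
            (\<sigma> *\<^sub>R b - snd w $ N - \<sigma> *\<^sub>R (\<Sum>j\<in>UNIV - {N}. A j (fst w $ j)))"
      using J by (auto simp: gen_jacobian_def split_beta)
    have D: "norm (blinfun_apply (D i) v) \<le> norm v" if "i \<notin> I1" "v \<in> X i" for i v
    proof -
      have lip: "1-lipschitz_on (X i) (prox (X i) \<sigma> (fenchel_conjugate (X i) (h i)))"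
        by (rule prox_nonexpansive[OF proper_closed_convex_fenchel_conjugate[OF X pcc[OF that(1)]] \<sigma>])
      show ?thesis
        using clarke_jacobian_bound[OF X that(2) lip] Di[OF that(1)] DN by (cases "i = N") auto
    qed
    note dW = W_D[OF d]
    have n1: "norm (fst d $ i) \<le> norm d" and n2: "norm (snd d $ i) \<le> norm d" for i
      using order_trans[OF Finite_Cartesian_Product.norm_nth_le[of "fst d" i] norm_fst_le[of "fst d" "snd d"]]
        order_trans[OF Finite_Cartesian_Product.norm_nth_le[of "snd d" i] norm_snd_le[of "snd d" "fst d"]]
      by simp_all
    have "(\<Sum>j\<in>UNIV - {N}. A j (fst d $ j)) \<in> X N"
      by (rule subspace_sum[OF X]) (simp add: A(2) dW(1))
    then have sX: "s d \<in> X N" unfolding s_def using X dW(3)[OF N] by (simp add: subspace_add subspace_scale)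
    have Ds: "norm (blinfun_apply (D N) (s d)) \<le> S * norm d" using D[OF N sX] S(2) order_trans by blast
    have adjs: "norm (adj i (blinfun_apply (D N) (s d))) \<le> B i * (S * norm d)" if "i \<noteq> N" for i
      using B(2)[OF that, of "blinfun_apply (D N) (s d)"] mult_left_mono[OF Ds, of "B i"] B(1)[OF that] by linarith
    have Dd: "norm (blinfun_apply (D i) (\<sigma> *\<^sub>R fst d $ i - snd d $ i)) \<le> (\<sigma> + 1) * norm d"
      if "i \<notin> I1" "i \<noteq> N" for i
    proof -
      have "\<sigma> *\<^sub>R fst d $ i - snd d $ i \<in> X i"
        using dW(1)[OF that(2)] dW(3)[OF that(1)] X by (simp add: subspace_diff subspace_scale)
      then have "norm (blinfun_apply (D i) (\<sigma> *\<^sub>R fst d $ i - snd d $ i)) \<le> norm (\<sigma> *\<^sub>R fst d $ i - snd d $ i)"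
        by (rule D[OF that(1)])
      also have "\<dots> \<le> \<sigma> * norm (fst d $ i) + norm (snd d $ i)"
        using norm_triangle_ineq4[of "\<sigma> *\<^sub>R fst d $ i" "snd d $ i"] \<sigma> by simp
      also have "\<dots> \<le> \<sigma> * norm d + norm d" using n1 n2 \<sigma> by (intro add_mono mult_left_mono) auto
      finally show ?thesis by (simp add: distrib_right)
    qed
    have fstJ: "fst (J d) $ i = (if i = N then 0 else if i \<in> I1
        then blinfun_apply (hessian_on (X i) (\<lambda>u. real_of_ereal (h i u)) (fst w $ i)) (fst d $ i)
           + adj i (blinfun_apply (D N) (s d))
        else blinfun_apply (D i) (\<sigma> *\<^sub>R fst d $ i - snd d $ i) + adj i (blinfun_apply (D N) (s d)))" for i
      unfolding JD jac_op_def adj_def s_def by (simp add: split_beta Let_def)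
    have sndJ: "snd (J d) $ i = (if i = N then snd d $ N /\<^sub>R \<sigma> - blinfun_apply (D N) (s d) /\<^sub>R \<sigma>
        else if i \<in> I1 then 0
        else snd d $ i /\<^sub>R \<sigma> + blinfun_apply (D i) (\<sigma> *\<^sub>R fst d $ i - snd d $ i) /\<^sub>R \<sigma>)" for i
      unfolding JD jac_op_def s_def by (simp add: split_beta Let_def)
    have 1: "norm (fst (J d) $ i) \<le> c1 i * norm d" for i
    proof (cases "i = N")
      case True
      then show ?thesis by (simp add: fstJ c1_def)
    next
      case iN: False
      show ?thesis
      proof (cases "i \<in> I1")
        case True
        have "norm (blinfun_apply (hessian_on (X i) (\<lambda>u. real_of_ereal (h i u)) (fst w $ i)) (fst d $ i))
            \<le> L i * norm (fst d $ i)"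
          by (rule hessian_on_bound[OF X W_D(1)[OF w iN] dW(1)[OF iN] C2_I1[OF True] L[OF True]])
        also have "\<dots> \<le> L i * norm d"
          using n1 lipschitz_on_nonneg[OF L[OF True]] by (rule mult_left_mono)
        finally show ?thesis
          using norm_triangle_le[OF add_mono[OF _ adjs[OF iN]]] True iN by (simp add: fstJ c1_def distrib_right mult.assoc)
      next
        case False
        show ?thesis
          using norm_triangle_le[OF add_mono[OF Dd[OF False iN] adjs[OF iN]]] False iN
          by (simp add: fstJ c1_def distrib_right mult.assoc)
      qed
    qed
    have 2: "norm (snd (J d) $ i) \<le> c2 i * norm d" for i
    proof (cases "i = N")
      case True
      have "norm (snd d $ N - blinfun_apply (D N) (s d)) \<le> norm d + S * norm d"
        using norm_triangle_ineq4[of "snd d $ N" "blinfun_apply (D N) (s d)"] n2[of N] Ds by linarith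
      then have "norm ((snd d $ N - blinfun_apply (D N) (s d)) /\<^sub>R \<sigma>) \<le> (norm d + S * norm d) / \<sigma>"
        using \<sigma> by (simp add: divide_inverse mult.commute mult_left_mono)
      then show ?thesis using True by (simp add: sndJ c2_def scaleR_diff_right distrib_right add_divide_distrib)
    next
      case iN: False
      show ?thesis
      proof (cases "i \<in> I1")
        case True
        then show ?thesis using iN by (simp add: sndJ c2_def)
      next
        case False
        let ?v = "blinfun_apply (D i) (\<sigma> *\<^sub>R fst d $ i - snd d $ i)"
        have "norm (snd d $ i + ?v) \<le> norm d + (\<sigma> + 1) * norm d"
          using norm_triangle_ineq[of "snd d $ i" ?v] n2[of i] Dd[OF False iN] by linarith
        then have "norm (snd d $ i + ?v) \<le> (\<sigma> + 2) * norm d" by (simp add: algebra_simps)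
        then have "norm ((snd d $ i + ?v) /\<^sub>R \<sigma>) \<le> (\<sigma> + 2) * norm d / \<sigma>"
          using \<sigma> by (simp add: divide_inverse mult.commute mult_left_mono)
        then show ?thesis using False iN by (simp add: sndJ c2_def scaleR_add_right)
      qed
    qed
    have "norm (J d) \<le> norm (fst (J d)) + norm (snd (J d))"
      using norm_Pair_le[of "fst (J d)" "snd (J d)"] by simp
    also have "\<dots> \<le> (\<Sum>i\<in>UNIV. norm (fst (J d) $ i)) + (\<Sum>i\<in>UNIV. norm (snd (J d) $ i))"
      by (intro add_mono norm_vec_le_sum)
    also have "\<dots> \<le> (\<Sum>i\<in>UNIV. c1 i * norm d) + (\<Sum>i\<in>UNIV. c2 i * norm d)"
      by (intro add_mono sum_mono 1 2)
    also have "\<dots> = K * norm d" by (simp add: K_def distrib_right sum_distrib_right)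
    finally show ?thesis .
  qed
  ultimately show ?thesis by blast
qed

section \<open>A zero of the saddle map from optimality\<close>

text \<open>A short move along \<open>d = g - H i u\<close> compares \<open>g\<close> with the
  gradient at the new point. By Lipschitz continuity that gradient differs from \<open>H i u\<close>
  by less than the norm of \<open>d\<close>, unless \<open>d\<close> vanishes.\<close>

lemma H_eq_subgradient:
  assumes i: "i \<in> I1" and u: "u \<in> X i" and g: "g \<in> X i"
    and sub: "\<And>v. v \<in> X i \<Longrightarrow> real_of_ereal (h i u) + g \<bullet> (v - u) \<le> real_of_ereal (h i v)"
  shows "H i u = g"
proof -
  obtain L where L: "L-lipschitz_on (X i) (H i)" using lipschitz_I1[OF i] unfolding H_def by blast
  define d where "d = g - H i u"
  \<comment> \<open>With \<open>L + 1\<close> instead of \<open>L\<close>, the choice is valid for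
    \<open>L = 0\<close> as well and gives \<open>L * t < 1\<close>.\<close>
  define t where "t = 1 / (2 * (L + 1))"
  have L0: "0 \<le> L" by (rule lipschitz_on_nonneg[OF L])
  then have t: "0 < t" "L * t < 1" by (auto simp: t_def field_simps)
  have v: "u + t *\<^sub>R d \<in> X i"
    unfolding d_def using u g H_works(1)[OF i u] X by (simp add: subspace_add subspace_diff subspace_scale)
  have "t * (g \<bullet> d) \<le> t * (H i (u + t *\<^sub>R d) \<bullet> d)"
    using sub[OF v] H_gradient_inequality[OF i v u] by simp
  then have "g \<bullet> d \<le> H i (u + t *\<^sub>R d) \<bullet> d" using t by simp
  then have "d \<bullet> d \<le> (H i (u + t *\<^sub>R d) - H i u) \<bullet> d" by (simp add: d_def inner_diff_left)
  also have "\<dots> \<le> norm (H i (u + t *\<^sub>R d) - H i u) * norm d" by (rule norm_cauchy_schwarz)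
  also have "\<dots> \<le> (L * (t * norm d)) * norm d"
    using lipschitz_on_normD[OF L v u] t by (intro mult_right_mono) auto
  finally have "(1 - L * t) * (d \<bullet> d) \<le> 0"
    by (simp add: power2_norm_eq_inner[symmetric] power2_eq_square algebra_simps)
  then have "d \<bullet> d \<le> 0" using t by (simp add: mult_le_0_iff)
  then have "d = 0" by (meson inner_gt_zero_iff not_le)
  then show ?thesis by (simp add: d_def)
qed

text \<open>The zero pairs the optimal solution with the negatives of the subgradients that a
  Lagrange multiplier \<open>y\<close> induces: \<open>y\<close> itself for block \<open>N\<close>,
  its image under \<open>adj i\<close> for the others.\<close>

lemma Fe_zero_exists:
  assumes opt: "optimal_solution X N h A b xo"
    and xs: "\<And>i. xs $ i \<in> rel_interior (dom_on (X i) (h i))"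
      "(\<Sum>i\<in>UNIV - {N}. A i (xs $ i)) + xs $ N = b"
  shows "\<exists>ws\<in>W. Fe ws = 0"
proof -
  define f where "f i u = real_of_ereal (h i u)" for i u
  define B where "B i = (if i = N then (\<lambda>u. u) else A i)" for i
  have B: "linear (B i)" for i using A(1)[of i] by (auto simp: B_def linear_ident)
  have sumB: "(\<Sum>i\<in>UNIV. B i (x i)) = (\<Sum>i\<in>UNIV - {N}. A i (x i)) + x N" for x
    by (simp add: sum.remove[of UNIV N] B_def)
  have dom: "dom_on (X i) (h i) = X i" if "i \<in> I1" for i
    using finite_I1[OF that] by (force simp: dom_on_def)
  have hf: "ereal (f i u) = h i u" if "u \<in> dom_on (X i) (h i)" for i u
    using that finite_I1[of i u] dom_on_ereal[OF pcc, of i u] dom[of i]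
    by (cases "i \<in> I1") (auto simp: f_def ereal_real)
  have cv: "convex_on (dom_on (X i) (h i)) (f i)" for i
    using convex_I1[of i] convex_on_dom_on[OF pcc, of i] dom[of i] by (cases "i \<in> I1") (auto simp: f_def[abs_def])
  have hsum: "(\<Sum>i\<in>UNIV. h i (x $ i)) = ereal (\<Sum>i\<in>UNIV. f i (x $ i))"
    if "\<And>i. x $ i \<in> dom_on (X i) (h i)" for x
    using hf[OF that] by (simp flip: sum_ereal)
  have feas: "feasible X N A b x \<longleftrightarrow> (\<forall>i. x $ i \<in> X i) \<and> (\<Sum>i\<in>UNIV. B i (x $ i)) = b" for x
    by (simp add: feasible_def sumB)
  have xsd: "xs $ i \<in> dom_on (X i) (h i)" for i using xs(1) rel_interior_subset by blast
  have xsB: "(\<Sum>i\<in>UNIV. B i (xs $ i)) = b" using xs(2) by (simp add: sumB)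
  have xof: "feasible X N A b xo"
    and min: "\<And>x. feasible X N A b x \<Longrightarrow> (\<Sum>i\<in>UNIV. h i (xo $ i)) \<le> (\<Sum>i\<in>UNIV. h i (x $ i))"
    using opt by (auto simp: optimal_solution_def is_arg_min_def not_less)
  have "(\<Sum>i\<in>UNIV. h i (xo $ i)) \<le> ereal (\<Sum>i\<in>UNIV. f i (xs $ i))"
    unfolding hsum[OF xsd, symmetric] using xsd xsB by (intro min) (auto simp: feas dom_on_def)
  \<comment> \<open>The Slater point has a finite objective value, so each summand at the optimum is
    finite.\<close>
  then have "(\<Sum>i\<in>UNIV. h i (xo $ i)) \<noteq> \<infinity>" by auto
  then have xod: "xo $ i \<in> dom_on (X i) (h i)" for i
    using xof by (auto simp: sum_Pinfty dom_on_def feas less_top[symmetric])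
  have xoB: "(\<Sum>i\<in>UNIV. B i (xo $ i)) = b" using xof by (simp add: feas)
  have "\<exists>y. \<forall>i. \<forall>u\<in>dom_on (X i) (h i). f i (xo $ i) + y \<bullet> B i (u - xo $ i) \<le> f i u"
  proof (rule lagrange_multiplier_exists[OF cv B xs(1) xsB xod xoB])
    fix x assume x: "\<And>i. x i \<in> dom_on (X i) (h i)" "(\<Sum>i\<in>UNIV. B i (x i)) = b"
    let ?x = "\<chi> i. x i"
    have "(\<Sum>i\<in>UNIV. h i (xo $ i)) \<le> (\<Sum>i\<in>UNIV. h i (?x $ i))"
      using x by (intro min) (auto simp: feas dom_on_def)
    then show "(\<Sum>i\<in>UNIV. f i (xo $ i)) \<le> (\<Sum>i\<in>UNIV. f i (x i))"
      using hsum[OF xod] hsum[of ?x] x by simp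
  qed
  then obtain y0 where y0: "\<And>i u. u \<in> dom_on (X i) (h i) \<Longrightarrow> f i (xo $ i) + y0 \<bullet> B i (u - xo $ i) \<le> f i u"
    by blast
  \<comment> \<open>The multiplier found in the ambient space may leave \<open>X N\<close>; its
    projection acts identically on \<open>X N\<close>.\<close>
  define y where "y = adjoint_on (X N) (\<lambda>u. u) y0"
  have yX: "y \<in> X N" unfolding y_def by (rule adjoint_on_in[OF X linear_ident])
  have yy: "y0 \<bullet> u = y \<bullet> u" if "u \<in> X N" for u
    using adjoint_on_works[OF X linear_ident that, of y0] by (simp add: y_def inner_commute)
  define g where "g i = (if i = N then y else adj i y)" for i
  have gX: "g i \<in> X i" for i unfolding g_def using yX adj(2) by auto
  have xoX: "xo $ i \<in> X i" for i using xod by (simp add: dom_on_def)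
  have sub: "f i (xo $ i) + g i \<bullet> (u - xo $ i) \<le> f i u" if u: "u \<in> dom_on (X i) (h i)" for i u
  proof -
    have uX: "u - xo $ i \<in> X i" using u xoX X by (auto simp: dom_on_def intro: subspace_diff)
    have "y0 \<bullet> B i (u - xo $ i) = g i \<bullet> (u - xo $ i)"
    proof (cases "i = N")
      case True
      then show ?thesis using yy uX by (simp add: B_def g_def)
    next
      case False
      have "y0 \<bullet> A i (u - xo $ i) = y \<bullet> A i (u - xo $ i)" by (rule yy[OF A(2)[OF False uX]])
      then show ?thesis using adj(3)[OF False uX, of y] False by (simp add: B_def g_def inner_commute)
    qed
    then show ?thesis using y0[OF u] by simp
  qed
  define ws :: "('a ^ 'n) \<times> ('a ^ 'n)" where
    "ws = (\<chi> i. if i = N then 0 else xo $ i, \<chi> i. if i \<in> I1 then 0 else - g i)"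
  have W: "ws \<in> W" using N xoX gX X by (auto simp: ws_def pd_space_def subspace_neg)
  have pg: "p i ws = g i" for i
  proof (cases "i \<in> I1")
    case True
    then have "i \<noteq> N" using N by auto
    then show ?thesis
      using H_eq_subgradient[OF True xoX gX] sub[of _ i] dom[OF True] True by (simp add: p_def ws_def f_def)
  next
    case False
    have xN: "b - (\<Sum>j\<in>UNIV - {N}. A j (xo $ j)) = xo $ N" using xoB by (simp add: sumB algebra_simps)
    have "(\<Sum>j\<in>UNIV - {N}. A j (fst ws $ j)) = (\<Sum>j\<in>UNIV - {N}. A j (xo $ j))"
      by (rule sum.cong) (auto simp: ws_def)
    \<comment> \<open>At \<open>N\<close> the constraint turns the envelope argument into that of
      the other blocks. The subgradient inequality then identifies \<open>xo $ i\<close> as the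
      proximal point, and \<open>G i\<close> returns \<open>g i\<close>.\<close>
    then have q: "q i ws = xo $ i + g i /\<^sub>R \<sigma>"
      using False N xN by (auto simp: q_def ql_def ws_def)
    have "prox (X i) (1 / \<sigma>) (h i) (q i ws) = xo $ i"
    proof (rule prox_eqI[OF pcc[OF False]])
      show "subgradient_on (X i) (h i) (xo $ i) ((q i ws - xo $ i) /\<^sub>R (1 / \<sigma>))"
        using sub[of _ i] xod \<sigma> by (simp add: q subgradient_on_def f_def)
    qed (use \<sigma> in simp)
    then show ?thesis using False \<sigma> by (simp add: p_def G_def q)
  qed
  have "Fe ws = 0"
    unfolding Fe_def assemble_def pg using N by (auto simp: vec_eq_iff zero_prod_def g_def ws_def)
  then show ?thesis using W by blast
qed

end

theorem theorem4p1:
  fixes X :: "'n::finite \<Rightarrow> 'a::euclidean_space set"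
    and I1 :: "'n set" and N :: 'n
    and h :: "'n \<Rightarrow> 'a \<Rightarrow> ereal"
    and A :: "'n \<Rightarrow> 'a \<Rightarrow> 'a" and b :: 'a
    and \<sigma> \<gamma> \<nu> \<beta> \<kappa> :: real and \<zeta> :: nat
    and w :: "nat \<Rightarrow> ('a ^ 'n) \<times> ('a ^ 'n)"
  assumes "N \<notin> I1"
    and "\<And>i. subspace (X i)"
    and "\<And>i. i \<noteq> N \<Longrightarrow> linear (A i) \<and> A i ` X i \<subseteq> X N"
    and "b \<in> X N"
    and "\<And>i. i \<in> I1 \<Longrightarrow>
           (\<forall>u\<in>X i. \<bar>h i u\<bar> \<noteq> \<infinity>) \<and>
           convex_on (X i) (\<lambda>u. real_of_ereal (h i u)) \<and>
           C2_on (X i) (\<lambda>u. real_of_ereal (h i u)) \<and>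
           (\<exists>L. L-lipschitz_on (X i) (gradient_on (X i) (\<lambda>u. real_of_ereal (h i u))))"
    and "\<And>i. i \<notin> I1 \<Longrightarrow> proper_closed_convex_on (X i) (h i)"
    and "\<And>i. semismooth_on (X i) (prox (X i) 1 (h i))"
    and "\<sigma> > 0"
    and "\<gamma> > 1" and "0 < \<nu>" "\<nu> < 1" and "1 / 2 < \<beta>" "\<beta> \<le> 1" and "\<kappa> > 0" and "\<zeta> \<ge> 1"
    and "\<exists>x. optimal_solution X N h A b x"
    and "\<exists>x. (\<forall>i. x $ i \<in> rel_interior (dom_on (X i) (h i))) \<and>
             (\<Sum>i\<in>UNIV - {N}. A i (x $ i)) + x $ N = b"
    and "ALPDSN_sequence (pd_space X I1 N) (F_map X I1 N h A b \<sigma>) (gen_jacobian X I1 N h A b \<sigma>)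
           \<gamma> \<nu> \<beta> \<kappa> \<zeta> w"
    and "\<And>k. F_map X I1 N h A b \<sigma> (w k) \<noteq> 0"
  shows "(\<lambda>k. F_map X I1 N h A b \<sigma> (w k)) \<longlonglongrightarrow> 0"
proof -
  interpret saddle_problem X I1 N h A b \<sigma>
  proof (rule saddle_problem.intro)
    show "\<And>i. i \<noteq> N \<Longrightarrow> linear (A i)" "\<And>i u. i \<noteq> N \<Longrightarrow> u \<in> X i \<Longrightarrow> A i u \<in> X N"
      using assms(3) by auto
    show "\<And>i u. i \<in> I1 \<Longrightarrow> u \<in> X i \<Longrightarrow> \<bar>h i u\<bar> \<noteq> \<infinity>"
      "\<And>i. i \<in> I1 \<Longrightarrow> convex_on (X i) (\<lambda>u. real_of_ereal (h i u))"
      "\<And>i. i \<in> I1 \<Longrightarrow> C2_on (X i) (\<lambda>u. real_of_ereal (h i u))"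
      "\<And>i. i \<in> I1 \<Longrightarrow>
        \<exists>L. L-lipschitz_on (X i) (gradient_on (X i) (\<lambda>u. real_of_ereal (h i u)))"
      using assms(5) by simp_all
  qed (fact assms(1,2,4,6,8))+
  obtain xo xs where "optimal_solution X N h A b xo"
    and "\<And>i. xs $ i \<in> rel_interior (dom_on (X i) (h i))"
    and "(\<Sum>i\<in>UNIV - {N}. A i (xs $ i)) + xs $ N = b"
    using assms(16,17) by metis
  from Fe_zero_exists[OF this] obtain ws where ws: "ws \<in> W" "Fe ws = 0" by blast
  obtain c where c: "0 < c" "\<And>v w. v \<in> W \<Longrightarrow> w \<in> W \<Longrightarrow> c * (norm (ev v w))\<^sup>2 \<le> (Fe v - Fe w) \<bullet> (v - w)"
    using dissipation by blast
  obtain K where K: "\<And>v w. norm (Fe v - Fe w - M (v - w)) \<le> K * norm (ev v w)"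
      "\<And>v w. norm (M (Fe v - Fe w)) \<le> K * norm (ev v w)"
    using M_bounds by blast
  obtain L1 where L1: "L1-lipschitz_on W Fe" using Fe_lipschitz by blast
  obtain L2 where L2: "0 \<le> L2" "\<And>w J d. w \<in> W \<Longrightarrow> J \<in> gen_jacobian X I1 N h A b \<sigma> w \<Longrightarrow> d \<in> W \<Longrightarrow>
      norm (J d) \<le> L2 * norm d"
    using gen_jacobian_bound by blast
  define L where "L = max L1 L2"
  \<comment> \<open>Squaring the bounds by \<open>K * norm (ev v ws)\<close> and inserting the
    dissipation inequality with constant \<open>c\<close> produces this factor.\<close>
  define C where "C = K\<^sup>2 / c"
  have sq: "x\<^sup>2 \<le> C * (Fe v \<bullet> (v - ws))" if "v \<in> W" "0 \<le> x" "x \<le> K * norm (ev v ws)" for v x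
  proof -
    have "x\<^sup>2 \<le> C * (c * (norm (ev v ws))\<^sup>2)"
      using power_mono[OF that(3,2), of 2] c(1) by (simp add: C_def power_mult_distrib)
    also have "\<dots> \<le> C * (Fe v \<bullet> (v - ws))"
      using c(2)[OF that(1) ws(1)] c(1) ws(2) by (intro mult_left_mono) (auto simp: C_def)
    finally show ?thesis .
  qed
  show ?thesis
  proof (rule ALPDSN_residual_tendsto_0[where W = W and F = "F_map X I1 N h A b \<sigma>" and w = w
        and M = M and C = C and ws = ws and L = L])
    show "subspace W" by (rule subspace_W)
    show "linear M" by (rule linear_M)
    show "0 \<le> L" "0 \<le> C" using L2(1) c(1) by (auto simp: L_def C_def)
    show "norm (F_map X I1 N h A b \<sigma> u - F_map X I1 N h A b \<sigma> v) \<le> L * norm (u - v)"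
      if "u \<in> W" "v \<in> W" for u v
    proof -
      have "norm (Fe u - Fe v) \<le> L1 * norm (u - v)" by (rule lipschitz_on_normD[OF L1 that])
      also have "\<dots> \<le> L * norm (u - v)" by (intro mult_right_mono) (auto simp: L_def)
      finally show ?thesis using that by (simp add: F_map_eq)
    qed
    show "0 \<le> (F_map X I1 N h A b \<sigma> u - F_map X I1 N h A b \<sigma> v) \<bullet> (u - v)"
      if "u \<in> W" "v \<in> W" for u v
    proof -
      have "0 \<le> c * (norm (ev u v))\<^sup>2" using c(1) by simp
      also have "\<dots> \<le> (Fe u - Fe v) \<bullet> (u - v)" by (rule c(2)[OF that])
      finally show ?thesis using that by (simp add: F_map_eq)
    qed
    show "norm (J d) \<le> L * norm d"
      if "u \<in> W" "J \<in> gen_jacobian X I1 N h A b \<sigma> u" "d \<in> W" for u J d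
    proof -
      have "norm (J d) \<le> L2 * norm d" by (rule L2(2)[OF that])
      also have "\<dots> \<le> L * norm d" by (intro mult_right_mono) (auto simp: L_def)
      finally show ?thesis .
    qed
    show "ws \<in> W" "F_map X I1 N h A b \<sigma> ws = 0" using ws by (simp_all add: F_map_eq)
    show "(norm (F_map X I1 N h A b \<sigma> u - M (u - ws)))\<^sup>2 \<le> C * (F_map X I1 N h A b \<sigma> u \<bullet> (u - ws))"
      if "u \<in> W" for u
      using sq[OF that norm_ge_zero K(1)[of u ws, unfolded ws(2)]] that by (simp add: F_map_eq)
    show "(norm (M (F_map X I1 N h A b \<sigma> u)))\<^sup>2 \<le> C * (F_map X I1 N h A b \<sigma> u \<bullet> (u - ws))"
      if "u \<in> W" for u
      using sq[OF that norm_ge_zero K(2)[of u ws, unfolded ws(2)]] that by (simp add: F_map_eq)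
  qed (fact assms)+
qed

end
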